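(* Consider the $k$-heavy-tailed private stochastic convex optimization setting in the context, let $\rho \ge 0$ and $x^\star \defeq \arg\min_{x \in \mathcal{X}} F_{\mathcal{P}}(x)$. Assume $\mathcal{S} \subseteq \mathbb{R}^d$ and that there is a convex function $\sigma: \mathbb{R} \to \mathbb{R}$ with $f(x; s) = \sigma(\langle s, x\rangle)$ for all $s \in \mathcal{S}$, $x \in \mathcal{X}$. Assume further that $f(\cdot; s)$ is $\beta$-smooth (i.e. $\|\nabla f(x;s) - \nabla f(x';s)\| \le \beta\|x - x'\|$) for all $s \in \mathcal{S}$, where \[\beta \le \max\left(\sqrt{\frac n 2} \cdot \frac {G_2} D,\; n \cdot \left(\frac{d}{n^2\rho}\right)^{\frac{k - 1}{2k}} \cdot \frac{G_k}{D}\right).\] Then there is a $\rho$-CDP algorithm (a one-pass clipped stochastic gradient method with geometrically decreasing phases and Gaussian noise added at the end of each phase) which draws $\mathcal{D} \sim \mathcal{P}^n$, queries $n$ sample gradients (using samples in $\mathcal{D}$), and outputs $x_I \in \mathcal{X}$ satisfying \[\mathbb{E}\left[F_{\mathcal{P}}(x_I) - F_{\mathcal{P}}(x^\star)\right] \le 4G_2 D \sqrt{\frac 1 n} + 26G_k D\left(\frac{\sqrt d}{n\sqrt{\rho}}\right)^{1 - \frac 1 k}.\]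
   Context: $\|\cdot\|$ is the Euclidean norm. Let $\mathcal{X} \subset \mathbb{R}^d$ be compact and convex with diameter $D$. Let $\mathcal{P}$ be a distribution over a sample space $\mathcal{S}$ such that each $s$ induces a continuously differentiable convex $f(\cdot; s): \mathcal{X} \to \mathbb{R}$, with $L_s \defeq \max_{x \in \mathcal{X}}\|\nabla f(x;s)\|$ (unknown). For an integer $k \ge 2$ and nondecreasing $G_1 \le \dots \le G_k$, assume $\mathbb{E}_{s \sim \mathcal{P}}[L_s^j] \le G_j^j < \infty$ for $j \in \{1,\dots,k\}$. $F_{\mathcal{P}}(x) \defeq \mathbb{E}_{s\sim\mathcal{P}}[f(x;s)]$. "Queries $N$ sample gradients" means queries $\nabla f(x;s)$ for $N$ distinct pairs $(x,s)$. Neighboring datasets have the same size and differ in one entry. With Rényi divergence $D_\alpha(\mu\|\nu)=\frac{1}{\alpha-1}\log\int(\mu/\nu)^\alpha d\nu$, an algorithm $M$ is $\rho$-CDP if $D_\alpha(M(\mathcal{D})\|M(\mathcal{D}'))\le \alpha\rho$ for all neighboring $\mathcal{D},\mathcal{D}'$ and all $\alpha\ge 1$. *)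

theory Defs
  imports "HOL-Probability.Probability"
begin

text \<open>
  Differentiating \<open>h\<close> within a convex set \<open>X\<close> determines a gradient only up to vectors orthogonal to
  the affine hull of \<open>X\<close>; the representative parallel to that hull is taken.  Where \<open>x\<close> is an
  interior point of \<open>X\<close> this is the usual gradient (\<open>grad_on_eq_GDERIV\<close> below); on the
  boundary it needs no values of \<open>h\<close> outside \<open>X\<close>.
\<close>

definition grad_on :: "'a::euclidean_space set \<Rightarrow> ('a \<Rightarrow> real) \<Rightarrow> 'a \<Rightarrow> 'a" where
  "grad_on X h x =
     (THE v. v \<in> span ((\<lambda>y. y - x) ` X) \<and> (h has_derivative (\<lambda>u. v \<bullet> u)) (at x within X))"

lemma grad_on_eq_GDERIV:
  assumes x: "x \<in> interior X" and h: "GDERIV h x :> v"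
  shows "grad_on X h x = v"
proof -
  obtain e where e: "e > 0" "cball x e \<subseteq> X"
    using x mem_interior_cball by blast
  have at: "at x within X = at x"
    by (rule at_within_interior[OF x])
  have span: "u \<in> span ((\<lambda>y. y - x) ` X)" for u
  proof (cases "u = 0")
    case False
    define y where "y = x + (e / norm u) *\<^sub>R u"
    have "y \<in> cball x e"
      using e(1) False by (simp add: y_def dist_norm)
    then have "y - x \<in> span ((\<lambda>y. y - x) ` X)"
      by (intro span_base imageI subsetD[OF e(2)])
    from span_scale[OF this, of "norm u / e"] show ?thesis
      using e(1) False by (simp add: y_def)
  qed (simp add: span_zero)
  have inner: "(\<lambda>u. v \<bullet> u) = (\<lambda>u. u \<bullet> v)"
    by (rule ext) (rule inner_commute)
  have unique: "w = v" if "(h has_derivative (\<lambda>u. w \<bullet> u)) (at x)" for w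
  proof -
    have "(\<lambda>u. w \<bullet> u) = (\<lambda>u. v \<bullet> u)"
      unfolding inner by (rule has_derivative_unique[OF that h[unfolded gderiv_def]])
    then have "\<forall>u. w \<bullet> u = v \<bullet> u"
      by (intro allI) (rule fun_cong)
    then show ?thesis
      by (rule iffD1[OF vector_eq_rdot])
  qed
  have "(h has_derivative (\<lambda>u. v \<bullet> u)) (at x)"
    unfolding inner by (rule h[unfolded gderiv_def])
  then show ?thesis
    unfolding grad_on_def at using span[of v] unique by (intro the_equality conjI) (assumption | elim conjE)+
qed

definition C1_on :: "'a::euclidean_space set \<Rightarrow> ('a \<Rightarrow> real) \<Rightarrow> bool" where
  "C1_on X h \<longleftrightarrow> h differentiable_on X \<and> continuous_on X (grad_on X h)"

definition sample_grad :: "'a::euclidean_space set \<Rightarrow> ('a \<Rightarrow> 's \<Rightarrow> real) \<Rightarrow> 'a \<Rightarrow> 's \<Rightarrow> 'a" where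
  "sample_grad X f x s = grad_on X (\<lambda>y. f y s) x"

definition smooth_on :: "'a::euclidean_space set \<Rightarrow> real \<Rightarrow> ('a \<Rightarrow> real) \<Rightarrow> bool" where
  "smooth_on X \<beta> h \<longleftrightarrow>
     (\<forall>x\<in>X. \<forall>x'\<in>X. norm (grad_on X h x - grad_on X h x') \<le> \<beta> * norm (x - x'))"

text \<open>For compact nonempty \<open>X\<close> and continuously differentiable \<open>f\<close> the supremum is a maximum.\<close>

definition sample_lip :: "'a::euclidean_space set \<Rightarrow> ('a \<Rightarrow> 's \<Rightarrow> real) \<Rightarrow> 's \<Rightarrow> real" where
  "sample_lip X f s = (SUP x\<in>X. norm (sample_grad X f x s))"

definition pop_loss :: "'s measure \<Rightarrow> ('a \<Rightarrow> 's \<Rightarrow> real) \<Rightarrow> 'a \<Rightarrow> real" where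
  "pop_loss P f x = (\<integral>s. f x s \<partial>P)"

text \<open>The sample space is \<open>space P\<close>.  Integrability of \<open>f x\<close> makes \<open>pop_loss\<close> well defined.\<close>

definition heavy_tailed_sco ::
    "nat \<Rightarrow> (nat \<Rightarrow> real) \<Rightarrow> 'a::euclidean_space set \<Rightarrow> 's measure \<Rightarrow> ('a \<Rightarrow> 's \<Rightarrow> real) \<Rightarrow> bool" where
  "heavy_tailed_sco k G X P f \<longleftrightarrow>
     prob_space P \<and>
     (\<forall>s\<in>space P. convex_on X (\<lambda>x. f x s) \<and> C1_on X (\<lambda>x. f x s)) \<and>
     (\<forall>x\<in>X. integrable P (f x)) \<and>
     (\<forall>j\<in>{1..k}. integrable P (\<lambda>s. sample_lip X f s ^ j) \<and>
                 (\<integral>s. sample_lip X f s ^ j \<partial>P) \<le> G j ^ j)"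

text \<open>
  Intended for probability measures on the same measurable space and \<open>\<alpha> \<ge> 1\<close>; order 1 is the
  limit, i.e. the Kullback-Leibler divergence.  Note that \<open>KL_divergence b \<nu> \<mu>\<close> is the divergence
  of \<open>\<mu>\<close> from \<open>\<nu>\<close>, and that the library gives it the value 0 when the integral is
  infinite, hence the explicit integrability test.
\<close>

definition renyi_divergence :: "real \<Rightarrow> 'b measure \<Rightarrow> 'b measure \<Rightarrow> ereal" where
  "renyi_divergence \<alpha> \<mu> \<nu> =
     (if \<not> absolutely_continuous \<nu> \<mu> then \<infinity>
      else if \<alpha> = 1 then
        (if integrable \<mu> (entropy_density (exp 1) \<nu> \<mu>) then ereal (KL_divergence (exp 1) \<nu> \<mu>) else \<infinity>)
      else
        (let J = (\<integral>\<^sup>+x. ennreal (enn2real (RN_deriv \<nu> \<mu> x) powr \<alpha>) \<partial>\<nu>)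
         in if J = \<infinity> then \<infinity> else ereal (ln (enn2real J) / (\<alpha> - 1))))"

definition neighboring :: "nat \<Rightarrow> (nat \<Rightarrow> 's) \<Rightarrow> (nat \<Rightarrow> 's) \<Rightarrow> bool" where
  "neighboring n z z' \<longleftrightarrow> card {i. i < n \<and> z i \<noteq> z' i} = 1"

definition CDP :: "real \<Rightarrow> nat \<Rightarrow> 's set \<Rightarrow> ((nat \<Rightarrow> 's) \<Rightarrow> 'b measure) \<Rightarrow> bool" where
  "CDP \<rho> n S M \<longleftrightarrow>
     (\<forall>z \<in> {..<n} \<rightarrow>\<^sub>E S. \<forall>z' \<in> {..<n} \<rightarrow>\<^sub>E S. neighboring n z z' \<longrightarrow>
        (\<forall>\<alpha>\<ge>1. renyi_divergence \<alpha> (M z) (M z') \<le> ereal (\<alpha> * \<rho>)))"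

definition gaussian :: "real \<Rightarrow> 'a::euclidean_space measure" where
  "gaussian \<tau> = density lborel (\<lambda>x. ennreal (\<Prod>b\<in>Basis. normal_density 0 \<tau> (x \<bullet> b)))"

definition clip :: "real \<Rightarrow> 'a::real_normed_vector \<Rightarrow> 'a" where
  "clip C v = min 1 (C / norm v) *\<^sub>R v"

text \<open>
  The phased method.  Phases are numbered \<open>1, \<dots>, num_phases A\<close>; phase \<open>i\<close> consumes the next
  \<open>n div 2 ^ i\<close> entries of the data set \<open>z\<close>, takes one projected clipped step per entry, and
  outputs the projection of the average iterate plus the noise vector \<open>\<xi> i\<close>.  The loss enters only
  through the gradient oracle \<open>g\<close>.
\<close>

record 'a phased_params =
  num_phases :: nat
  init_point :: 'a
  step_size :: "nat \<Rightarrow> real"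
  clip_level :: "nat \<Rightarrow> real"
  noise_dev :: "nat \<Rightarrow> real"

primrec clipped_sgd ::
    "'a::euclidean_space set \<Rightarrow> ('a \<Rightarrow> 's \<Rightarrow> 'a) \<Rightarrow> real \<Rightarrow> real \<Rightarrow> (nat \<Rightarrow> 's) \<Rightarrow> 'a \<Rightarrow> nat \<Rightarrow> 'a" where
  "clipped_sgd X g \<eta> C z x 0 = x"
| "clipped_sgd X g \<eta> C z x (Suc t) =
     (let y = clipped_sgd X g \<eta> C z x t in closest_point X (y - \<eta> *\<^sub>R clip C (g y (z t))))"

definition phase_start :: "nat \<Rightarrow> nat \<Rightarrow> nat" where
  "phase_start n i = (\<Sum>j = 1..<i. n div 2 ^ j)"

definition phase_iterate ::
    "'a::euclidean_space set \<Rightarrow> 'a phased_params \<Rightarrow> nat \<Rightarrow> ('a \<Rightarrow> 's \<Rightarrow> 'a) \<Rightarrow> (nat \<Rightarrow> 's) \<Rightarrow> nat \<Rightarrow> 'a \<Rightarrow> nat \<Rightarrow> 'a" where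
  "phase_iterate X A n g z i x t =
     clipped_sgd X g (step_size A i) (clip_level A i) (\<lambda>t. z (phase_start n i + t)) x t"

definition phase_average ::
    "'a::euclidean_space set \<Rightarrow> 'a phased_params \<Rightarrow> nat \<Rightarrow> ('a \<Rightarrow> 's \<Rightarrow> 'a) \<Rightarrow> (nat \<Rightarrow> 's) \<Rightarrow> nat \<Rightarrow> 'a \<Rightarrow> 'a" where
  "phase_average X A n g z i x =
     (1 / real (n div 2 ^ i)) *\<^sub>R (\<Sum>t < n div 2 ^ i. phase_iterate X A n g z i x t)"

primrec phase_output ::
    "'a::euclidean_space set \<Rightarrow> 'a phased_params \<Rightarrow> nat \<Rightarrow> ('a \<Rightarrow> 's \<Rightarrow> 'a) \<Rightarrow> (nat \<Rightarrow> 's) \<Rightarrow> (nat \<Rightarrow> 'a) \<Rightarrow> nat \<Rightarrow> 'a" where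
  "phase_output X A n g z \<xi> 0 = init_point A"
| "phase_output X A n g z \<xi> (Suc i) =
     closest_point X (phase_average X A n g z (Suc i) (phase_output X A n g z \<xi> i) + \<xi> (Suc i))"

definition phased_noise :: "'a::euclidean_space phased_params \<Rightarrow> (nat \<Rightarrow> 'a) measure" where
  "phased_noise A = PiM {1..num_phases A} (\<lambda>i. gaussian (noise_dev A i))"

text \<open>The law of the output on data set \<open>z\<close>, as a measure on \<open>X\<close>.\<close>

definition phased_law ::
    "'a::euclidean_space set \<Rightarrow> 'a phased_params \<Rightarrow> nat \<Rightarrow> ('a \<Rightarrow> 's \<Rightarrow> 'a) \<Rightarrow> (nat \<Rightarrow> 's) \<Rightarrow> 'a measure" where
  "phased_law X A n g z =
     distr (phased_noise A) (restrict_space borel X) (\<lambda>\<xi>. phase_output X A n g z \<xi> (num_phases A))"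

text \<open>The pairs at which the oracle \<open>g\<close> is evaluated in a run with noise \<open>\<xi>\<close>.\<close>

definition phased_queries ::
    "'a::euclidean_space set \<Rightarrow> 'a phased_params \<Rightarrow> nat \<Rightarrow> ('a \<Rightarrow> 's \<Rightarrow> 'a) \<Rightarrow> (nat \<Rightarrow> 's) \<Rightarrow> (nat \<Rightarrow> 'a) \<Rightarrow> ('a \<times> 's) set" where
  "phased_queries X A n g z \<xi> =
     (\<Union>i\<in>{1..num_phases A}. \<Union>t\<in>{..<n div 2 ^ i}.
        {(phase_iterate X A n g z i (phase_output X A n g z \<xi> (i - 1)) t, z (phase_start n i + t))})"

definition valid_params :: "'a::euclidean_space set \<Rightarrow> nat \<Rightarrow> 'a phased_params \<Rightarrow> bool" where
  "valid_params X n A \<longleftrightarrow>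
     init_point A \<in> X \<and> 2 ^ num_phases A \<le> n \<and>
     (\<forall>i\<in>{1..num_phases A}. step_size A i > 0 \<and> clip_level A i > 0 \<and> noise_dev A i > 0)"

end

theory Submission
  imports Defs
begin

text \<open>
  Privacy: for a generalized linear model every sample gradient is a multiple of one fixed vector, the
  projection \<open>p\<close> of \<open>s\<close> onto the directions of \<open>X\<close>, with a factor that is monotone and Lipschitz in
  \<open>s \<bullet> x\<close>.  Clipping the gradient clips this factor, so clipped gradient steps remain nonexpansive and
  exchanging one sample moves a phase average by at most \<open>2 \<eta> C\<close>.  This displacement is absorbed by a
  shift of the Gaussian noise of the same phase; everything afterwards is post-processing.

  Utility: the regret inequality for projected clipped steps holds sample by sample, with clipping
  costing \<open>D max(0, L - C)\<close>, which the \<open>k\<close>-th moment controls.  Phase \<open>i\<close> is compared with the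
  noiseless average of phase \<open>i - 1\<close> (the first one with the minimizer), so the initial distance of a phase
  is the noise of the previous phase; as the step sizes decrease geometrically, these errors form
  geometric series and only the noise of the last phase remains.
\<close>

section \<open>Gradients relative to a convex set\<close>

text \<open>For a general smooth convex loss, radial clipping destroys the monotonicity of the
  gradient field: for a planar quadratic with two different curvatures a clipped step can increase
  the distance of two points, however small the step. Here all gradients of one sample lie on one
  line, so the argument reduces to cocoercivity in dimension one, and the only requirement on the
  step is \<eta> \<beta> \<le> 2. Two features of the setting shape the details. Gradients and
  smoothness only see points of \<open>X\<close>, which may have empty interior; hence the work in
  the relative interior with difference quotients between points of \<open>X\<close>, and the
  passage to the boundary by continuity. And the parameters are fixed before the distribution and
  the loss are known, so \<beta> cannot influence the step size; the assumed upper bound on \<beta>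
  ensures that the step size chosen for the risk also satisfies \<eta> \<beta> \<le> 2.\<close>

lemma directional_derivative_sequence:
  fixes h :: "'a::euclidean_space \<Rightarrow> real"
  assumes der: "(h has_derivative h') (at x within X)" and X: "convex X" "x \<in> X" "y \<in> X"
  shows "(\<lambda>m. real (Suc m) * (h (x + (1 / real (Suc m)) *\<^sub>R (y - x)) - h x)) \<longlonglongrightarrow> h' (y - x)"
proof -
  define L where "L t = x + t *\<^sub>R (y - x)" for t :: real
  have L: "L t \<in> X" if "t \<in> {0..1}" for t
    using convexD_alt[OF X, of t] that by (simp add: L_def algebra_simps)
  have "(L has_derivative (\<lambda>t. t *\<^sub>R (y - x))) (at 0 within {0..1})"
    unfolding L_def by (auto intro!: derivative_eq_intros)
  moreover have "(h has_derivative h') (at (L 0) within L ` {0..1})"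
  proof -
    have "L 0 = x" "L ` {0..1} \<subseteq> X"
      using L by (auto simp: L_def)
    with has_derivative_subset[OF der] show ?thesis by simp
  qed
  ultimately have "((\<lambda>t. h (L t)) has_derivative (\<lambda>t. h' (t *\<^sub>R (y - x)))) (at 0 within {0..1})"
    by (rule has_derivative_in_compose)
  moreover have "linear h'"
    using der by (rule has_derivative_linear)
  ultimately have "((\<lambda>t. h (L t)) has_real_derivative h' (y - x)) (at 0 within {0..1})"
    by (simp add: has_field_derivative_def linear_scale mult.commute[of _ "h' (y - x)"] mult_commute_abs)
  then have lim: "((\<lambda>t. (h (L t) - h (L 0)) / (t - 0)) \<longlongrightarrow> h' (y - x)) (at 0 within {0..1})"
    by (simp add: has_field_derivative_iff)
  have "filterlim (\<lambda>m. 1 / real (Suc m)) (at 0 within {0..1}) sequentially"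
    using LIMSEQ_Suc[OF lim_1_over_n[where 'a=real]] unfolding filterlim_at
    by (auto simp: eventually_sequentially)
  from filterlim_compose[OF lim this] show ?thesis
    by (simp add: L_def mult.commute)
qed

text \<open>Of the vector \<open>w\<close> representing the derivative only the component in the
  span of the directions of \<open>X\<close> is kept. The discarded part is orthogonal to every
  \<open>y - x\<close> with \<open>y\<close> in \<open>X\<close>, and a derivative within
  \<open>X\<close> tests no other increments.\<close>

lemma grad_on_exists:
  fixes h :: "'a::euclidean_space \<Rightarrow> real"
  assumes "h differentiable (at x within X)"
  shows "\<exists>v\<in>span ((\<lambda>y. y - x) ` X). (h has_derivative (\<lambda>u. v \<bullet> u)) (at x within X)"
proof -
  obtain h' where h': "(h has_derivative h') (at x within X)"
    using assms by (auto simp: differentiable_def)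
  have lin: "linear h'"
    using h' by (rule has_derivative_linear)
  define w where "w = (\<Sum>b\<in>Basis. h' b *\<^sub>R b)"
  have w: "w \<bullet> u = h' u" for u
  proof -
    have "h' u = h' (\<Sum>b\<in>Basis. (u \<bullet> b) *\<^sub>R b)"
      by (simp add: euclidean_representation)
    then show ?thesis
      by (simp add: w_def inner_sum_left inner_sum_right linear_sum[OF lin] linear_scale[OF lin] mult.commute inner_commute)
  qed
  obtain v z where v: "v \<in> span ((\<lambda>y. y - x) ` X)" "\<And>u. u \<in> span ((\<lambda>y. y - x) ` X) \<Longrightarrow> orthogonal z u"
    "w = v + z"
    using orthogonal_subspace_decomp_exists[of "(\<lambda>y. y - x) ` X" w] by metis
  have vz: "v \<bullet> (y - x) = h' (y - x)" if "y \<in> X" for y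
    using v(2)[OF span_base[OF imageI[OF that]]] v(3) w[of "y - x"]
    by (simp add: inner_add_left orthogonal_def)
  have "(h has_derivative (\<lambda>u. v \<bullet> u)) (at x within X)"
    using h' vz unfolding has_derivative_within' by (auto simp: bounded_linear_inner_right)
  with v(1) show ?thesis by blast
qed

lemma span_orthogonal_eq:
  fixes v w :: "'a::real_inner"
  assumes "v \<in> span S" "w \<in> span S" "\<And>y. y \<in> S \<Longrightarrow> v \<bullet> y = w \<bullet> y"
  shows "v = w"
proof -
  have "orthogonal (v - w) u" if "u \<in> span S" for u
    by (rule orthogonal_to_span[OF that]) (simp add: assms orthogonal_def inner_diff_left)
  from this[OF span_diff[OF assms(1,2)]] show ?thesis
    by (simp add: orthogonal_def)
qed

text \<open>This makes the \<open>THE\<close> in \<open>grad_on\<close> meaningful: the difference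
  quotients determine the inner product with each \<open>y - x\<close>, and these vectors span the
  space in which the representative is sought.\<close>

lemma grad_on:
  fixes h :: "'a::euclidean_space \<Rightarrow> real"
  assumes "convex X" "x \<in> X" "h differentiable (at x within X)"
  shows grad_on_span: "grad_on X h x \<in> span ((\<lambda>y. y - x) ` X)"
    and grad_on_deriv: "(h has_derivative (\<lambda>u. grad_on X h x \<bullet> u)) (at x within X)"
proof -
  obtain v where v: "v \<in> span ((\<lambda>y. y - x) ` X)" "(h has_derivative (\<lambda>u. v \<bullet> u)) (at x within X)"
    using grad_on_exists[OF assms(3)] by blast
  have "\<exists>!v. v \<in> span ((\<lambda>y. y - x) ` X) \<and> (h has_derivative (\<lambda>u. v \<bullet> u)) (at x within X)"
  proof (rule ex1I)
    fix w assume w: "w \<in> span ((\<lambda>y. y - x) ` X) \<and> (h has_derivative (\<lambda>u. w \<bullet> u)) (at x within X)"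
    show "w = v"
    proof (rule span_orthogonal_eq)
      fix u assume "u \<in> (\<lambda>y. y - x) ` X"
      then obtain y where y: "y \<in> X" "u = y - x" by auto
      show "w \<bullet> u = v \<bullet> u"
        unfolding y(2)
        using directional_derivative_sequence[OF w[THEN conjunct2] assms(1,2) y(1)]
          directional_derivative_sequence[OF v(2) assms(1,2) y(1)] by (rule LIMSEQ_unique)
    qed (use v w in auto)
  qed (use v in auto)
  from theI'[OF this] show "grad_on X h x \<in> span ((\<lambda>y. y - x) ` X)"
    "(h has_derivative (\<lambda>u. grad_on X h x \<bullet> u)) (at x within X)"
    unfolding grad_on_def by blast+
qed

text \<open>The sequential form is what the later arguments use: it passes on inequalities
  (convexity), equalities (points with equal \<open>s \<bullet> x\<close>) and measurability in the
  sample.\<close>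

lemma grad_on_quotients:
  fixes h :: "'a::euclidean_space \<Rightarrow> real"
  assumes "convex X" "x \<in> X" "y \<in> X" "h differentiable_on X"
  shows "(\<lambda>m. real (Suc m) * (h (x + (1 / real (Suc m)) *\<^sub>R (y - x)) - h x))
           \<longlonglongrightarrow> grad_on X h x \<bullet> (y - x)"
  using assms grad_on_deriv[OF assms(1,2)]
  by (intro directional_derivative_sequence[of h "\<lambda>u. grad_on X h x \<bullet> u"])
     (auto simp: differentiable_on_def)

lemma convex_grad_on_ineq:
  fixes h :: "'a::euclidean_space \<Rightarrow> real"
  assumes "convex_on X h" "x \<in> X" "y \<in> X" "h differentiable_on X"
  shows "h x + grad_on X h x \<bullet> (y - x) \<le> h y"
proof -
  have "convex X" using assms(1) by (rule convex_on_imp_convex)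
  have "real (Suc m) * (h (x + (1 / real (Suc m)) *\<^sub>R (y - x)) - h x) \<le> h y - h x" for m
  proof -
    define t where "t = 1 / real (Suc m)"
    have t: "0 < t" "t \<le> 1" by (auto simp: t_def)
    have "h ((1 - t) *\<^sub>R x + t *\<^sub>R y) \<le> (1 - t) * h x + t * h y"
      using assms(1-3) t by (intro convex_onD) auto
    then have "h (x + t *\<^sub>R (y - x)) - h x \<le> t * (h y - h x)"
      by (simp add: algebra_simps)
    then have "(1 / t) * (h (x + t *\<^sub>R (y - x)) - h x) \<le> (1 / t) * (t * (h y - h x))"
      using t by (intro mult_left_mono) auto
    then show ?thesis using t by (simp add: t_def)
  qed
  from LIMSEQ_le_const2[OF grad_on_quotients[OF \<open>convex X\<close> assms(2,3,4)], of "h y - h x"] this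
  show ?thesis by force
qed

text \<open>\<open>grad_on\<close> takes the span of directions from its own base point; gradients
  at different points are comparable because that span is the same for all of them.\<close>

lemma span_diff_image_eq:
  fixes X :: "'a::real_vector set"
  assumes "x \<in> X" "y \<in> X"
  shows "span ((\<lambda>z. z - x) ` X) = span ((\<lambda>z. z - y) ` X)"
proof -
  have *: "span ((\<lambda>z. z - x) ` X) \<subseteq> span ((\<lambda>z. z - y) ` X)" if "x \<in> X" "y \<in> X" for x y
  proof (rule span_minimal)
    show "(\<lambda>z. z - x) ` X \<subseteq> span ((\<lambda>z. z - y) ` X)"
    proof clarify
      fix z assume "z \<in> X"
      then have "(z - y) - (x - y) \<in> span ((\<lambda>z. z - y) ` X)"
        using that by (intro span_diff span_base imageI)
      then show "z - x \<in> span ((\<lambda>z. z - y) ` X)" by simp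
    qed
  qed simp
  show ?thesis using *[OF assms] *[OF assms(2,1)] by blast
qed

section \<open>Clipped gradients of generalized linear models\<close>

text \<open>A derivative within \<open>X\<close> says nothing about directions that leave
  \<open>X\<close>. At relatively interior points every direction of the hull is available, and with
  both signs, because the affine hull is \<open>x\<close> plus the span.\<close>

lemma rel_interior_translate:
  fixes X :: "'a::euclidean_space set"
  assumes "convex X" "x \<in> rel_interior X" "x0 \<in> X" "v \<in> span ((\<lambda>y. y - x0) ` X)"
  shows "\<exists>e>0. \<forall>t. \<bar>t\<bar> < e \<longrightarrow> x + t *\<^sub>R v \<in> rel_interior X"
proof -
  have xX: "x \<in> X" using assms(2) rel_interior_subset by blast
  have "x \<in> rel_interior (rel_interior X)"
    using assms by (simp add: rel_interior_rel_interior)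
  then obtain e where e: "e > 0" "ball x e \<inter> affine hull X \<subseteq> rel_interior X"
    by (auto simp: mem_rel_interior_ball rel_interior_same_affine_hull[OF assms(1)])
  have v: "v \<in> span ((\<lambda>y. y - x) ` X)"
    using assms(4) span_diff_image_eq[OF assms(3) xX] by simp
  have "affine hull X = (+) x ` span ((\<lambda>y. - x + y) ` X)"
    using affine_hull_span_gen[of x X] hull_inc[OF xX] by simp
  then have aff: "x + t *\<^sub>R v \<in> affine hull X" for t
    using span_scale[OF v, of t] by (simp add: add.commute)
  have "x + t *\<^sub>R v \<in> rel_interior X" if "\<bar>t\<bar> < e / (norm v + 1)" for t
  proof -
    have "\<bar>t\<bar> * norm v \<le> \<bar>t\<bar> * (norm v + 1)" by (simp add: mult_left_mono)
    also have "\<dots> < e" using that by (simp add: pos_less_divide_eq add_nonneg_pos)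
    finally show ?thesis using e(2) aff by (auto simp: dist_norm)
  qed
  moreover have "e / (norm v + 1) > 0" using e(1) by (simp add: add_nonneg_pos)
  ultimately show ?thesis by blast
qed

text \<open>Continuity of the gradient up to the boundary is part of \<open>C1_on\<close>; along
  such sequences it carries statements from the relative interior to all of
  \<open>X\<close>.\<close>

lemma rel_interior_approach:
  fixes X :: "'a::euclidean_space set"
  assumes "convex X" "x \<in> X"
  obtains u where "\<And>m::nat. u m \<in> rel_interior X" "u \<longlonglongrightarrow> x"
proof -
  obtain x0 where x0: "x0 \<in> rel_interior X"
    using assms rel_interior_eq_empty[OF assms(1)] by blast
  define u where "u m = x - (1 / real (Suc m)) *\<^sub>R (x - x0)" for m
  have "u m \<in> rel_interior X" for m
    unfolding u_def using assms x0 by (intro rel_interior_convex_shrink) auto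
  moreover have "u \<longlonglongrightarrow> x - 0 *\<^sub>R (x - x0)"
    unfolding u_def by (intro tendsto_intros LIMSEQ_Suc[OF lim_1_over_n])
  ultimately show thesis by (intro that[of u]) auto
qed

text \<open>On a line, radial clipping becomes truncation of the coefficient to an interval, which
  is monotone and 1-Lipschitz. This is why clipping does no harm to generalized linear
  models.\<close>

lemma scaleR_clip:
  fixes p :: "'a::real_normed_vector"
  assumes "p \<noteq> 0" "C > 0"
  shows "clip C (c *\<^sub>R p) = max (- (C / norm p)) (min (C / norm p) c) *\<^sub>R p"
proof -
  have p: "norm p > 0" using assms by simp
  have "min 1 (C / (\<bar>c\<bar> * norm p)) * c = max (- (C / norm p)) (min (C / norm p) c)"
  proof (cases "\<bar>c\<bar> * norm p \<le> C")
    case True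
    then have *: "\<bar>c\<bar> \<le> C / norm p" using p by (simp add: field_simps)
    show ?thesis
    proof (cases "c = 0")
      case False
      then have "1 \<le> C / (\<bar>c\<bar> * norm p)"
        using True p by (simp add: le_divide_eq)
      with * show ?thesis by (auto simp: min_def max_def)
    qed (use p assms in simp)
  next
    case False
    then have *: "\<bar>c\<bar> > C / norm p" using p by (simp add: field_simps)
    have c0: "c \<noteq> 0" using False assms(2) by auto
    then have "C / (\<bar>c\<bar> * norm p) < 1" using False p by (simp add: divide_less_eq)
    then have "min 1 (C / (\<bar>c\<bar> * norm p)) * c = C / norm p * (c / \<bar>c\<bar>)"
      by (simp add: min_def)
    moreover have "C / norm p > 0" using p assms by simp
    ultimately show ?thesis using * c0 by (cases "c > 0") (auto simp: min_def max_def)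
  qed
  then show ?thesis by (simp add: clip_def)
qed

context
  fixes X :: "'a::euclidean_space set" and h :: "'a \<Rightarrow> real" and \<sigma> :: "real \<Rightarrow> real"
    and s p x0 :: 'a and \<beta> :: real
  assumes h: "convex_on X h" "C1_on X h" and x0: "x0 \<in> X"
    and glm: "\<And>x. x \<in> X \<Longrightarrow> h x = \<sigma> (s \<bullet> x)"
    and p: "p \<in> span ((\<lambda>y. y - x0) ` X)"
    and sp: "\<And>v. v \<in> span ((\<lambda>y. y - x0) ` X) \<Longrightarrow> s \<bullet> v = p \<bullet> v"
begin

private abbreviation "g \<equiv> grad_on X h"
private abbreviation "V \<equiv> span ((\<lambda>y. y - x0) ` X)"

private lemma convX: "convex X"
  using h(1) by (rule convex_on_imp_convex)

private lemma diff: "h differentiable_on X" and cont: "continuous_on X g"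
  using h(2) by (auto simp: C1_on_def)

private lemma diff_in_V: "x \<in> X \<Longrightarrow> y \<in> X \<Longrightarrow> x - y \<in> V"
  using span_diff[OF span_base[of "x - x0"] span_base[of "y - x0"], of "(\<lambda>y. y - x0) ` X"] by simp

private lemma g_in_V: "x \<in> X \<Longrightarrow> g x \<in> V"
  using grad_on_span[OF convX, of x h] diff span_diff_image_eq[OF x0]
  by (auto simp: differentiable_on_def)

text \<open>Since \<open>h\<close> depends on a point only through its inner product with
  \<open>s\<close>, the difference quotients at \<open>x\<close> along \<open>v\<close> and at
  \<open>y\<close> along \<open>w\<close> agree term by term. Relative interiority keeps short
  segments along \<open>v\<close> and \<open>w\<close> inside \<open>X\<close>.\<close>

private lemma glm_grad_level:
  assumes "x \<in> rel_interior X" "y \<in> rel_interior X" "s \<bullet> x = s \<bullet> y"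
    "v \<in> V" "w \<in> V" "s \<bullet> v = s \<bullet> w"
  shows "g x \<bullet> v = g y \<bullet> w"
proof -
  have X: "x \<in> X" "y \<in> X" using assms(1,2) rel_interior_subset by blast+
  obtain e1 where e1: "e1 > 0" "\<And>t. \<bar>t\<bar> < e1 \<Longrightarrow> x + t *\<^sub>R v \<in> rel_interior X"
    using rel_interior_translate[OF convX assms(1) x0 assms(4)] by blast
  obtain e2 where e2: "e2 > 0" "\<And>t. \<bar>t\<bar> < e2 \<Longrightarrow> y + t *\<^sub>R w \<in> rel_interior X"
    using rel_interior_translate[OF convX assms(2) x0 assms(5)] by blast
  define t where "t = min e1 e2 / 2"
  have t: "t > 0" using e1 e2 by (auto simp: t_def)
  have xt: "x + t *\<^sub>R v \<in> X" and yt: "y + t *\<^sub>R w \<in> X"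
    using e1(2)[of t] e2(2)[of t] e1(1) e2(1) rel_interior_subset[of X] by (auto simp: t_def)
  have eq: "h (x + (1 / real (Suc m)) *\<^sub>R ((x + t *\<^sub>R v) - x)) - h x
          = h (y + (1 / real (Suc m)) *\<^sub>R ((y + t *\<^sub>R w) - y)) - h y" for m
  proof -
    have "x + (1 / real (Suc m)) *\<^sub>R ((x + t *\<^sub>R v) - x) \<in> X"
      using convexD_alt[OF convX X(1) xt, of "1 / real (Suc m)"] by (simp add: algebra_simps)
    moreover have "y + (1 / real (Suc m)) *\<^sub>R ((y + t *\<^sub>R w) - y) \<in> X"
      using convexD_alt[OF convX X(2) yt, of "1 / real (Suc m)"] by (simp add: algebra_simps)
    ultimately show ?thesis
      using X assms(3,6) by (simp add: glm inner_add_right)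
  qed
  have "g x \<bullet> ((x + t *\<^sub>R v) - x) = g y \<bullet> ((y + t *\<^sub>R w) - y)"
    using grad_on_quotients[OF convX X(1) xt diff] grad_on_quotients[OF convX X(2) yt diff]
    unfolding eq by (rule LIMSEQ_unique)
  then show ?thesis using t by simp
qed

text \<open>Along the component \<open>u\<close> of the gradient orthogonal to \<open>p\<close> the
  value of \<open>s \<bullet> x\<close> does not change, so the derivative along \<open>u\<close> is
  0, that is, \<open>u \<bullet> u = 0\<close>. The coefficient of \<open>p\<close> stands in for
  the slope of \<sigma>. For \<open>p = 0\<close> it is 0 by the convention on division, and the
  identity says that the gradient vanishes.\<close>

private lemma glm_grad_parallel:
  assumes "x \<in> X"
  shows "g x = (g x \<bullet> p / (p \<bullet> p)) *\<^sub>R p"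
proof -
  have *: "g x = (g x \<bullet> p / (p \<bullet> p)) *\<^sub>R p" if x: "x \<in> rel_interior X" for x
  proof -
    have xX: "x \<in> X" using x rel_interior_subset by blast
    define u where "u = g x - (g x \<bullet> p / (p \<bullet> p)) *\<^sub>R p"
    have u: "u \<in> V" unfolding u_def by (intro span_diff span_scale g_in_V xX p)
    have up: "u \<bullet> p = 0" by (simp add: u_def inner_diff_left)
    then have "g x \<bullet> u = g x \<bullet> 0"
      using sp[OF u] by (intro glm_grad_level x u span_zero) (simp_all add: inner_commute)
    moreover have "u \<bullet> u = g x \<bullet> u - (g x \<bullet> p / (p \<bullet> p)) * (u \<bullet> p)"
      by (subst (1) u_def) (simp add: inner_diff_left inner_commute[of p u])
    ultimately have "u \<bullet> u = 0" using up by simp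
    then show ?thesis by (simp add: u_def)
  qed
  obtain u where u: "\<And>m::nat. u m \<in> rel_interior X" "u \<longlonglongrightarrow> x"
    using rel_interior_approach[OF convX assms] by blast
  have lim: "(\<lambda>m. g (u m)) \<longlonglongrightarrow> g x"
    using u rel_interior_subset[of X]
    by (intro continuous_on_tendsto_compose[OF cont _ assms] always_eventually allI) (auto simp: subset_iff)
  have "(\<lambda>m. g (u m)) \<longlonglongrightarrow> (g x \<bullet> p / (p \<bullet> p)) *\<^sub>R p"
    by (subst *[OF u(1)], unfold divide_inverse) (intro tendsto_intros lim)
  with lim show ?thesis by (rule LIMSEQ_unique)
qed

text \<open>
  Smoothness only compares points of \<open>X\<close>, and it is sharp for displacements along \<open>p\<close>.  Hence the
  segment from \<open>x\<close> to \<open>y\<close> is cut into pieces so short that each increment of \<open>s \<bullet> x\<close> is also realized by a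
  step along \<open>p\<close> inside \<open>X\<close>.
\<close>

private lemma glm_grad_lipschitz:
  assumes sm: "smooth_on X \<beta> h" and "x \<in> X" "y \<in> X"
  shows "\<bar>g x \<bullet> p - g y \<bullet> p\<bar> \<le> \<beta> * \<bar>s \<bullet> (x - y)\<bar>"
proof (cases "p = 0")
  case True
  then show ?thesis using sp[OF diff_in_V[OF assms(2,3)]] by simp
next
  case False
  then have pp: "p \<bullet> p > 0" by simp
  have *: "\<bar>g x \<bullet> p - g y \<bullet> p\<bar> \<le> \<beta> * \<bar>s \<bullet> (x - y)\<bar>"
    if x: "x \<in> rel_interior X" and y: "y \<in> rel_interior X" for x y
  proof -
    obtain e1 where e1: "e1 > 0" "\<And>t. \<bar>t\<bar> < e1 \<Longrightarrow> x + t *\<^sub>R p \<in> rel_interior X"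
      using rel_interior_translate[OF convX x x0 p] by blast
    obtain e2 where e2: "e2 > 0" "\<And>t. \<bar>t\<bar> < e2 \<Longrightarrow> y + t *\<^sub>R p \<in> rel_interior X"
      using rel_interior_translate[OF convX y x0 p] by blast
    define \<Delta> where "\<Delta> = s \<bullet> (y - x)"
    obtain N :: nat where N: "\<bar>\<Delta>\<bar> / (p \<bullet> p) / min e1 e2 < real N"
      using reals_Archimedean2 by blast
    have N0: "N > 0"
      using le_less_trans[OF _ N, of 0] e1 e2 pp by (auto intro!: divide_nonneg_nonneg)
    \<comment> \<open>The vector \<tau> p changes the inner product with \<open>s\<close> by the
      \<open>N\<close>-th part of \<Delta>, with the sign of \<Delta>; \<open>N\<close> is so large
      that this step stays within the admissible radius at both endpoints.\<close>
    define \<tau> where "\<tau> = \<Delta> / (real N * (p \<bullet> p))"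
    have "\<bar>\<tau>\<bar> = \<bar>\<Delta>\<bar> / (p \<bullet> p) / real N"
      using pp N0 by (simp add: \<tau>_def abs_mult)
    also have "\<dots> < min e1 e2"
    proof -
      have "min e1 e2 > 0" "real N > 0" using e1 e2 N0 by auto
      with N show ?thesis by (simp only: pos_divide_less_eq mult.commute)
    qed
    finally have \<tau>: "\<bar>\<tau>\<bar> < e1" "\<bar>\<tau>\<bar> < e2" by auto
    define u where "u i = (1 - real i / real N) *\<^sub>R x + (real i / real N) *\<^sub>R y" for i
    \<comment> \<open>The shifted point is a convex combination of the shifted endpoints, so the
      radii at \<open>x\<close> and \<open>y\<close> serve the whole segment.\<close>
    have u: "u i \<in> rel_interior X" and ut: "u i + \<tau> *\<^sub>R p \<in> rel_interior X" if "i \<le> N" for i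
    proof -
      have i: "0 \<le> real i / real N" "real i / real N \<le> 1" using that N0 by auto
      show "u i \<in> rel_interior X"
        unfolding u_def using convexD_alt[OF convex_rel_interior[OF convX] x y i] .
      have "(1 - real i / real N) *\<^sub>R (x + \<tau> *\<^sub>R p) + (real i / real N) *\<^sub>R (y + \<tau> *\<^sub>R p)
              \<in> rel_interior X"
        using \<tau> by (intro convexD_alt[OF convex_rel_interior[OF convX]] i e1 e2)
      then show "u i + \<tau> *\<^sub>R p \<in> rel_interior X"
        by (simp add: u_def algebra_simps)
    qed
    have step: "\<bar>g (u (Suc i)) \<bullet> p - g (u i) \<bullet> p\<bar> \<le> \<beta> * (\<bar>\<Delta>\<bar> / real N)" if "i < N" for i
    proof -
      \<comment> \<open>The next subdivision point and the step along \<open>p\<close> are in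
        general different points, but they have the same inner product with \<open>s\<close> and
        hence gradients with the same component along \<open>p\<close>.\<close>
      have "s \<bullet> u (Suc i) = s \<bullet> (u i + \<tau> *\<^sub>R p)"
        using N0 pp sp[OF p]
        by (simp add: u_def \<tau>_def \<Delta>_def inner_add_right inner_diff_right field_simps)
      then have "g (u (Suc i)) \<bullet> p = g (u i + \<tau> *\<^sub>R p) \<bullet> p"
        using that by (intro glm_grad_level u ut p) auto
      then have "\<bar>g (u (Suc i)) \<bullet> p - g (u i) \<bullet> p\<bar> = \<bar>(g (u i + \<tau> *\<^sub>R p) - g (u i)) \<bullet> p\<bar>"
        by (simp add: inner_diff_left)
      also have "\<dots> \<le> norm (g (u i + \<tau> *\<^sub>R p) - g (u i)) * norm p"
        by (rule Cauchy_Schwarz_ineq2)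
      also have "\<dots> \<le> \<beta> * norm (u i + \<tau> *\<^sub>R p - u i) * norm p"
      proof (rule mult_right_mono)
        have "u i \<in> X" "u i + \<tau> *\<^sub>R p \<in> X"
          using u[of i] ut[of i] that rel_interior_subset[of X] by auto
        then show "norm (g (u i + \<tau> *\<^sub>R p) - g (u i)) \<le> \<beta> * norm (u i + \<tau> *\<^sub>R p - u i)"
          using sm unfolding smooth_on_def by blast
      qed simp
      \<comment> \<open>The displacement has norm |\<tau>| times the norm of \<open>p\<close>; the
        two norms recombine to \<open>p \<bullet> p\<close>, which cancels the denominator of
        \<tau>, so no constant is lost.\<close>
      also have "\<dots> = \<beta> * (\<bar>\<Delta>\<bar> / real N)"
        using pp N0 by (auto simp: \<tau>_def abs_mult dot_square_norm power2_eq_square)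
      finally show ?thesis .
    qed
    have "\<bar>g (u i) \<bullet> p - g (u 0) \<bullet> p\<bar> \<le> real i * (\<beta> * (\<bar>\<Delta>\<bar> / real N))" if "i \<le> N" for i
      using that
    proof (induction i)
      case (Suc i)
      then show ?case using step[of i] by (simp only: of_nat_Suc distrib_right) linarith
    qed simp
    from this[of N] have "\<bar>g y \<bullet> p - g x \<bullet> p\<bar> \<le> \<beta> * \<bar>\<Delta>\<bar>"
      using N0 by (simp add: u_def)
    then show ?thesis
      by (simp add: \<Delta>_def abs_minus_commute inner_diff_right)
  qed
  obtain u where u: "\<And>m::nat. u m \<in> rel_interior X" "u \<longlonglongrightarrow> x"
    using rel_interior_approach[OF convX assms(2)] by blast
  obtain v where v: "\<And>m::nat. v m \<in> rel_interior X" "v \<longlonglongrightarrow> y"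
    using rel_interior_approach[OF convX assms(3)] by blast
  have gu: "(\<lambda>m. g (u m)) \<longlonglongrightarrow> g x"
    using u rel_interior_subset[of X]
    by (intro continuous_on_tendsto_compose[OF cont _ assms(2)] always_eventually allI) (auto simp: subset_iff)
  have gv: "(\<lambda>m. g (v m)) \<longlonglongrightarrow> g y"
    using v rel_interior_subset[of X]
    by (intro continuous_on_tendsto_compose[OF cont _ assms(3)] always_eventually allI) (auto simp: subset_iff)
  show ?thesis
  proof (rule LIMSEQ_le)
    show "(\<lambda>m. \<bar>g (u m) \<bullet> p - g (v m) \<bullet> p\<bar>) \<longlonglongrightarrow> \<bar>g x \<bullet> p - g y \<bullet> p\<bar>"
      by (intro tendsto_intros gu gv)
    show "(\<lambda>m. \<beta> * \<bar>s \<bullet> (u m - v m)\<bar>) \<longlonglongrightarrow> \<beta> * \<bar>s \<bullet> (x - y)\<bar>"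
      by (intro tendsto_intros u v)
  qed (use * u v in auto)
qed

text \<open>Let \<open>d\<close> be the difference of the clipped coefficients and
  \<open>a = p \<bullet> (x - y)\<close>. The squared distance changes by
  \<open>\<eta> * (\<eta> * (d * d * (p \<bullet> p)) - 2 * (d * a))\<close>. Monotonicity gives d a
  = |d| |a|, smoothness together with the 1-Lipschitz truncation bounds |d|
  \<open>(p \<bullet> p)\<close> by \<beta> |a|, and \<eta> \<beta> \<le> 2 makes the change
  nonpositive.\<close>

lemma glm_clipped_step_nonexpansive_aux:
  assumes sm: "smooth_on X \<beta> h" and xy: "x \<in> X" "y \<in> X" and C: "C > 0" and \<eta>: "\<eta> > 0" "\<eta> * \<beta> \<le> 2"
  shows "norm ((x - \<eta> *\<^sub>R clip C (g x)) - (y - \<eta> *\<^sub>R clip C (g y))) \<le> norm (x - y)"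
proof (cases "p = 0")
  case True
  then have "g x = 0" "g y = 0" using glm_grad_parallel xy by simp_all
  then show ?thesis by (simp add: clip_def)
next
  case False
  define c where "c x = g x \<bullet> p / (p \<bullet> p)" for x
  define \<psi> where "\<psi> c = max (- (C / norm p)) (min (C / norm p) c)" for c :: real
  have pp: "p \<bullet> p > 0" using False by simp
  define d where "d = \<psi> (c x) - \<psi> (c y)"
  define a where "a = s \<bullet> (x - y)"
  have ap: "a = p \<bullet> (x - y)" using sp[OF diff_in_V[OF xy]] by (simp add: a_def)
  have g: "g x = c x *\<^sub>R p" if "x \<in> X" for x
    using glm_grad_parallel[OF that] by (simp add: c_def)
  have cl: "clip C (g x) = \<psi> (c x) *\<^sub>R p" if "x \<in> X" for x
    by (subst g[OF that]) (simp add: scaleR_clip[OF False C] \<psi>_def)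
  have K: "C / norm p > 0" using False C by simp
  have d1: "\<bar>d\<bar> \<le> \<bar>c x - c y\<bar>" and d2: "0 \<le> d * (c x - c y)"
    using K by (auto simp: d_def \<psi>_def max_def min_def zero_le_mult_iff)
  have "0 \<le> (g x - g y) \<bullet> (x - y)"
    using convex_grad_on_ineq[OF h(1) xy diff] convex_grad_on_ineq[OF h(1) xy(2,1) diff]
    by (simp add: inner_diff_left inner_diff_right)
  then have ca: "0 \<le> (c x - c y) * a"
    by (simp add: g xy ap inner_diff_left left_diff_distrib flip: scaleR_diff_left)
  have "\<bar>(c x - c y) * (p \<bullet> p)\<bar> \<le> \<beta> * \<bar>a\<bar>"
    using glm_grad_lipschitz[OF sm xy] by (simp add: a_def g xy left_diff_distrib)
  then have lip: "\<bar>c x - c y\<bar> * (p \<bullet> p) \<le> \<beta> * \<bar>a\<bar>"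
    by (simp add: abs_mult)
  have key: "\<eta> * (d * d * (p \<bullet> p)) \<le> 2 * (d * a)"
  proof (cases "d = 0")
    case False
    then have dc: "c x - c y \<noteq> 0" using d1 by auto
    \<comment> \<open>Truncation cannot reverse the sign of \<open>c x - c y\<close>, and convexity
      makes this sign that of \<open>a\<close>; the assumption on \<open>d\<close> excludes
      \<open>c x = c y\<close>.\<close>
    have da: "d * a = \<bar>d\<bar> * \<bar>a\<bar>"
    proof -
      have "0 \<le> d * a"
        using dc d2 ca by (auto simp: zero_le_mult_iff)
      then show ?thesis by (simp flip: abs_mult)
    qed
    have "\<eta> * (d * d * (p \<bullet> p)) = \<eta> * \<bar>d\<bar> * (\<bar>d\<bar> * (p \<bullet> p))"
      by (simp add: abs_mult_self_eq mult_ac)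
    also have "\<dots> \<le> \<eta> * \<bar>d\<bar> * (\<bar>c x - c y\<bar> * (p \<bullet> p))"
      using \<eta> d1 by (intro mult_left_mono mult_right_mono) auto
    also have "\<dots> \<le> \<eta> * \<bar>d\<bar> * (\<beta> * \<bar>a\<bar>)"
      using \<eta> by (intro mult_left_mono lip) auto
    also have "\<dots> = (\<eta> * \<beta>) * (\<bar>d\<bar> * \<bar>a\<bar>)" by simp
    also have "\<dots> \<le> 2 * (\<bar>d\<bar> * \<bar>a\<bar>)"
      by (intro mult_right_mono \<eta>) auto
    finally show ?thesis by (simp add: da)
  qed simp
  have "(x - \<eta> *\<^sub>R clip C (g x)) - (y - \<eta> *\<^sub>R clip C (g y)) = (x - y) - (\<eta> * d) *\<^sub>R p"
    by (simp add: cl xy d_def algebra_simps)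
  moreover have "(norm ((x - y) - (\<eta> * d) *\<^sub>R p))\<^sup>2
      = (norm (x - y))\<^sup>2 + \<eta> * (\<eta> * (d * d * (p \<bullet> p)) - 2 * (d * a))"
  proof -
    have "(norm (u - k *\<^sub>R p))\<^sup>2 = (norm u)\<^sup>2 + k * (k * (p \<bullet> p) - 2 * (p \<bullet> u))" for u k
      unfolding power2_norm_eq_inner
      by (simp add: inner_diff_left inner_diff_right inner_commute[of u p] right_diff_distrib)
    from this[of "x - y" "\<eta> * d"] show ?thesis
      unfolding ap by (simp add: right_diff_distrib mult_ac)
  qed
  moreover
  have "\<eta> * (\<eta> * (d * d * (p \<bullet> p)) - 2 * (d * a)) \<le> 0"
    using key \<eta> by (intro mult_nonneg_nonpos) auto
  then have "(norm (x - y))\<^sup>2 + \<eta> * (\<eta> * (d * d * (p \<bullet> p)) - 2 * (d * a)) \<le> (norm (x - y))\<^sup>2"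
    by simp
  ultimately have "(norm ((x - \<eta> *\<^sub>R clip C (g x)) - (y - \<eta> *\<^sub>R clip C (g y))))\<^sup>2 \<le> (norm (x - y))\<^sup>2"
    by (simp only:)
  then show ?thesis by (rule power2_le_imp_le) simp
qed

end

lemma glm_clipped_step_nonexpansive:
  fixes X :: "'a::euclidean_space set"
  assumes "convex_on X h" "C1_on X h" "smooth_on X \<beta> h" "\<And>x. x \<in> X \<Longrightarrow> h x = \<sigma> (s \<bullet> x)"
    and "x \<in> X" "y \<in> X" "C > 0" "\<eta> > 0" "\<eta> * \<beta> \<le> 2"
  shows "norm ((x - \<eta> *\<^sub>R clip C (grad_on X h x)) - (y - \<eta> *\<^sub>R clip C (grad_on X h y))) \<le> norm (x - y)"
proof -
  obtain p z where p: "p \<in> span ((\<lambda>y. y - x) ` X)"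
    "\<And>v. v \<in> span ((\<lambda>y. y - x) ` X) \<Longrightarrow> orthogonal z v" "s = p + z"
    using orthogonal_subspace_decomp_exists[of "(\<lambda>y. y - x) ` X" s] by metis
  have "s \<bullet> v = p \<bullet> v" if "v \<in> span ((\<lambda>y. y - x) ` X)" for v
    using p(2)[OF that] p(3) by (simp add: inner_add_left orthogonal_def)
  from glm_clipped_step_nonexpansive_aux[OF assms(1,2,5,4) p(1) this assms(3,5-)]
  show ?thesis by simp
qed

section \<open>The phased method on fixed data\<close>

lemma norm_clip_le:
  assumes "C \<ge> 0"
  shows "norm (clip C v) \<le> C" "norm (clip C v) \<le> norm v"
proof -
  have *: "norm (clip C v) = min 1 (C / norm v) * norm v"
    using assms by (simp add: clip_def)
  show "norm (clip C v) \<le> norm v"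
    unfolding * using mult_right_mono[of "min 1 (C / norm v)" 1 "norm v"] by simp
  show "norm (clip C v) \<le> C"
    unfolding * using assms mult_right_mono[of "min 1 (C / norm v)" "C / norm v" "norm v"]
    by (cases "v = 0") auto
qed

lemma norm_diff_clip:
  assumes "C \<ge> 0"
  shows "norm (v - clip C v) \<le> max 0 (norm v - C)"
proof (cases "v = 0")
  case False
  have "v - clip C v = (1 - min 1 (C / norm v)) *\<^sub>R v"
    by (simp add: clip_def algebra_simps)
  then have "norm (v - clip C v) = (1 - min 1 (C / norm v)) * norm v"
    by simp
  also have "\<dots> = max 0 (norm v - C)"
    using False by (auto simp: min_def max_def field_simps)
  finally show ?thesis by simp
qed (simp add: clip_def)

lemma clipped_sgd_in:
  assumes "closed X" "x \<in> X"
  shows "clipped_sgd X g \<eta> C z x t \<in> X"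
  using assms by (cases t) (auto simp: Let_def intro!: closest_point_in_set)

lemma clipped_sgd_cong:
  assumes "\<And>i. i < t \<Longrightarrow> z i = z' i"
  shows "clipped_sgd X g \<eta> C z x t = clipped_sgd X g \<eta> C z' x t"
  using assms by (induction t) auto

lemma closest_point_nonexpansive:
  fixes X :: "'a::euclidean_space set"
  assumes "convex X" "closed X" "X \<noteq> {}"
  shows "norm (closest_point X x - closest_point X y) \<le> norm (x - y)"
  using closest_point_lipschitz[OF assms, of x y] by (simp add: dist_norm)

text \<open>The two runs agree until the exchanged entry is read, differ by at most two clipped
  steps right after it, and do not move further apart from then on. One bound is therefore
  invariant, and the number of steps does not enter.\<close>

lemma clipped_sgd_sensitivity:
  fixes X :: "'a::euclidean_space set"
  assumes X: "convex X" "closed X" "x \<in> X" and \<eta>: "\<eta> > 0" and C: "C > 0"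
    and nonexp: "\<And>x y s. x \<in> X \<Longrightarrow> y \<in> X \<Longrightarrow> s \<in> S \<Longrightarrow>
      norm ((x - \<eta> *\<^sub>R clip C (g x s)) - (y - \<eta> *\<^sub>R clip C (g y s))) \<le> norm (x - y)"
    and z: "\<And>i. i < t \<Longrightarrow> z i \<in> S" "\<And>i. i < t \<Longrightarrow> i \<noteq> j \<Longrightarrow> z i = z' i"
  shows "norm (clipped_sgd X g \<eta> C z x t - clipped_sgd X g \<eta> C z' x t) \<le> 2 * \<eta> * C"
  using z
proof (induction t)
  case 0
  then show ?case using \<eta> C by simp
next
  case (Suc t)
  define y where "y = clipped_sgd X g \<eta> C z x t"
  define y' where "y' = clipped_sgd X g \<eta> C z' x t"
  have ne: "X \<noteq> {}" using X(3) by auto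
  have yX: "y \<in> X" "y' \<in> X" unfolding y_def y'_def by (rule clipped_sgd_in[OF X(2,3)])+
  have "norm (clipped_sgd X g \<eta> C z x (Suc t) - clipped_sgd X g \<eta> C z' x (Suc t))
      \<le> norm ((y - \<eta> *\<^sub>R clip C (g y (z t))) - (y' - \<eta> *\<^sub>R clip C (g y' (z' t))))"
    using closest_point_nonexpansive[OF X(1,2) ne] by (simp add: y_def y'_def Let_def)
  also have "\<dots> \<le> 2 * \<eta> * C"
  proof (cases "t = j")
    case True
    have "y = y'"
      unfolding y_def y'_def using Suc.prems(2) True by (intro clipped_sgd_cong) auto
    then have "norm ((y - \<eta> *\<^sub>R clip C (g y (z t))) - (y' - \<eta> *\<^sub>R clip C (g y' (z' t))))
        = norm (\<eta> *\<^sub>R clip C (g y (z' t)) - \<eta> *\<^sub>R clip C (g y (z t)))"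
      by simp
    also have "\<dots> \<le> norm (\<eta> *\<^sub>R clip C (g y (z' t))) + norm (\<eta> *\<^sub>R clip C (g y (z t)))"
      by (rule norm_triangle_ineq4)
    also have "\<dots> \<le> \<eta> * C + \<eta> * C"
      using \<eta> C by (intro add_mono) (auto intro!: mult_left_mono norm_clip_le)
    finally show ?thesis by (simp add: mult_ac)
  next
    case False
    then have "norm ((y - \<eta> *\<^sub>R clip C (g y (z t))) - (y' - \<eta> *\<^sub>R clip C (g y' (z' t)))) \<le> norm (y - y')"
      using nonexp[OF yX] Suc.prems(1)[of t] Suc.prems(2)[of t] by simp
    also have "\<dots> \<le> 2 * \<eta> * C"
      unfolding y_def y'_def using Suc by simp
    finally show ?thesis .
  qed
  finally show ?case .
qed

text \<open>The usual potential argument with the squared distance to \<open>u\<close>, for one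
  fixed data sequence. Being pointwise, it leaves open that \<open>u\<close> itself depends on the
  data, as the average of a previous phase does.\<close>

lemma clipped_sgd_regret:
  fixes X :: "'a::euclidean_space set"
  assumes X: "convex X" "closed X" "x \<in> X" "u \<in> X" and \<eta>: "\<eta> > 0" and C: "C > 0"
    and D: "\<And>x y. x \<in> X \<Longrightarrow> y \<in> X \<Longrightarrow> norm (x - y) \<le> D"
    and cvx: "\<And>x y s. x \<in> X \<Longrightarrow> y \<in> X \<Longrightarrow> s \<in> S \<Longrightarrow> f x s - f y s \<le> g x s \<bullet> (x - y)"
    and L: "\<And>x s. x \<in> X \<Longrightarrow> s \<in> S \<Longrightarrow> norm (g x s) \<le> L s"
    and z: "\<And>i. i < t \<Longrightarrow> z i \<in> S"
  shows "(\<Sum>i<t. f (clipped_sgd X g \<eta> C z x i) (z i) - f u (z i))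
    \<le> (norm (x - u))\<^sup>2 / (2 * \<eta>) + (\<Sum>i<t. \<eta> * (L (z i))\<^sup>2 / 2 + D * max 0 (L (z i) - C))"
proof -
  have ne: "X \<noteq> {}" using X(3) by auto
  \<comment> \<open>The negative distance of the current iterate makes the induction telescope; it
    is dropped only at the end.\<close>
  have "(\<Sum>i<t. f (clipped_sgd X g \<eta> C z x i) (z i) - f u (z i))
    \<le> ((norm (x - u))\<^sup>2 - (norm (clipped_sgd X g \<eta> C z x t - u))\<^sup>2) / (2 * \<eta>)
      + (\<Sum>i<t. \<eta> * (L (z i))\<^sup>2 / 2 + D * max 0 (L (z i) - C))"
    using z
  proof (induction t)
    case (Suc t)
    define y where "y = clipped_sgd X g \<eta> C z x t"
    define y' where "y' = clipped_sgd X g \<eta> C z x (Suc t)"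
    define s where "s = z t"
    define c where "c = clip C (g y s)"
    have s: "s \<in> S" using Suc.prems by (simp add: s_def)
    have yX: "y \<in> X" unfolding y_def by (rule clipped_sgd_in[OF X(2,3)])
    have Ls: "norm (g y s) \<le> L s" by (rule L[OF yX s])
    have "norm (y' - u) \<le> norm ((y - \<eta> *\<^sub>R c) - u)"
      using closest_point_nonexpansive[OF X(1,2) ne, of "y - \<eta> *\<^sub>R c" u] closest_point_self[OF X(4)]
      by (simp add: y'_def y_def c_def s_def Let_def)
    then have "(norm (y' - u))\<^sup>2 \<le> (norm ((y - u) - \<eta> *\<^sub>R c))\<^sup>2"
      by (intro power_mono) (simp_all add: algebra_simps)
    also have "\<dots> = (norm (y - u))\<^sup>2 - 2 * \<eta> * (c \<bullet> (y - u)) + \<eta>\<^sup>2 * (norm c)\<^sup>2"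
    proof -
      have "(norm (v - \<eta> *\<^sub>R c))\<^sup>2 = (norm v)\<^sup>2 - 2 * \<eta> * (c \<bullet> v) + \<eta>\<^sup>2 * (norm c)\<^sup>2" for v
        unfolding power2_norm_eq_inner
        by (simp add: inner_diff_left inner_diff_right inner_commute[of v c] power2_eq_square right_diff_distrib)
      then show ?thesis .
    qed
    \<comment> \<open>The clipped gradient is bounded by \<open>L s\<close> and not by
      \<open>C\<close>: the second-order term is then governed by the second moment, whatever the
      clipping level.\<close>
    also have "\<dots> \<le> (norm (y - u))\<^sup>2 - 2 * \<eta> * (c \<bullet> (y - u)) + \<eta>\<^sup>2 * (L s)\<^sup>2"
      using norm_clip_le(2)[of C "g y s"] C Ls
      by (intro add_left_mono mult_left_mono power_mono) (auto simp: c_def)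
    finally have "2 * \<eta> * (c \<bullet> (y - u)) \<le> (norm (y - u))\<^sup>2 - (norm (y' - u))\<^sup>2 + \<eta>\<^sup>2 * (L s)\<^sup>2"
      by simp
    then have 1: "c \<bullet> (y - u) \<le> ((norm (y - u))\<^sup>2 - (norm (y' - u))\<^sup>2) / (2 * \<eta>) + \<eta> * (L s)\<^sup>2 / 2"
      using \<eta> by (simp add: field_simps power2_eq_square)
    have "f y s - f u s \<le> g y s \<bullet> (y - u)"
      by (rule cvx[OF yX X(4) s])
    also have "\<dots> = c \<bullet> (y - u) + (g y s - c) \<bullet> (y - u)"
      by (simp add: inner_diff_left)
    also have "(g y s - c) \<bullet> (y - u) \<le> norm (g y s - c) * norm (y - u)"
      by (rule norm_cauchy_schwarz)
    also have "\<dots> \<le> max 0 (L s - C) * D"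
      using norm_diff_clip[of C "g y s"] C Ls D[OF yX X(4)]
      by (intro mult_mono) (auto simp: c_def)
    finally have "f y s - f u s \<le> ((norm (y - u))\<^sup>2 - (norm (y' - u))\<^sup>2) / (2 * \<eta>)
        + (\<eta> * (L s)\<^sup>2 / 2 + D * max 0 (L s - C))"
      using 1 by (simp add: mult.commute)
    moreover have "(\<Sum>i<t. f (clipped_sgd X g \<eta> C z x i) (z i) - f u (z i))
      \<le> ((norm (x - u))\<^sup>2 - (norm (y - u))\<^sup>2) / (2 * \<eta>)
      + (\<Sum>i<t. \<eta> * (L (z i))\<^sup>2 / 2 + D * max 0 (L (z i) - C))"
      using Suc unfolding y_def by simp
    ultimately show ?case
      unfolding sum.lessThan_Suc y_def[symmetric] y'_def[symmetric] s_def[symmetric]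
      by (simp add: diff_divide_distrib)
  qed simp
  also have "((norm (x - u))\<^sup>2 - (norm (clipped_sgd X g \<eta> C z x t - u))\<^sup>2) / (2 * \<eta>)
      \<le> (norm (x - u))\<^sup>2 / (2 * \<eta>)"
    using \<eta> by (intro divide_right_mono) auto
  finally show ?thesis by simp
qed

section \<open>Which data entries each phase reads\<close>

lemma phase_start_Suc: "i \<ge> 1 \<Longrightarrow> phase_start n (Suc i) = phase_start n i + n div 2 ^ i"
  by (simp add: phase_start_def)

lemma phase_start_mono: "i \<le> j \<Longrightarrow> phase_start n i \<le> phase_start n j"
  unfolding phase_start_def by (intro sum_mono2) auto

lemma phase_start_le: "phase_start n i \<le> n"
proof -
  \<comment> \<open>The extra summand reserves a further block of the length of the last phase; two
    blocks of phase \<open>Suc i\<close> fit into one of phase \<open>i\<close>.\<close>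
  have "(\<Sum>j = 1..<Suc i. n div 2 ^ j) + n div 2 ^ i \<le> n" for i
  proof (induction i)
    case (Suc i)
    have "n div 2 ^ Suc i + n div 2 ^ Suc i \<le> n div 2 ^ i"
      by (simp add: div_mult2_eq mult.commute[of 2])
    then show ?case using Suc by simp
  qed simp
  from this[of i] have "phase_start n (Suc i) \<le> n"
    by (simp add: phase_start_def)
  then show ?thesis using phase_start_mono[of i "Suc i" n] by simp
qed

lemma phase_index_less: "i \<ge> 1 \<Longrightarrow> t < n div 2 ^ i \<Longrightarrow> phase_start n i + t < phase_start n (Suc i)"
  by (simp add: phase_start_Suc)

lemma phase_index_less_n: "i \<ge> 1 \<Longrightarrow> t < n div 2 ^ i \<Longrightarrow> phase_start n i + t < n"
  using phase_index_less[of i t n] phase_start_le[of n "Suc i"] by simp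

lemma phase_start_interval:
  assumes "j < phase_start n (Suc m)"
  obtains i where "i \<in> {1..m}" "phase_start n i \<le> j" "j < phase_start n (Suc i)"
  using assms
proof (induction m arbitrary: thesis)
  case 0
  then show ?case by (simp add: phase_start_def)
next
  case (Suc m)
  show ?case
  proof (cases "j < phase_start n (Suc m)")
    case True
    obtain i where "i \<in> {1..m}" "phase_start n i \<le> j" "j < phase_start n (Suc i)"
      using Suc.IH[OF _ True] by blast
    then show ?thesis using Suc.prems(1)[of i] by auto
  next
    case False
    then show ?thesis using Suc.prems(1)[of "Suc m"] Suc.prems(2) by auto
  qed
qed

lemma phase_iterate_in:
  "closed X \<Longrightarrow> x \<in> X \<Longrightarrow> phase_iterate X A n g z i x t \<in> X"
  unfolding phase_iterate_def by (rule clipped_sgd_in)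

lemma phase_output_in:
  "closed X \<Longrightarrow> init_point A \<in> X \<Longrightarrow> phase_output X A n g z \<xi> i \<in> X"
  by (cases i) (auto intro!: closest_point_in_set)

lemma phase_average_in:
  assumes "closed X" "convex X" "x \<in> X" "n div 2 ^ i \<noteq> 0"
  shows "phase_average X A n g z i x \<in> X"
proof -
  have "(\<Sum>t<n div 2 ^ i. (1 / real (n div 2 ^ i)) *\<^sub>R phase_iterate X A n g z i x t) \<in> X"
    using assms by (intro convex_sum) (auto intro: phase_iterate_in)
  then show ?thesis by (simp add: phase_average_def scaleR_right.sum)
qed

lemma phase_average_cong:
  assumes "i \<ge> 1" "\<And>l. phase_start n i \<le> l \<Longrightarrow> l < phase_start n (Suc i) \<Longrightarrow> z l = z' l"
  shows "phase_average X A n g z i x = phase_average X A n g z' i x"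
  unfolding phase_average_def phase_iterate_def
  using assms phase_index_less[OF assms(1), of _ n]
  by (intro arg_cong2[where f=scaleR] sum.cong refl clipped_sgd_cong) auto

lemma phase_output_cong:
  assumes "\<And>l. l < phase_start n (Suc i) \<Longrightarrow> z l = z' l" "\<And>l. l \<in> {1..i} \<Longrightarrow> \<xi> l = \<xi>' l"
  shows "phase_output X A n g z \<xi> i = phase_output X A n g z' \<xi>' i"
  using assms
proof (induction i)
  case (Suc i)
  have "phase_output X A n g z \<xi> i = phase_output X A n g z' \<xi>' i"
    using Suc.prems phase_start_mono[of "Suc i" "Suc (Suc i)" n]
    by (intro Suc.IH) auto
  moreover have "phase_average X A n g z (Suc i) x = phase_average X A n g z' (Suc i) x" for x
    using Suc.prems by (intro phase_average_cong) auto
  ultimately show ?case using Suc.prems(2)[of "Suc i"] by simp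
qed simp

text \<open>Only phase \<open>i\<close> reads entry \<open>j\<close>. Everything before it is
  unchanged, its output depends on the data only through average plus noise, and later phases read
  the same entries from the same starting point. The shift uses the output of phase
  \<open>i - 1\<close>, hence only noise with smaller index than the one being shifted.\<close>

lemma phase_output_shift:
  fixes X :: "'a::euclidean_space set" and A :: "'a phased_params" and g :: "'a \<Rightarrow> 's \<Rightarrow> 'a"
    and z z' :: "nat \<Rightarrow> 's"
  assumes i: "i \<ge> 1" "phase_start n i \<le> j" "j < phase_start n (Suc i)"
    and z: "\<And>l. l < n \<Longrightarrow> l \<noteq> j \<Longrightarrow> z l = z' l" and m: "i \<le> m"
  defines "\<Delta> \<equiv> \<lambda>\<xi>. phase_average X A n g z i (phase_output X A n g z \<xi> (i - 1))
                  - phase_average X A n g z' i (phase_output X A n g z \<xi> (i - 1))"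
  shows "phase_output X A n g z \<xi> m = phase_output X A n g z' (\<xi>(i := \<xi> i + \<Delta> \<xi>)) m"
  using m
proof (induction m rule: dec_induct)
  case base
  obtain i' where i': "i = Suc i'" using i(1) by (cases i) auto
  have jn: "j < n" using i(3) phase_start_le[of n "Suc i"] by simp
  have "phase_output X A n g z \<xi> i' = phase_output X A n g z' (\<xi>(i := \<xi> i + \<Delta> \<xi>)) i'"
    using i jn z by (intro phase_output_cong) (auto simp: i')
  then show ?case by (simp add: i' \<Delta>_def fun_upd_def add.commute)
next
  case (step m)
  have jm: "j < phase_start n (Suc m)"
    using i(3) phase_start_mono[of "Suc i" "Suc m" n] step by simp
  have "phase_average X A n g z (Suc m) x = phase_average X A n g z' (Suc m) x" for x
    using jm phase_start_le[of n "Suc (Suc m)"] by (intro phase_average_cong z) auto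
  then show ?case using step by simp
qed

lemma phase_average_sensitivity:
  fixes X :: "'a::euclidean_space set"
  assumes X: "convex X" "closed X" "x \<in> X" and pos: "step_size A i > 0" "clip_level A i > 0"
    and nonexp: "\<And>x y s. x \<in> X \<Longrightarrow> y \<in> X \<Longrightarrow> s \<in> S \<Longrightarrow>
      norm ((x - step_size A i *\<^sub>R clip (clip_level A i) (g x s)) - (y - step_size A i *\<^sub>R clip (clip_level A i) (g y s)))
        \<le> norm (x - y)"
    and i: "i \<ge> 1" and z: "\<And>l. l < n \<Longrightarrow> z l \<in> S" "\<And>l. l < n \<Longrightarrow> l \<noteq> j \<Longrightarrow> z l = z' l"
  shows "norm (phase_average X A n g z i x - phase_average X A n g z' i x)
           \<le> 2 * step_size A i * clip_level A i"
proof -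
  let ?N = "n div 2 ^ i" and ?B = "2 * step_size A i * clip_level A i"
  have "norm (phase_iterate X A n g z i x t - phase_iterate X A n g z' i x t) \<le> ?B" if "t < ?N" for t
    unfolding phase_iterate_def
  \<comment> \<open>The subtraction is truncated: if \<open>j\<close> precedes the phase it yields
    0, which merely exempts position 0 from the agreement hypothesis and keeps the bound
    valid.\<close>
  proof (rule clipped_sgd_sensitivity[OF X pos nonexp, where j = "j - phase_start n i"])
    fix l assume "l < t"
    then have "phase_start n i + l < n" using that i by (intro phase_index_less_n) auto
    then show "z (phase_start n i + l) \<in> S"
      "l \<noteq> j - phase_start n i \<Longrightarrow> z (phase_start n i + l) = z' (phase_start n i + l)"
      using z by auto
  qed
  then have "norm (\<Sum>t<?N. phase_iterate X A n g z i x t - phase_iterate X A n g z' i x t) \<le> real ?N * ?B"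
    using sum_norm_le[of "{..<?N}" "\<lambda>t. phase_iterate X A n g z i x t - phase_iterate X A n g z' i x t" "\<lambda>_. ?B"]
    by simp
  moreover have "phase_average X A n g z i x - phase_average X A n g z' i x
      = (1 / real ?N) *\<^sub>R (\<Sum>t<?N. phase_iterate X A n g z i x t - phase_iterate X A n g z' i x t)"
    by (simp add: phase_average_def sum_subtractf scaleR_diff_right)
  ultimately show ?thesis
    using pos by (cases "?N = 0") (auto simp: field_simps)
qed

lemma phased_queries_bound:
  assumes "closed X" "init_point A \<in> X"
  shows "phased_queries X A n g z \<xi> \<subseteq> X \<times> z ` {..<n}" "card (phased_queries X A n g z \<xi>) \<le> n"
proof -
  show "phased_queries X A n g z \<xi> \<subseteq> X \<times> z ` {..<n}"
    using assms by (auto simp: phased_queries_def phase_index_less_n intro!: phase_iterate_in phase_output_in)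
  have "card (phased_queries X A n g z \<xi>) \<le> (\<Sum>i\<in>{1..num_phases A}. card (\<Union>t\<in>{..<n div 2 ^ i}.
        {(phase_iterate X A n g z i (phase_output X A n g z \<xi> (i - 1)) t, z (phase_start n i + t))}))"
    unfolding phased_queries_def by (intro card_UN_le) auto
  also have "\<dots> \<le> (\<Sum>i\<in>{1..num_phases A}. \<Sum>t\<in>{..<n div 2 ^ i}. 1)"
  proof (rule sum_mono)
    fix i
    show "card (\<Union>t\<in>{..<n div 2 ^ i}.
        {(phase_iterate X A n g z i (phase_output X A n g z \<xi> (i - 1)) t, z (phase_start n i + t))})
        \<le> (\<Sum>t\<in>{..<n div 2 ^ i}. 1)"
      by (rule order_trans[OF card_UN_le]) auto
  qed
  also have "\<dots> = phase_start n (Suc (num_phases A))"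
    by (simp add: phase_start_def atLeastLessThanSuc_atLeastAtMost)
  also have "\<dots> \<le> n" by (rule phase_start_le)
  finally show "card (phased_queries X A n g z \<xi>) \<le> n" .
qed

section \<open>Gaussian noise and Renyi divergence\<close>

lemma norm_power2_eq_sum: "(norm (x :: 'a::euclidean_space))\<^sup>2 = (\<Sum>b\<in>Basis. (x \<bullet> b)\<^sup>2)"
  unfolding power2_norm_eq_inner by (subst euclidean_inner) (simp add: power2_eq_square)

lemma prod_normal_density:
  fixes x :: "'a::euclidean_space"
  shows "(\<Prod>b\<in>Basis. normal_density 0 \<tau> (x \<bullet> b))
    = (1 / sqrt (2 * pi * \<tau>\<^sup>2)) ^ DIM('a) * exp (- (norm x)\<^sup>2 / (2 * \<tau>\<^sup>2))"
proof -
  have "(\<Prod>b\<in>Basis. exp (- (x \<bullet> b)\<^sup>2 / (2 * \<tau>\<^sup>2))) = exp (\<Sum>b\<in>Basis. - (x \<bullet> b)\<^sup>2 / (2 * \<tau>\<^sup>2))"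
    by (simp add: exp_sum)
  also have "(\<Sum>b\<in>Basis. - (x \<bullet> b)\<^sup>2 / (2 * \<tau>\<^sup>2)) = - (norm x)\<^sup>2 / (2 * \<tau>\<^sup>2)"
    by (simp add: norm_power2_eq_sum sum_negf flip: sum_divide_distrib)
  finally show ?thesis
    by (simp only: normal_density_def prod.distrib prod_constant diff_zero)
qed

lemma space_gaussian [simp]: "space (gaussian \<tau>) = UNIV"
  and sets_gaussian [simp, measurable_cong]: "sets (gaussian \<tau>) = sets borel"
  by (simp_all add: gaussian_def)

lemma nn_integral_gaussian:
  fixes h :: "'a::euclidean_space \<Rightarrow> ennreal"
  assumes [measurable]: "h \<in> borel_measurable borel"
  shows "(\<integral>\<^sup>+x. h x \<partial>gaussian \<tau>)
    = (\<integral>\<^sup>+x. ennreal ((1 / sqrt (2 * pi * \<tau>\<^sup>2)) ^ DIM('a) * exp (- (norm x)\<^sup>2 / (2 * \<tau>\<^sup>2))) * h x \<partial>lborel)"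
  unfolding gaussian_def prod_normal_density by (rule nn_integral_density) measurable

lemma nn_integral_normal_density: "\<tau> > 0 \<Longrightarrow> (\<integral>\<^sup>+x. ennreal (normal_density \<mu> \<tau> x) \<partial>lborel) = 1"
  by (subst nn_integral_eq_integral) auto

lemma prob_space_gaussian:
  assumes "\<tau> > 0"
  shows "prob_space (gaussian \<tau> :: 'a::euclidean_space measure)"
proof
  have "emeasure (gaussian \<tau> :: 'a measure) (space (gaussian \<tau>))
      = (\<integral>\<^sup>+x. (\<Prod>b\<in>Basis. ennreal (normal_density 0 \<tau> ((x::'a) \<bullet> b))) \<partial>lborel)"
    by (simp add: gaussian_def emeasure_density prod_ennreal)
  also have "\<dots> = 1"
    using assms by (subst nn_integral_lborel_prod) (auto simp: nn_integral_normal_density)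
  finally show "emeasure (gaussian \<tau> :: 'a measure) (space (gaussian \<tau>)) = 1" .
qed

lemma nn_integral_gaussian_norm_power2:
  fixes \<tau> :: real
  assumes "\<tau> > 0"
  shows "(\<integral>\<^sup>+x. ennreal ((norm x)\<^sup>2) \<partial>(gaussian \<tau> :: 'a::euclidean_space measure)) = ennreal (DIM('a) * \<tau>\<^sup>2)"
proof -
  have *: "(\<integral>\<^sup>+x. ennreal ((x \<bullet> a)\<^sup>2) \<partial>(gaussian \<tau> :: 'a measure)) = ennreal (\<tau>\<^sup>2)" if a: "a \<in> Basis" for a :: 'a
  proof -
    \<comment> \<open>The square is attached to a single coordinate, so the integrand remains a
      product over coordinates.\<close>
    define F where "F b t = ennreal (normal_density 0 \<tau> t) * (if b = a then ennreal (t\<^sup>2) else 1)" for b t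
    have eq: "(\<Prod>b\<in>Basis. F b (x \<bullet> b)) = ennreal (\<Prod>b\<in>Basis. normal_density 0 \<tau> (x \<bullet> b)) * ennreal ((x \<bullet> a)\<^sup>2)" for x
      using a by (simp add: F_def prod.distrib prod_ennreal prod.delta)
    have "(\<integral>\<^sup>+x. ennreal ((x \<bullet> a)\<^sup>2) \<partial>(gaussian \<tau> :: 'a measure))
        = (\<integral>\<^sup>+x. ennreal (\<Prod>b\<in>Basis. normal_density 0 \<tau> (x \<bullet> b)) * ennreal ((x \<bullet> a)\<^sup>2) \<partial>lborel)"
      unfolding gaussian_def by (rule nn_integral_density) measurable
    also have "\<dots> = (\<Prod>b\<in>Basis. \<integral>\<^sup>+t. F b t \<partial>lborel)"
      unfolding eq[symmetric] by (rule nn_integral_lborel_prod) (auto simp: F_def)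
    also have "\<dots> = (\<Prod>b\<in>Basis. if b = a then ennreal (\<tau>\<^sup>2) else 1)"
    proof (rule prod.cong[OF refl])
      fix b :: 'a assume "b \<in> Basis"
      show "(\<integral>\<^sup>+t. F b t \<partial>lborel) = (if b = a then ennreal (\<tau>\<^sup>2) else 1)"
      proof (cases "b = a")
        case True
        have "(\<integral>\<^sup>+t. F b t \<partial>lborel) = (\<integral>\<^sup>+t. ennreal (normal_density 0 \<tau> t * (t - 0) ^ (2 * 1)) \<partial>lborel)"
          using True by (simp add: F_def ennreal_mult')
        also have "\<dots> = ennreal (\<integral>t. normal_density 0 \<tau> t * (t - 0) ^ (2 * 1) \<partial>lborel)"
          using assms by (intro nn_integral_eq_integral integrable_normal_moment) auto
        also have "\<dots> = ennreal (\<tau>\<^sup>2)"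
          using assms by (subst integral_normal_moment_even) auto
        finally show ?thesis using True by simp
      qed (use assms in \<open>simp add: F_def nn_integral_normal_density\<close>)
    qed
    also have "\<dots> = ennreal (\<tau>\<^sup>2)" using a by (simp add: prod.delta)
    finally show ?thesis .
  qed
  have "(\<integral>\<^sup>+x. ennreal ((norm x)\<^sup>2) \<partial>(gaussian \<tau> :: 'a measure))
      = (\<integral>\<^sup>+x. (\<Sum>b\<in>Basis. ennreal ((x \<bullet> b)\<^sup>2)) \<partial>(gaussian \<tau> :: 'a measure))"
    by (simp add: norm_power2_eq_sum sum_ennreal)
  also have "\<dots> = (\<Sum>b\<in>(Basis::'a set). ennreal (\<tau>\<^sup>2))"
    by (subst nn_integral_sum) (auto simp: *)
  finally show ?thesis by (simp add: ennreal_of_nat_eq_real_of_nat ennreal_mult')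
qed

lemma nn_integral_lborel_translate:
  fixes c :: "'a::euclidean_space"
  assumes [measurable]: "h \<in> borel_measurable borel"
  shows "(\<integral>\<^sup>+x. h (c + x) \<partial>lborel) = (\<integral>\<^sup>+x. h x \<partial>lborel)"
  by (subst (2) lborel_distr_plus[of c, symmetric]) (simp add: nn_integral_distr)

text \<open>The exponential is the likelihood ratio of the Gaussian with mean \<delta> to the
  centered one.\<close>

lemma nn_integral_gaussian_translate:
  fixes \<delta> :: "'a::euclidean_space"
  assumes [measurable]: "h \<in> borel_measurable borel"
  shows "(\<integral>\<^sup>+x. h (x + \<delta>) \<partial>gaussian \<tau>)
    = (\<integral>\<^sup>+x. h x * ennreal (exp ((2 * (\<delta> \<bullet> x) - (norm \<delta>)\<^sup>2) / (2 * \<tau>\<^sup>2))) \<partial>gaussian \<tau>)"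
proof -
  define c where "c = (1 / sqrt (2 * pi * \<tau>\<^sup>2)) ^ DIM('a)"
  have c: "c \<ge> 0" by (simp add: c_def)
  have norm: "(norm (x - \<delta>))\<^sup>2 = (norm x)\<^sup>2 - (2 * (\<delta> \<bullet> x) - (norm \<delta>)\<^sup>2)" for x
    unfolding power2_norm_eq_inner by (simp add: inner_diff_left inner_diff_right inner_commute[of x \<delta>])
  have "(\<integral>\<^sup>+x. h (x + \<delta>) \<partial>gaussian \<tau>)
      = (\<integral>\<^sup>+x. ennreal (c * exp (- (norm (\<delta> + x - \<delta>))\<^sup>2 / (2 * \<tau>\<^sup>2))) * h (\<delta> + x) \<partial>lborel)"
    by (subst nn_integral_gaussian) (auto simp: c_def add.commute)
  also have "\<dots> = (\<integral>\<^sup>+x. ennreal (c * exp (- (norm (x - \<delta>))\<^sup>2 / (2 * \<tau>\<^sup>2))) * h x \<partial>lborel)"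
    by (rule nn_integral_lborel_translate[where h="\<lambda>x. ennreal (c * exp (- (norm (x - \<delta>))\<^sup>2 / (2 * \<tau>\<^sup>2))) * h x"])
      measurable
  also have "\<dots> = (\<integral>\<^sup>+x. ennreal (c * exp (- (norm x)\<^sup>2 / (2 * \<tau>\<^sup>2)))
      * (h x * ennreal (exp ((2 * (\<delta> \<bullet> x) - (norm \<delta>)\<^sup>2) / (2 * \<tau>\<^sup>2)))) \<partial>lborel)"
  proof (rule nn_integral_cong)
    fix x
    have "exp (- (norm (x - \<delta>))\<^sup>2 / (2 * \<tau>\<^sup>2))
        = exp (- (norm x)\<^sup>2 / (2 * \<tau>\<^sup>2)) * exp ((2 * (\<delta> \<bullet> x) - (norm \<delta>)\<^sup>2) / (2 * \<tau>\<^sup>2))"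
      unfolding norm exp_add[symmetric] add_divide_distrib[symmetric] by simp
    then show "ennreal (c * exp (- (norm (x - \<delta>))\<^sup>2 / (2 * \<tau>\<^sup>2))) * h x
        = ennreal (c * exp (- (norm x)\<^sup>2 / (2 * \<tau>\<^sup>2)))
      * (h x * ennreal (exp ((2 * (\<delta> \<bullet> x) - (norm \<delta>)\<^sup>2) / (2 * \<tau>\<^sup>2))))"
      using c by (simp add: ennreal_mult' mult_ac)
  qed
  also have "\<dots> = (\<integral>\<^sup>+x. h x * ennreal (exp ((2 * (\<delta> \<bullet> x) - (norm \<delta>)\<^sup>2) / (2 * \<tau>\<^sup>2))) \<partial>gaussian \<tau>)"
    by (subst nn_integral_gaussian) (auto simp: c_def)
  finally show ?thesis .
qed

text \<open>The power \<alpha> of the likelihood ratio for \<delta> is, up to a constant factor, the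
  likelihood ratio for \<alpha> \<delta>, which has total mass 1. The logarithm of the constant
  divided by \<alpha> - 1 is the familiar divergence of two translated Gaussians.\<close>

lemma nn_integral_gaussian_tilt_powr:
  fixes \<delta> :: "'a::euclidean_space"
  assumes "\<tau> > 0"
  shows "(\<integral>\<^sup>+x. ennreal (exp ((2 * (\<delta> \<bullet> x) - (norm \<delta>)\<^sup>2) / (2 * \<tau>\<^sup>2)) powr \<alpha>) \<partial>gaussian \<tau>)
    = ennreal (exp (\<alpha> * (\<alpha> - 1) * (norm \<delta>)\<^sup>2 / (2 * \<tau>\<^sup>2)))"
proof -
  interpret prob_space "gaussian \<tau> :: 'a measure" by (rule prob_space_gaussian[OF assms])
  have eq: "exp ((2 * (\<delta> \<bullet> x) - (norm \<delta>)\<^sup>2) / (2 * \<tau>\<^sup>2)) powr \<alpha>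
    = exp (\<alpha> * (\<alpha> - 1) * (norm \<delta>)\<^sup>2 / (2 * \<tau>\<^sup>2)) *
      exp ((2 * ((\<alpha> *\<^sub>R \<delta>) \<bullet> x) - (norm (\<alpha> *\<^sub>R \<delta>))\<^sup>2) / (2 * \<tau>\<^sup>2))" for x
  proof -
    have "\<alpha> * (2 * (\<delta> \<bullet> x) - (norm \<delta>)\<^sup>2) = \<alpha> * (\<alpha> - 1) * (norm \<delta>)\<^sup>2 + (2 * ((\<alpha> *\<^sub>R \<delta>) \<bullet> x) - (norm (\<alpha> *\<^sub>R \<delta>))\<^sup>2)"
      by (simp add: power_mult_distrib) (simp add: algebra_simps power2_eq_square)
    then show ?thesis
      by (simp add: powr_def flip: exp_add add_divide_distrib)
  qed
  have "(\<integral>\<^sup>+x. ennreal (exp ((2 * ((\<alpha> *\<^sub>R \<delta>) \<bullet> x) - (norm (\<alpha> *\<^sub>R \<delta>))\<^sup>2) / (2 * \<tau>\<^sup>2))) \<partial>gaussian \<tau>) = 1"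
    using nn_integral_gaussian_translate[of "\<lambda>_. 1" \<tau> "\<alpha> *\<^sub>R \<delta>"] emeasure_space_1 by simp
  then show ?thesis
    unfolding eq by (simp add: ennreal_mult' nn_integral_cmult)
qed

section \<open>Renyi divergence of all orders from moments of the density\<close>

lemma mult_ln_bounds:
  fixes h :: real
  assumes "h \<ge> 0"
  shows "\<bar>h * ln h\<bar> \<le> 1 + h powr 2" "\<alpha> > 1 \<Longrightarrow> (\<alpha> - 1) * (h * ln h) \<le> h powr \<alpha> - h"
proof -
  have "h * ln h \<le> h * h"
  proof (cases "h = 0")
    case False
    then show ?thesis using assms ln_le_minus_one[of h] by (intro mult_left_mono) auto
  qed simp
  moreover have "h - 1 \<le> h * ln h"
  proof (cases "h = 0")
    case False
    then have "1 - 1 / h \<le> ln h"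
      using assms ln_le_minus_one[of "1 / h"] by (simp add: ln_div)
    then have "h * (1 - 1 / h) \<le> h * ln h" using assms by (intro mult_left_mono)
    then show ?thesis using False by (simp add: algebra_simps)
  qed simp
  moreover have "h powr 2 = h * h"
    using assms by (cases "h = 0") (auto simp: power2_eq_square)
  ultimately show "\<bar>h * ln h\<bar> \<le> 1 + h powr 2"
    using assms by (auto simp: abs_le_iff intro: order_trans[of _ 1])
  assume \<alpha>: "\<alpha> > 1"
  show "(\<alpha> - 1) * (h * ln h) \<le> h powr \<alpha> - h"
  proof (cases "h = 0")
    case False
    then have h: "h > 0" using assms by simp
    have "h * (1 + (\<alpha> - 1) * ln h) \<le> h * exp ((\<alpha> - 1) * ln h)"
      using h by (intro mult_left_mono exp_ge_add_one_self) auto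
    also have "\<dots> = h powr \<alpha>"
      using h by (simp add: powr_def algebra_simps exp_diff)
    finally show ?thesis by (simp add: algebra_simps)
  qed simp
qed

text \<open>For orders above 1 only a logarithm has to be taken. Order 1 has its own definition and
  is reached as a limit: h ln h is at most (h^(1+e) - h) / e, so the divergence is at most a
  difference quotient of the moment bounds at e = 0. Its integrability comes from the moment of
  order 2.\<close>

lemma renyi_divergence_le:
  assumes "prob_space \<mu>" "prob_space \<nu>" and sets: "sets \<mu> = sets \<nu>" and ac: "absolutely_continuous \<nu> \<mu>"
    and \<rho>: "\<rho> \<ge> 0"
    and J: "\<And>\<alpha>. \<alpha> > 1 \<Longrightarrow> (\<integral>\<^sup>+x. ennreal (enn2real (RN_deriv \<nu> \<mu> x) powr \<alpha>) \<partial>\<nu>) \<le> ennreal (exp (\<alpha> * (\<alpha> - 1) * \<rho>))"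
    and \<alpha>: "\<alpha> \<ge> 1"
  shows "renyi_divergence \<alpha> \<mu> \<nu> \<le> ereal (\<alpha> * \<rho>)"
proof (cases "\<alpha> = 1")
  case False
  define I where "I = (\<integral>\<^sup>+x. ennreal (enn2real (RN_deriv \<nu> \<mu> x) powr \<alpha>) \<partial>\<nu>)"
  have I: "I \<le> ennreal (exp (\<alpha> * (\<alpha> - 1) * \<rho>))" unfolding I_def using J \<alpha> False by auto
  then have fin: "I \<noteq> \<infinity>" by (auto simp: top_unique)
  have "enn2real I \<le> exp (\<alpha> * (\<alpha> - 1) * \<rho>)"
    using I by (simp add: enn2real_leI)
  have "ln (enn2real I) \<le> \<alpha> * (\<alpha> - 1) * \<rho>"
  \<comment> \<open>In the degenerate case \<open>ln 0\<close> has the default value 0, and the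
    right-hand side is nonnegative.\<close>
  proof (cases "enn2real I = 0")
    case False
    then have "enn2real I > 0" using enn2real_nonneg[of I] by linarith
    then have "ln (enn2real I) \<le> ln (exp (\<alpha> * (\<alpha> - 1) * \<rho>))"
      using \<open>enn2real I \<le> _\<close> by (subst ln_le_cancel_iff) auto
    then show ?thesis by simp
  qed (use \<alpha> \<rho> in simp)
  then have "ln (enn2real I) / (\<alpha> - 1) \<le> \<alpha> * \<rho>"
    using \<alpha> False by (simp add: divide_le_eq mult_ac)
  then show ?thesis
    using ac False fin by (simp add: renyi_divergence_def I_def[symmetric])
next
  case True
  interpret \<mu>: prob_space \<mu> by fact
  interpret \<nu>: prob_space \<nu> by fact
  define h where "h x = enn2real (RN_deriv \<nu> \<mu> x)" for x
  have h0: "h x \<ge> 0" for x by (simp add: h_def)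
  have [measurable]: "h \<in> borel_measurable \<nu>" by (simp add: h_def[abs_def])
  have "AE x in \<nu>. RN_deriv \<nu> \<mu> x \<noteq> \<infinity>"
    using \<mu>.sigma_finite_measure_axioms ac sets by (rule \<nu>.RN_deriv_finite)
  then have "density \<nu> (RN_deriv \<nu> \<mu>) = density \<nu> (\<lambda>x. ennreal (h x))"
    by (intro density_cong) (auto simp: h_def less_top elim!: eventually_mono)
  then have \<mu>: "\<mu> = density \<nu> (\<lambda>x. ennreal (h x))"
    using \<nu>.density_RN_deriv[OF ac sets] by simp
  have ent: "entropy_density (exp 1) \<nu> \<mu> = (\<lambda>x. ln (h x))"
    by (auto simp: entropy_density_def h_def log_def fun_eq_iff)
  have int_powr: "integrable \<nu> (\<lambda>x. h x powr \<beta>)" if "\<beta> > 1" for \<beta>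
  proof (rule integrableI_bounded)
    show "(\<integral>\<^sup>+x. ennreal (norm (h x powr \<beta>)) \<partial>\<nu>) < \<infinity>"
      using J[OF that] le_less_trans[OF _ ennreal_less_top] by (simp add: h_def)
  qed simp
  have int_ln: "integrable \<nu> (\<lambda>x. h x * ln (h x))"
    by (rule Bochner_Integration.integrable_bound[where f="\<lambda>x. 1 + h x powr 2"])
       (use int_powr[of 2] mult_ln_bounds(1)[OF h0] in auto)
  have int_h: "integrable \<nu> h" "(\<integral>x. h x \<partial>\<nu>) = 1"
  proof -
    have "integrable \<mu> (\<lambda>x. 1::real)" by simp
    then show "integrable \<nu> h"
      unfolding \<mu> by (subst (asm) integrable_real_density) (auto simp: h0)
    have "(\<integral>x. (1::real) \<partial>\<mu>) = (\<integral>x. h x * 1 \<partial>\<nu>)"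
      unfolding \<mu> by (subst integral_real_density) (auto simp: h0)
    then show "(\<integral>x. h x \<partial>\<nu>) = 1" using \<mu>.prob_space by simp
  qed
  have bnd: "(\<integral>x. h x * ln (h x) \<partial>\<nu>) \<le> (exp ((1 + e) * e * \<rho>) - 1) / e" if e: "e > 0" for e
  proof -
    have "e * (\<integral>x. h x * ln (h x) \<partial>\<nu>) = (\<integral>x. (1 + e - 1) * (h x * ln (h x)) \<partial>\<nu>)"
      by simp
    also have "\<dots> \<le> (\<integral>x. h x powr (1 + e) - h x \<partial>\<nu>)"
      using e int_powr[of "1 + e"] int_ln int_h
      by (intro integral_mono mult_ln_bounds(2) h0) auto
    also have "\<dots> = (\<integral>x. h x powr (1 + e) \<partial>\<nu>) - 1"
      using e int_powr[of "1 + e"] int_h by simp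
    also have "(\<integral>x. h x powr (1 + e) \<partial>\<nu>) = enn2real (\<integral>\<^sup>+x. ennreal (h x powr (1 + e)) \<partial>\<nu>)"
      by (rule integral_eq_nn_integral) auto
    also have "\<dots> \<le> exp ((1 + e) * e * \<rho>)"
      using J[of "1 + e"] e by (intro enn2real_leI) (auto simp: h_def)
    finally show ?thesis using e by (simp add: pos_le_divide_eq mult.commute)
  qed
  have *: "(\<integral>x. h x * ln (h x) \<partial>\<nu>) \<le> (exp ((1 + 1 / real (Suc m)) * (1 / real (Suc m)) * \<rho>) - 1) / (1 / real (Suc m))" for m
    by (rule bnd) simp
  \<comment> \<open>The bounds \<open>bnd\<close> are the difference quotients of this function at
    0, so they tend to \<rho>.\<close>
  have "DERIV (\<lambda>e. exp ((1 + e) * e * \<rho>)) 0 :> \<rho>"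
    by (auto intro!: derivative_eq_intros)
  then have "((\<lambda>e. (exp ((1 + e) * e * \<rho>) - 1) / e) \<longlongrightarrow> \<rho>) (at 0)"
    by (simp add: DERIV_def)
  moreover have "filterlim (\<lambda>m. 1 / real (Suc m)) (at 0) sequentially"
    using LIMSEQ_Suc[OF lim_1_over_n[where 'a=real]] unfolding filterlim_at
    by (auto simp: eventually_sequentially)
  ultimately have "(\<lambda>m. (exp ((1 + 1 / real (Suc m)) * (1 / real (Suc m)) * \<rho>) - 1) / (1 / real (Suc m))) \<longlonglongrightarrow> \<rho>"
    by (rule filterlim_compose)
  from LIMSEQ_le_const[OF this] * have le: "(\<integral>x. h x * ln (h x) \<partial>\<nu>) \<le> \<rho>" by blast
  have "integrable \<mu> (\<lambda>x. ln (h x))"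
    unfolding \<mu> using int_ln by (subst integrable_real_density) (auto simp: h0)
  moreover have "(\<integral>x. ln (h x) \<partial>\<mu>) = (\<integral>x. h x * ln (h x) \<partial>\<nu>)"
    unfolding \<mu> by (subst integral_real_density) (auto simp: h0)
  ultimately show ?thesis
    using ac True le by (simp add: renyi_divergence_def ent KL_divergence_def)
qed

lemma Young_powr:
  fixes a r \<alpha> :: real
  assumes "a \<ge> 0" "r \<ge> 0" "\<alpha> > 1"
  shows "a powr (\<alpha> - 1) * r \<le> (\<alpha> - 1) / \<alpha> * a powr \<alpha> + 1 / \<alpha> * r powr \<alpha>"
proof -
  have "1 / \<alpha> + 1 / (\<alpha> / (\<alpha> - 1)) = 1"
    using assms by (simp add: field_simps)
  moreover have "\<alpha> / (\<alpha> - 1) > 1" using assms by (simp add: field_simps)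
  ultimately have "r * a powr (\<alpha> - 1) \<le> r powr \<alpha> / \<alpha> + (a powr (\<alpha> - 1)) powr (\<alpha> / (\<alpha> - 1)) / (\<alpha> / (\<alpha> - 1))"
    using assms by (intro Youngs_inequality) auto
  also have "(a powr (\<alpha> - 1)) powr (\<alpha> / (\<alpha> - 1)) = a powr \<alpha>"
    using assms by (simp add: powr_powr)
  finally show ?thesis using assms by (simp add: mult_ac)
qed

text \<open>
  Post-processing: \<open>r\<close> plays the role of a density before applying \<open>\<Phi>\<close>.  Testing the density \<open>h\<close>
  after \<open>\<Phi>\<close> against its truncated power and applying Young's inequality avoids conditional expectations.
\<close>

lemma renyi_postprocessing:
  fixes r :: "'a \<Rightarrow> real"
  assumes "prob_space N" "prob_space \<mu>" and [measurable]: "\<Phi> \<in> N \<rightarrow>\<^sub>M Y" "r \<in> borel_measurable N"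
    and sets_\<mu>: "sets \<mu> = sets Y" and r0: "\<And>x. r x \<ge> 0"
    and dens: "\<And>H. H \<in> borel_measurable Y \<Longrightarrow> (\<integral>\<^sup>+y. H y \<partial>\<mu>) = (\<integral>\<^sup>+x. H (\<Phi> x) * ennreal (r x) \<partial>N)"
  defines "\<nu> \<equiv> distr N Y \<Phi>"
  shows "absolutely_continuous \<nu> \<mu>"
    and "\<alpha> > 1 \<Longrightarrow> (\<integral>\<^sup>+y. ennreal (enn2real (RN_deriv \<nu> \<mu> y) powr \<alpha>) \<partial>\<nu>) \<le> (\<integral>\<^sup>+x. ennreal (r x powr \<alpha>) \<partial>N)"
proof -
  interpret N: prob_space N by fact
  interpret \<mu>: prob_space \<mu> by fact
  have "prob_space \<nu>" unfolding \<nu>_def by (rule N.prob_space_distr) fact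
  then interpret \<nu>: prob_space \<nu> .
  have sets_\<nu> [simp, measurable_cong]: "sets \<nu> = sets Y" by (simp add: \<nu>_def)
  show ac: "absolutely_continuous \<nu> \<mu>"
    unfolding absolutely_continuous_def
  proof
    fix A assume "A \<in> null_sets \<nu>"
    then have A [measurable]: "A \<in> sets Y" and "emeasure N (\<Phi> -` A \<inter> space N) = 0"
      by (auto simp: null_sets_def \<nu>_def emeasure_distr)
    then have "AE x in N. \<Phi> x \<notin> A"
      by (intro AE_I[of _ _ "\<Phi> -` A \<inter> space N"]) auto
    have "emeasure \<mu> A = (\<integral>\<^sup>+y. indicator A y \<partial>\<mu>)"
      using A sets_\<mu> by simp
    also have "\<dots> = (\<integral>\<^sup>+x. indicator A (\<Phi> x) * ennreal (r x) \<partial>N)"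
      by (rule dens) simp
    also have "\<dots> = (\<integral>\<^sup>+x. 0 \<partial>N)"
      using \<open>AE x in N. \<Phi> x \<notin> A\<close> by (intro nn_integral_cong_AE) auto
    finally show "A \<in> null_sets \<mu>" using A sets_\<mu> by (auto simp: null_sets_def)
  qed
  assume \<alpha>: "\<alpha> > 1"
  define R where "R = (\<integral>\<^sup>+x. ennreal (r x powr \<alpha>) \<partial>N)"
  define h where "h y = enn2real (RN_deriv \<nu> \<mu> y)" for y
  have h0: "h x \<ge> 0" for x by (simp add: h_def)
  have hm: "h \<in> borel_measurable \<nu>" by (simp add: h_def[abs_def])
  then have [measurable]: "h \<in> borel_measurable Y" by (simp cong: measurable_cong_sets)
  have "AE x in \<nu>. RN_deriv \<nu> \<mu> x \<noteq> \<infinity>"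
    using \<mu>.sigma_finite_measure_axioms ac by (rule \<nu>.RN_deriv_finite) (simp add: sets_\<mu>)
  then have "density \<nu> (RN_deriv \<nu> \<mu>) = density \<nu> (\<lambda>x. ennreal (h x))"
    using hm by (intro density_cong) (auto simp: h_def less_top elim!: eventually_mono)
  then have \<mu>: "\<mu> = density \<nu> (\<lambda>x. ennreal (h x))"
    using \<nu>.density_RN_deriv[OF ac] sets_\<mu> by simp
  have trunc: "(\<integral>\<^sup>+y. ennreal (min (h y) (real m) powr \<alpha>) \<partial>\<nu>) \<le> R" for m :: nat
  proof -
    define k where "k y = min (h y) (real m)" for y
    define a where "a = (\<integral>\<^sup>+y. ennreal (k y powr \<alpha>) \<partial>\<nu>)"
    have k0: "k y \<ge> 0" "k y \<le> h y" "k y \<le> real m" for y using h0 by (auto simp: k_def)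
    have [measurable]: "k \<in> borel_measurable Y" by (simp add: k_def[abs_def])
    have "a \<le> (\<integral>\<^sup>+y. ennreal (real m powr \<alpha>) \<partial>\<nu>)"
      unfolding a_def using \<alpha> k0 by (intro nn_integral_mono ennreal_leI powr_mono2) auto
    \<comment> \<open>Finiteness is the purpose of the truncation: \<open>a\<close> reappears on the
      right with factor (\<alpha> - 1) / \<alpha> and has to be subtracted.\<close>
    then have a_fin: "a \<noteq> \<infinity>" using \<nu>.emeasure_space_1 by (auto simp: top_unique)
    have "a \<le> (\<integral>\<^sup>+y. ennreal (h y) * ennreal (k y powr (\<alpha> - 1)) \<partial>\<nu>)"
      unfolding a_def
    proof (intro nn_integral_mono)
      fix y
      have "k y powr \<alpha> = k y * k y powr (\<alpha> - 1)"
        using k0(1)[of y] by (cases "k y = 0") (auto simp: powr_diff)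
      also have "\<dots> \<le> h y * k y powr (\<alpha> - 1)"
        using k0 by (intro mult_right_mono) auto
      finally show "ennreal (k y powr \<alpha>) \<le> ennreal (h y) * ennreal (k y powr (\<alpha> - 1))"
        using h0 by (simp add: ennreal_leI flip: ennreal_mult)
    qed
    also have "\<dots> = (\<integral>\<^sup>+y. ennreal (k y powr (\<alpha> - 1)) \<partial>\<mu>)"
      unfolding \<mu> by (subst nn_integral_density) auto
    also have "\<dots> = (\<integral>\<^sup>+x. ennreal (k (\<Phi> x) powr (\<alpha> - 1)) * ennreal (r x) \<partial>N)"
      by (rule dens) measurable
    also have "\<dots> \<le> (\<integral>\<^sup>+x. ennreal ((\<alpha> - 1) / \<alpha>) * ennreal (k (\<Phi> x) powr \<alpha>) + ennreal (1 / \<alpha>) * ennreal (r x powr \<alpha>) \<partial>N)"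
    proof (intro nn_integral_mono)
      fix x
      show "ennreal (k (\<Phi> x) powr (\<alpha> - 1)) * ennreal (r x)
          \<le> ennreal ((\<alpha> - 1) / \<alpha>) * ennreal (k (\<Phi> x) powr \<alpha>) + ennreal (1 / \<alpha>) * ennreal (r x powr \<alpha>)"
        using Young_powr[OF k0(1) r0 \<alpha>, of "\<Phi> x" x] \<alpha> r0[of x]
        by (simp add: ennreal_leI flip: ennreal_mult ennreal_plus)
    qed
    also have "\<dots> = ennreal ((\<alpha> - 1) / \<alpha>) * a + ennreal (1 / \<alpha>) * R"
      unfolding a_def R_def \<nu>_def
      by (subst nn_integral_add) (auto simp: nn_integral_cmult nn_integral_distr)
    finally have le: "a \<le> ennreal ((\<alpha> - 1) / \<alpha>) * a + ennreal (1 / \<alpha>) * R" .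
    show ?thesis
    proof (cases R)
      case top
      then show ?thesis by simp
    next
      case (real R')
      obtain a' where a': "a = ennreal a'" "a' \<ge> 0" using a_fin by (cases a) auto
      have "a' \<le> (\<alpha> - 1) / \<alpha> * a' + 1 / \<alpha> * R'"
        using le a' real \<alpha> by (simp flip: ennreal_mult ennreal_plus)
      then have "a' \<le> R'" using \<alpha> by (simp add: field_simps)
      then show ?thesis using a' real unfolding a_def k_def by (simp add: ennreal_leI)
    qed
  qed
  have "(\<integral>\<^sup>+y. ennreal (h y powr \<alpha>) \<partial>\<nu>) \<le> (\<integral>\<^sup>+y. (SUP m. ennreal (min (h y) (real m) powr \<alpha>)) \<partial>\<nu>)"
  proof (intro nn_integral_mono)
    fix y
    obtain m :: nat where "h y \<le> real m" using real_arch_simple by blast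
    then show "ennreal (h y powr \<alpha>) \<le> (SUP m. ennreal (min (h y) (real m) powr \<alpha>))"
      by (intro SUP_upper2[of m]) auto
  qed
  also have "\<dots> = (SUP m. \<integral>\<^sup>+y. ennreal (min (h y) (real m) powr \<alpha>) \<partial>\<nu>)"
    using h0 \<alpha> by (intro nn_integral_monotone_convergence_SUP)
      (auto simp: incseq_def le_fun_def intro!: ennreal_leI powr_mono2)
  also have "\<dots> \<le> R" using trunc by (intro SUP_least)
  finally show "(\<integral>\<^sup>+y. ennreal (enn2real (RN_deriv \<nu> \<mu> y) powr \<alpha>) \<partial>\<nu>) \<le> (\<integral>\<^sup>+x. ennreal (r x powr \<alpha>) \<partial>N)"
    by (simp add: h_def R_def)
qed

section \<open>Measurability\<close>

text \<open>The first argument is replaced by the first point of a countable dense sequence within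
  distance 1 / (m + 1). This choice is a measurable index, so the approximations are countable
  pastings of measurable functions; they converge by continuity in the first argument.\<close>

lemma borel_measurable_Caratheodory:
  fixes h :: "'a::euclidean_space \<Rightarrow> 's \<Rightarrow> 'b::metric_space"
  assumes cont: "\<And>s. s \<in> space P \<Longrightarrow> continuous_on X (\<lambda>x. h x s)"
    and meas: "\<And>x. x \<in> X \<Longrightarrow> h x \<in> borel_measurable P"
  shows "(\<lambda>(x, s). h x s) \<in> borel_measurable (restrict_space borel X \<Otimes>\<^sub>M P)"
proof (cases "X = {}")
  case True
  then show ?thesis
    by (simp add: measurable_def space_pair_measure space_restrict_space)
next
  case False
  obtain T where T: "countable T" "T \<subseteq> X" "X \<subseteq> closure T"
    using separable[of X] by metis
  have "T \<noteq> {}" using T(3) False by auto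
  define q where "q = from_nat_into T"
  have q: "q i \<in> X" for i
    using from_nat_into[OF \<open>T \<noteq> {}\<close>, of i] T(2) by (auto simp: q_def)
  have dense: "\<exists>i. dist x (q i) < e" if x: "x \<in> X" and e: "e > 0" for x e
  proof -
    obtain y where "y \<in> T" "dist y x < e"
      using T(3) x e by (meson closure_approachable subsetD)
    then show ?thesis
      using from_nat_into_surj[OF T(1), of y] by (auto simp: q_def dist_commute)
  qed
  define idx where "idx m x = (LEAST i. dist x (q i) < 1 / real (Suc m))" for m and x :: 'a
  have idx: "dist x (q (idx m x)) < 1 / real (Suc m)" if "x \<in> X" for m x
    unfolding idx_def by (rule LeastI_ex) (rule dense[OF that], simp)
  let ?M = "restrict_space borel X \<Otimes>\<^sub>M P"
  have fst_meas [measurable]: "fst \<in> borel_measurable ?M"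
    by (rule measurable_compose[OF measurable_fst]) (rule measurable_restrict_space1, simp)
  show ?thesis
  proof (rule borel_measurable_LIMSEQ_metric)
    fix m
    have idx_meas: "(\<lambda>w. idx m (fst w)) \<in> ?M \<rightarrow>\<^sub>M count_space UNIV"
      unfolding idx_def by (rule measurable_Least) measurable
    show "(\<lambda>w. h (q (idx m (fst w))) (snd w)) \<in> borel_measurable ?M"
      by (rule measurable_compose_countable[OF _ idx_meas, where f="\<lambda>i w. h (q i) (snd w)"])
        (rule measurable_compose[OF measurable_snd], rule meas, rule q)
  next
    fix w assume "w \<in> space ?M"
    then have w: "fst w \<in> X" "snd w \<in> space P"
      by (auto simp: space_pair_measure space_restrict_space)
    have "(\<lambda>m. q (idx m (fst w))) \<longlonglongrightarrow> fst w"
    proof (rule metric_tendsto_imp_tendsto)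
      show "(\<lambda>m. 1 / real (Suc m)) \<longlonglongrightarrow> 0"
        by (rule LIMSEQ_Suc[OF lim_1_over_n])
      show "\<forall>\<^sub>F m in sequentially. dist (q (idx m (fst w))) (fst w) \<le> dist (1 / real (Suc m)) 0"
        using idx[OF w(1)] by (intro always_eventually allI) (auto simp: dist_commute less_imp_le)
    qed
    then have "(\<lambda>m. h (q (idx m (fst w))) (snd w)) \<longlonglongrightarrow> h (fst w) (snd w)"
      using q w by (intro continuous_on_tendsto_compose[OF cont[OF w(2)]]) auto
    then show "(\<lambda>m. h (q (idx m (fst w))) (snd w)) \<longlonglongrightarrow> (case w of (x, s) \<Rightarrow> h x s)"
      by (simp add: case_prod_beta)
  qed
qed

text \<open>A \<open>THE\<close> gives no direct access to measurability, so inner products are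
  used. Those with \<open>y - x\<close> are limits of measurable quotients, linearity extends this
  to the span, and of a basis vector only the component in the span matters because the gradient
  lies there.\<close>

lemma sample_grad_measurable:
  fixes X :: "'a::euclidean_space set"
  assumes X: "convex X" "x \<in> X"
    and f: "\<And>x. x \<in> X \<Longrightarrow> f x \<in> borel_measurable P"
    and diff: "\<And>s. s \<in> space P \<Longrightarrow> (\<lambda>x. f x s) differentiable_on X"
  shows "sample_grad X f x \<in> borel_measurable P"
proof -
  let ?V = "span ((\<lambda>y. y - x) ` X)"
  let ?g = "sample_grad X f x"
  have gV: "?g s \<in> ?V" if "s \<in> space P" for s
    unfolding sample_grad_def
    using diff[OF that] X by (intro grad_on_span) (auto simp: differentiable_on_def)
  have dir: "(\<lambda>s. ?g s \<bullet> (y - x)) \<in> borel_measurable P" if y: "y \<in> X" for y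
  proof (rule borel_measurable_LIMSEQ_real)
    fix s assume "s \<in> space P"
    then show "(\<lambda>m. real (Suc m) * (f (x + (1 / real (Suc m)) *\<^sub>R (y - x)) s - f x s)) \<longlonglongrightarrow> ?g s \<bullet> (y - x)"
      unfolding sample_grad_def using X y diff by (intro grad_on_quotients) auto
  next
    fix m
    have "x + (1 / real (Suc m)) *\<^sub>R (y - x) \<in> X"
      using convexD_alt[OF X y, of "1 / real (Suc m)"] by (simp add: algebra_simps)
    from f[OF this] f[OF X(2)]
    show "(\<lambda>s. real (Suc m) * (f (x + (1 / real (Suc m)) *\<^sub>R (y - x)) s - f x s)) \<in> borel_measurable P"
      by simp
  qed
  have span: "(\<lambda>s. ?g s \<bullet> e) \<in> borel_measurable P" if "e \<in> ?V" for e
    using that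
  proof (induction rule: span_induct)
    case base
    show ?case by (auto simp: subspace_def inner_add_right)
  next
    case (step e)
    then show ?case using dir by auto
  qed
  show ?thesis
  proof (rule borel_measurable_euclidean_space[THEN iffD2], rule ballI)
    fix b :: 'a assume "b \<in> Basis"
    obtain v w where v: "v \<in> ?V" "\<And>u. u \<in> ?V \<Longrightarrow> orthogonal w u" "b = v + w"
      using orthogonal_subspace_decomp_exists[of "(\<lambda>y. y - x) ` X" b] by metis
    have "?g s \<bullet> b = ?g s \<bullet> v" if "s \<in> space P" for s
      using v(2)[OF gV[OF that]] v(3) by (simp add: inner_add_right inner_add_left orthogonal_def inner_commute)
    then show "(\<lambda>s. ?g s \<bullet> b) \<in> borel_measurable P"
      using span[OF v(1)] by (simp cong: measurable_cong)
  qed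
qed

lemma borel_measurable_clip [measurable]: "(clip C :: 'a::euclidean_space \<Rightarrow> 'a) \<in> borel_measurable borel"
  unfolding clip_def[abs_def] by measurable

lemma borel_measurable_closest_point:
  fixes X :: "'a::euclidean_space set"
  assumes "convex X" "closed X" "X \<noteq> {}"
  shows "closest_point X \<in> borel_measurable borel"
  by (rule borel_measurable_continuous_onI) (rule continuous_on_closest_point[OF assms])

lemma measurable_oracle:
  assumes g: "(\<lambda>(x, s). g x s) \<in> (restrict_space borel X \<Otimes>\<^sub>M P) \<rightarrow>\<^sub>M N"
    and x: "x \<in> borel_measurable W" "\<And>w. w \<in> space W \<Longrightarrow> x w \<in> X" and s: "s \<in> W \<rightarrow>\<^sub>M P"
  shows "(\<lambda>w. g (x w) (s w)) \<in> W \<rightarrow>\<^sub>M N"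
proof -
  have "(\<lambda>w. (x w, s w)) \<in> W \<rightarrow>\<^sub>M restrict_space borel X \<Otimes>\<^sub>M P"
    using x by (intro measurable_Pair s measurable_restrict_space2) auto
  from measurable_compose[OF this g] show ?thesis by simp
qed

lemma clipped_sgd_measurable:
  fixes X :: "'a::euclidean_space set"
  assumes X: "convex X" "closed X"
    and g: "(\<lambda>(x, s). g x s) \<in> borel_measurable (restrict_space borel X \<Otimes>\<^sub>M P)"
    and x: "x \<in> borel_measurable W" "\<And>w. w \<in> space W \<Longrightarrow> x w \<in> X"
    and z: "\<And>l. l < t \<Longrightarrow> (\<lambda>w. z w l) \<in> W \<rightarrow>\<^sub>M P"
  shows "(\<lambda>w. clipped_sgd X g \<eta> C (z w) (x w) t) \<in> borel_measurable W"
proof (cases "space W = {}")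
  case True
  then show ?thesis by (simp add: measurable_def)
next
  case False
  then have ne: "X \<noteq> {}" using x(2) by auto
  note [measurable] = borel_measurable_closest_point[OF X ne]
  show ?thesis
    using z
  proof (induction t)
    case 0
    then show ?case using x(1) by simp
  next
    case (Suc t)
    have IH [measurable]: "(\<lambda>w. clipped_sgd X g \<eta> C (z w) (x w) t) \<in> borel_measurable W"
      using Suc by simp
    have [measurable]: "(\<lambda>w. g (clipped_sgd X g \<eta> C (z w) (x w) t) (z w t)) \<in> borel_measurable W"
      using Suc.prems x by (intro measurable_oracle[OF g IH]) (auto intro: clipped_sgd_in X)
    show ?case by (simp add: Let_def)
  qed
qed

lemma phase_average_measurable:
  fixes X :: "'a::euclidean_space set"
  assumes X: "convex X" "closed X"
    and g: "(\<lambda>(x, s). g x s) \<in> borel_measurable (restrict_space borel X \<Otimes>\<^sub>M P)"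
    and x: "x \<in> borel_measurable W" "\<And>w. w \<in> space W \<Longrightarrow> x w \<in> X"
    and z: "\<And>l. l < n \<Longrightarrow> (\<lambda>w. z w l) \<in> W \<rightarrow>\<^sub>M P" and i: "i \<ge> 1"
  shows "t \<le> n div 2 ^ i \<Longrightarrow> (\<lambda>w. phase_iterate X A n g (z w) i (x w) t) \<in> borel_measurable W"
    and "(\<lambda>w. phase_average X A n g (z w) i (x w)) \<in> borel_measurable W"
proof -
  have *: "(\<lambda>w. phase_iterate X A n g (z w) i (x w) t) \<in> borel_measurable W" if "t \<le> n div 2 ^ i" for t
    unfolding phase_iterate_def
    by (rule clipped_sgd_measurable[OF X g x]) (use i that in \<open>auto intro!: z phase_index_less_n\<close>)
  show "t \<le> n div 2 ^ i \<Longrightarrow> (\<lambda>w. phase_iterate X A n g (z w) i (x w) t) \<in> borel_measurable W" by (rule *)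
  show "(\<lambda>w. phase_average X A n g (z w) i (x w)) \<in> borel_measurable W"
    unfolding phase_average_def
    by (intro borel_measurable_scaleR borel_measurable_const borel_measurable_sum *) auto
qed

lemma phase_output_measurable:
  fixes X :: "'a::euclidean_space set"
  assumes X: "convex X" "closed X" and A: "init_point A \<in> X"
    and g: "(\<lambda>(x, s). g x s) \<in> borel_measurable (restrict_space borel X \<Otimes>\<^sub>M P)"
    and z: "\<And>l. l < n \<Longrightarrow> (\<lambda>w. z w l) \<in> W \<rightarrow>\<^sub>M P"
    and \<xi>: "\<And>i. i \<in> {1..m} \<Longrightarrow> (\<lambda>w. \<xi> w i) \<in> borel_measurable W"
  shows "(\<lambda>w. phase_output X A n g (z w) (\<xi> w) m) \<in> borel_measurable W"
  using \<xi>
proof (induction m)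
  case (Suc m)
  have IH: "(\<lambda>w. phase_output X A n g (z w) (\<xi> w) m) \<in> borel_measurable W"
    using Suc by simp
  have [measurable]: "(\<lambda>w. phase_average X A n g (z w) (Suc m) (phase_output X A n g (z w) (\<xi> w) m)) \<in> borel_measurable W"
    by (rule phase_average_measurable[OF X g IH]) (auto intro: z phase_output_in X A)
  have [measurable]: "closest_point X \<in> borel_measurable borel"
    using A by (intro borel_measurable_closest_point X) auto
  have [measurable]: "(\<lambda>w. \<xi> w (Suc m)) \<in> borel_measurable W"
    using Suc.prems by simp
  show ?case by simp
qed simp

lemma sets_phased_noise [measurable_cong]: "sets (phased_noise A) = sets (PiM {1..num_phases A} (\<lambda>_. borel))"
  unfolding phased_noise_def by (intro sets_PiM_cong) auto

lemma prob_space_phased_noise: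
  assumes "\<And>i. i \<in> {1..num_phases A} \<Longrightarrow> noise_dev A i > 0"
  shows "prob_space (phased_noise A)"
proof -
  \<comment> \<open>Positive deviations are known only for indices of phases, whereas the product
    rule asks for a probability measure at every index; the others are replaced by a standard
    Gaussian.\<close>
  have "phased_noise A = PiM {1..num_phases A} (\<lambda>i. gaussian (if i \<in> {1..num_phases A} then noise_dev A i else 1))"
    unfolding phased_noise_def by (intro PiM_cong) auto
  also have "prob_space \<dots>"
    using assms by (intro prob_space_PiM prob_space_gaussian) auto
  finally show ?thesis .
qed

lemma phased_law_measurable:
  fixes X :: "'a::euclidean_space set"
  assumes X: "convex X" "closed X" and A: "valid_params X n A"
    and g: "(\<lambda>(x, s). g x s) \<in> borel_measurable (restrict_space borel X \<Otimes>\<^sub>M P)"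
  shows "phased_law X A n g \<in> PiM {..<n} (\<lambda>_. P) \<rightarrow>\<^sub>M prob_algebra (restrict_space borel X)"
proof -
  have init: "init_point A \<in> X" using A by (simp add: valid_params_def)
  have "prob_space (phased_noise A)"
    using A by (intro prob_space_phased_noise) (auto simp: valid_params_def)
  then have "(\<lambda>_. phased_noise A) \<in> PiM {..<n} (\<lambda>_. P) \<rightarrow>\<^sub>M prob_algebra (phased_noise A)"
    by (intro measurable_const) (simp add: space_prob_algebra)
  moreover have "(\<lambda>(z, \<xi>). phase_output X A n g z \<xi> (num_phases A))
      \<in> PiM {..<n} (\<lambda>_. P) \<Otimes>\<^sub>M phased_noise A \<rightarrow>\<^sub>M restrict_space borel X"
  proof (rule measurable_restrict_space2)
    show "(\<lambda>(z, \<xi>). phase_output X A n g z \<xi> (num_phases A))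
      \<in> borel_measurable (PiM {..<n} (\<lambda>_. P) \<Otimes>\<^sub>M phased_noise A)"
      unfolding case_prod_beta
      by (rule phase_output_measurable[OF X init g]) measurable
  qed (auto intro: phase_output_in X init)
  ultimately show ?thesis
    unfolding phased_law_def[abs_def] by (intro measurable_distr_prob_space2)
qed

section \<open>Privacy\<close>

text \<open>Serves the case of an exchanged entry that no phase reads, where the two output laws
  coincide. Post-processing by the identity with density 1 gives the moments without computing
  \<open>RN_deriv\<close>.\<close>

lemma renyi_divergence_self:
  assumes "prob_space \<nu>" "\<rho> \<ge> 0" "\<alpha> \<ge> 1"
  shows "renyi_divergence \<alpha> \<nu> \<nu> \<le> ereal (\<alpha> * \<rho>)"
proof -
  interpret prob_space \<nu> by fact
  have "absolutely_continuous (distr \<nu> \<nu> (\<lambda>x. x)) \<nu>"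
    by (rule renyi_postprocessing(1)[where r="\<lambda>_. 1"]) (use assms in auto)
  moreover have "(\<integral>\<^sup>+x. ennreal (enn2real (RN_deriv \<nu> \<nu> x) powr \<beta>) \<partial>\<nu>) \<le> ennreal (exp (\<beta> * (\<beta> - 1) * \<rho>))"
    if \<beta>: "\<beta> > 1" for \<beta>
  proof -
    have "(\<integral>\<^sup>+x. ennreal (enn2real (RN_deriv (distr \<nu> \<nu> (\<lambda>x. x)) \<nu> x) powr \<beta>) \<partial>distr \<nu> \<nu> (\<lambda>x. x))
        \<le> (\<integral>\<^sup>+x. ennreal (1 powr \<beta>) \<partial>\<nu>)"
      by (rule renyi_postprocessing(2)[where r="\<lambda>_. 1"]) (use assms \<beta> in auto)
    also have "\<dots> = 1" using emeasure_space_1 by simp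
    also have "\<dots> \<le> ennreal (exp (\<beta> * (\<beta> - 1) * \<rho>))" using \<beta> assms by simp
    finally show ?thesis by (simp add: distr_id)
  qed
  ultimately show ?thesis
    using assms by (intro renyi_divergence_le) (auto simp: distr_id)
qed

text \<open>Since \<Delta> ignores coordinate \<open>i\<close>, it is a constant vector once the
  other coordinates are fixed, and the inner integral is that of a translated Gaussian. The
  resulting conditional moments are bounded uniformly in the other coordinates, so they survive
  integration over them, and \<Phi> is post-processing.\<close>

lemma renyi_gaussian_shift:
  fixes \<Delta> :: "(nat \<Rightarrow> 'a::euclidean_space) \<Rightarrow> 'a"
  assumes J: "finite J" "i \<in> J" and \<tau>: "\<And>j. \<tau> j > 0" and \<alpha>: "\<alpha> \<ge> 1"
  defines "N \<equiv> PiM J (\<lambda>j. gaussian (\<tau> j))"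
  assumes \<Delta>_meas: "\<Delta> \<in> borel_measurable (PiM J (\<lambda>_. borel))" and \<Phi>_meas: "\<Phi> \<in> PiM J (\<lambda>_. borel) \<rightarrow>\<^sub>M Y"
    and \<Delta>: "\<And>\<xi> v. \<Delta> (\<xi>(i := v)) = \<Delta> \<xi>" "\<And>\<xi>. (norm (\<Delta> \<xi>))\<^sup>2 \<le> 2 * \<rho> * (\<tau> i)\<^sup>2"
  shows "renyi_divergence \<alpha> (distr N Y (\<lambda>\<xi>. \<Phi> (\<xi>(i := \<xi> i + \<Delta> \<xi>)))) (distr N Y \<Phi>) \<le> ereal (\<alpha> * \<rho>)"
proof -
  have sets_N [measurable_cong]: "sets N = sets (PiM J (\<lambda>_. borel))"
    unfolding N_def by (intro sets_PiM_cong) auto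
  have \<Delta>' [measurable]: "\<Delta> \<in> borel_measurable N" using \<Delta>_meas by (simp cong: measurable_cong_sets add: sets_N)
  have \<Phi>' [measurable]: "\<Phi> \<in> N \<rightarrow>\<^sub>M Y" using \<Phi>_meas by (simp cong: measurable_cong_sets add: sets_N)
  have comp [measurable]: "(\<lambda>\<xi>. \<xi> i) \<in> borel_measurable N"
    using J(2) by measurable
  have shift [measurable]: "(\<lambda>\<xi>. \<xi>(i := \<xi> i + \<Delta> \<xi>)) \<in> N \<rightarrow>\<^sub>M N"
  proof -
    have "(\<lambda>\<xi>. \<xi>(i := \<xi> i + \<Delta> \<xi>)) \<in> N \<rightarrow>\<^sub>M PiM (insert i J) (\<lambda>_. borel)"
      by (rule measurable_fun_upd[where J=J]) (use J in \<open>auto simp: insert_absorb\<close>)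
    then show ?thesis using J(2) by (simp cong: measurable_cong_sets add: sets_N insert_absorb)
  qed
  have ps: "prob_space N" unfolding N_def by (intro prob_space_PiM prob_space_gaussian \<tau>)
  interpret N: prob_space N by (rule ps)
  have "\<rho> \<ge> 0"
  proof -
    have "0 \<le> 2 * \<rho> * (\<tau> i)\<^sup>2" by (rule order_trans[OF _ \<Delta>(2)[of undefined]]) simp
    then show ?thesis using \<tau>[of i] by (simp add: zero_le_mult_iff)
  qed
  interpret product_sigma_finite "\<lambda>j. gaussian (\<tau> j) :: 'a measure"
    by (intro product_sigma_finite.intro prob_space_imp_sigma_finite prob_space_gaussian \<tau>)
  define I where "I = J - {i}"
  have I: "finite I" "i \<notin> I" "insert i I = J" using J by (auto simp: I_def)
  have fubini: "(\<integral>\<^sup>+\<xi>. H \<xi> \<partial>N) = (\<integral>\<^sup>+w. (\<integral>\<^sup>+v. H (w(i := v)) \<partial>gaussian (\<tau> i)) \<partial>PiM I (\<lambda>j. gaussian (\<tau> j)))"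
    if "H \<in> borel_measurable N" for H
    using product_nn_integral_insert[OF I(1,2), of H] that unfolding I(3) N_def .
  define r where "r \<xi> = exp ((2 * (\<Delta> \<xi> \<bullet> \<xi> i) - (norm (\<Delta> \<xi>))\<^sup>2) / (2 * (\<tau> i)\<^sup>2))" for \<xi>
  have [measurable]: "r \<in> borel_measurable N" unfolding r_def[abs_def] by measurable
  have upd: "(\<lambda>v. w(i := v)) \<in> borel \<rightarrow>\<^sub>M N" if "w \<in> space (PiM I (\<lambda>j. gaussian (\<tau> j)))" for w
    using measurable_component_update[OF that I(2)] by (simp cong: measurable_cong_sets add: I(3) N_def)
  have dens: "(\<integral>\<^sup>+y. H y \<partial>distr N Y (\<lambda>\<xi>. \<Phi> (\<xi>(i := \<xi> i + \<Delta> \<xi>)))) = (\<integral>\<^sup>+\<xi>. H (\<Phi> \<xi>) * ennreal (r \<xi>) \<partial>N)"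
    if [measurable]: "H \<in> borel_measurable Y" for H
  proof -
    have "(\<integral>\<^sup>+y. H y \<partial>distr N Y (\<lambda>\<xi>. \<Phi> (\<xi>(i := \<xi> i + \<Delta> \<xi>)))) = (\<integral>\<^sup>+\<xi>. H (\<Phi> (\<xi>(i := \<xi> i + \<Delta> \<xi>))) \<partial>N)"
      by (rule nn_integral_distr) measurable
    also have "\<dots> = (\<integral>\<^sup>+w. (\<integral>\<^sup>+v. H (\<Phi> (w(i := v + \<Delta> w))) \<partial>gaussian (\<tau> i)) \<partial>PiM I (\<lambda>j. gaussian (\<tau> j)))"
      by (subst fubini) (auto simp: \<Delta>)
    also have "\<dots> = (\<integral>\<^sup>+w. (\<integral>\<^sup>+v. H (\<Phi> (w(i := v))) * ennreal (r (w(i := v))) \<partial>gaussian (\<tau> i)) \<partial>PiM I (\<lambda>j. gaussian (\<tau> j)))"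
    proof (rule nn_integral_cong)
      fix w assume "w \<in> space (PiM I (\<lambda>j. gaussian (\<tau> j) :: 'a measure))"
      note [measurable] = upd[OF this]
      show "(\<integral>\<^sup>+v. H (\<Phi> (w(i := v + \<Delta> w))) \<partial>gaussian (\<tau> i))
          = (\<integral>\<^sup>+v. H (\<Phi> (w(i := v))) * ennreal (r (w(i := v))) \<partial>gaussian (\<tau> i))"
        using nn_integral_gaussian_translate[of "\<lambda>v. H (\<Phi> (w(i := v)))" "\<tau> i" "\<Delta> w"]
        by (simp add: r_def \<Delta>)
    qed
    also have "\<dots> = (\<integral>\<^sup>+\<xi>. H (\<Phi> \<xi>) * ennreal (r \<xi>) \<partial>N)"
      by (subst fubini) auto
    finally show ?thesis .
  qed
  have prob: "prob_space (distr N Y (\<lambda>\<xi>. \<Phi> (\<xi>(i := \<xi> i + \<Delta> \<xi>))))" "prob_space (distr N Y \<Phi>)"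
    by (rule N.prob_space_distr, measurable)+
  have pow: "(\<integral>\<^sup>+\<xi>. ennreal (r \<xi> powr \<beta>) \<partial>N) \<le> ennreal (exp (\<beta> * (\<beta> - 1) * \<rho>))" if \<beta>: "\<beta> > 1" for \<beta>
  proof -
    interpret I: prob_space "PiM I (\<lambda>j. gaussian (\<tau> j) :: 'a measure)"
      by (intro prob_space_PiM prob_space_gaussian \<tau>)
    have "(\<integral>\<^sup>+\<xi>. ennreal (r \<xi> powr \<beta>) \<partial>N)
        = (\<integral>\<^sup>+w. (\<integral>\<^sup>+v. ennreal (r (w(i := v)) powr \<beta>) \<partial>gaussian (\<tau> i)) \<partial>PiM I (\<lambda>j. gaussian (\<tau> j)))"
      by (rule fubini) measurable
    also have "\<dots> = (\<integral>\<^sup>+w. ennreal (exp (\<beta> * (\<beta> - 1) * (norm (\<Delta> w))\<^sup>2 / (2 * (\<tau> i)\<^sup>2))) \<partial>PiM I (\<lambda>j. gaussian (\<tau> j)))"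
      unfolding r_def by (simp add: \<Delta> nn_integral_gaussian_tilt_powr[OF \<tau>])
    also have "\<dots> \<le> (\<integral>\<^sup>+w. ennreal (exp (\<beta> * (\<beta> - 1) * \<rho>)) \<partial>PiM I (\<lambda>j. gaussian (\<tau> j) :: 'a measure))"
    proof (intro nn_integral_mono ennreal_leI exp_mono)
      fix w
      have "\<beta> * (\<beta> - 1) * (norm (\<Delta> w))\<^sup>2 \<le> \<beta> * (\<beta> - 1) * (2 * \<rho> * (\<tau> i)\<^sup>2)"
        using \<beta> by (intro mult_left_mono \<Delta>) auto
      then show "\<beta> * (\<beta> - 1) * (norm (\<Delta> w))\<^sup>2 / (2 * (\<tau> i)\<^sup>2) \<le> \<beta> * (\<beta> - 1) * \<rho>"
        using \<tau>[of i] by (simp add: divide_le_eq mult_ac)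
    qed
    also have "\<dots> = ennreal (exp (\<beta> * (\<beta> - 1) * \<rho>))"
      using I.emeasure_space_1 by simp
    finally show ?thesis .
  qed
  show ?thesis
  proof (rule renyi_divergence_le[OF prob _ _ \<open>\<rho> \<ge> 0\<close> _ \<alpha>])
    show "absolutely_continuous (distr N Y \<Phi>) (distr N Y (\<lambda>\<xi>. \<Phi> (\<xi>(i := \<xi> i + \<Delta> \<xi>))))"
      by (rule renyi_postprocessing(1)[OF ps prob(1) \<Phi>' _ _ _ dens]) (auto simp: r_def)
    fix \<beta> :: real assume \<beta>: "\<beta> > 1"
    have "(\<integral>\<^sup>+x. ennreal (enn2real (RN_deriv (distr N Y \<Phi>) (distr N Y (\<lambda>\<xi>. \<Phi> (\<xi>(i := \<xi> i + \<Delta> \<xi>)))) x) powr \<beta>) \<partial>distr N Y \<Phi>)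
        \<le> (\<integral>\<^sup>+\<xi>. ennreal (r \<xi> powr \<beta>) \<partial>N)"
      by (rule renyi_postprocessing(2)[OF ps prob(1) \<Phi>' _ _ _ dens \<beta>]) (auto simp: r_def)
    also note pow[OF \<beta>]
    finally show "(\<integral>\<^sup>+x. ennreal (enn2real (RN_deriv (distr N Y \<Phi>) (distr N Y (\<lambda>\<xi>. \<Phi> (\<xi>(i := \<xi> i + \<Delta> \<xi>)))) x) powr \<beta>) \<partial>distr N Y \<Phi>)
        \<le> ennreal (exp (\<beta> * (\<beta> - 1) * \<rho>))" .
  qed simp
qed

text \<open>Hypothesis \<open>dev\<close> is the calibration of the noise to the sensitivity: a
  shift of length 2 \<eta> C then costs at most \<rho> per unit of \<alpha>. No composition over
  phases is needed, as neighboring data sets differ within at most one phase. \<open>noise\<close>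
  ranges over all indices because the Gaussians are treated as a family over all naturals.\<close>

lemma phased_law_CDP:
  fixes X :: "'a::euclidean_space set" and A :: "'a phased_params"
  assumes X: "convex X" "closed X" and A: "valid_params X n A" and noise: "\<And>i. noise_dev A i > 0"
    and g: "(\<lambda>(x, s). g x s) \<in> borel_measurable (restrict_space borel X \<Otimes>\<^sub>M P)"
    and \<rho>: "\<rho> \<ge> 0"
    and nonexp: "\<And>i x y s. i \<in> {1..num_phases A} \<Longrightarrow> x \<in> X \<Longrightarrow> y \<in> X \<Longrightarrow> s \<in> space P \<Longrightarrow>
      norm ((x - step_size A i *\<^sub>R clip (clip_level A i) (g x s)) - (y - step_size A i *\<^sub>R clip (clip_level A i) (g y s)))
        \<le> norm (x - y)"
    and dev: "\<And>i. i \<in> {1..num_phases A} \<Longrightarrow> (2 * step_size A i * clip_level A i)\<^sup>2 \<le> 2 * \<rho> * (noise_dev A i)\<^sup>2"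
  shows "CDP \<rho> n (space P) (phased_law X A n g)"
  unfolding CDP_def
proof (intro ballI impI allI)
  fix z z' \<alpha> assume z: "z \<in> {..<n} \<rightarrow>\<^sub>E space P" and z': "z' \<in> {..<n} \<rightarrow>\<^sub>E space P"
    and nb: "neighboring n z z'" and \<alpha>: "(1::real) \<le> \<alpha>"
  have init: "init_point A \<in> X" using A by (simp add: valid_params_def)
  let ?m = "num_phases A"
  let ?Y = "restrict_space borel X"
  have out_meas: "(\<lambda>\<xi>. phase_output X A n g z \<xi> m) \<in> borel_measurable (PiM {1..?m} (\<lambda>_. borel))"
    if "z \<in> {..<n} \<rightarrow>\<^sub>E space P" "m \<le> ?m" for z m
  proof (rule phase_output_measurable[OF X init g, where z="\<lambda>_. z" and \<xi>="\<lambda>\<xi>. \<xi>"])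
    show "(\<lambda>w. z l) \<in> PiM {1..?m} (\<lambda>_. borel) \<rightarrow>\<^sub>M P" if "l < n" for l
      using PiE_mem[OF \<open>z \<in> _\<close>, of l] that by (intro measurable_const) simp
    show "(\<lambda>w. w i) \<in> borel_measurable (PiM {1..?m} (\<lambda>_. borel))" if "i \<in> {1..m}" for i
      using that \<open>m \<le> ?m\<close> by (intro measurable_component_singleton) auto
  qed
  have out_meas': "(\<lambda>\<xi>. phase_output X A n g z \<xi> ?m) \<in> PiM {1..?m} (\<lambda>_. borel) \<rightarrow>\<^sub>M ?Y"
    if "z \<in> {..<n} \<rightarrow>\<^sub>E space P" for z
    using that by (intro measurable_restrict_space2 out_meas) (auto intro: phase_output_in X init)
  have prob: "prob_space (phased_law X A n g z')"
  proof -
    interpret prob_space "phased_noise A" by (intro prob_space_phased_noise noise)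
    show ?thesis unfolding phased_law_def
      using out_meas'[OF z'] by (intro prob_space_distr) (simp cong: measurable_cong_sets add: sets_phased_noise)
  qed
  obtain j where "{l. l < n \<and> z l \<noteq> z' l} = {j}"
    using nb unfolding neighboring_def by (auto simp: card_1_singleton_iff)
  then have j: "\<And>l. l < n \<Longrightarrow> l \<noteq> j \<Longrightarrow> z l = z' l" by blast
  show "renyi_divergence \<alpha> (phased_law X A n g z) (phased_law X A n g z') \<le> ereal (\<alpha> * \<rho>)"
  \<comment> \<open>Entries behind the last phase are never read, and exchanging one of them does
    not change the law.\<close>
  proof (cases "j < phase_start n (Suc ?m)")
    case False
    have "phase_output X A n g z \<xi> ?m = phase_output X A n g z' \<xi> ?m" for \<xi>
      using False phase_start_le[of n "Suc ?m"] by (intro phase_output_cong j) auto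
    then have "phased_law X A n g z = phased_law X A n g z'"
      by (simp add: phased_law_def)
    then show ?thesis using renyi_divergence_self[OF prob \<rho> \<alpha>] by simp
  next
    case True
    then obtain i where i: "i \<in> {1..?m}" "phase_start n i \<le> j" "j < phase_start n (Suc i)"
      using phase_start_interval by blast
    have i1: "i \<ge> 1" using i by auto
    define \<Delta> where "\<Delta> \<xi> = phase_average X A n g z i (phase_output X A n g z \<xi> (i - 1))
                  - phase_average X A n g z' i (phase_output X A n g z \<xi> (i - 1))" for \<xi>
    have shift: "phase_output X A n g z \<xi> ?m = phase_output X A n g z' (\<xi>(i := \<xi> i + \<Delta> \<xi>)) ?m" for \<xi>
      unfolding \<Delta>_def using i by (intro phase_output_shift[OF i1 i(2,3) j]) auto
    have law: "phased_law X A n g z = distr (phased_noise A) ?Y (\<lambda>\<xi>. phase_output X A n g z' (\<xi>(i := \<xi> i + \<Delta> \<xi>)) ?m)"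
      unfolding phased_law_def shift ..
    have "renyi_divergence \<alpha> (distr (phased_noise A) ?Y (\<lambda>\<xi>. phase_output X A n g z' (\<xi>(i := \<xi> i + \<Delta> \<xi>)) ?m))
        (distr (phased_noise A) ?Y (\<lambda>\<xi>. phase_output X A n g z' \<xi> ?m)) \<le> ereal (\<alpha> * \<rho>)"
      unfolding phased_noise_def
    proof (rule renyi_gaussian_shift[OF _ i(1) noise \<alpha> _ out_meas'[OF z']])
      have avg: "(\<lambda>\<xi>. phase_average X A n g y i (phase_output X A n g z \<xi> (i - 1))) \<in> borel_measurable (PiM {1..?m} (\<lambda>_. borel))"
        if "y \<in> {..<n} \<rightarrow>\<^sub>E space P" for y
      proof (rule phase_average_measurable(2)[OF X g, where z="\<lambda>_. y" and x="\<lambda>\<xi>. phase_output X A n g z \<xi> (i - 1)"])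
        show "(\<lambda>\<xi>. phase_output X A n g z \<xi> (i - 1)) \<in> borel_measurable (PiM {1..?m} (\<lambda>_. borel))"
          using i by (intro out_meas z) auto
        show "(\<lambda>w. y l) \<in> PiM {1..?m} (\<lambda>_. borel) \<rightarrow>\<^sub>M P" if "l < n" for l
          using PiE_mem[OF \<open>y \<in> _\<close>, of l] that by (intro measurable_const) simp
      qed (use i1 phase_output_in[OF X(2) init] in auto)
      show "\<Delta> \<in> borel_measurable (PiM {1..?m} (\<lambda>_. borel))"
        unfolding \<Delta>_def[abs_def] by (intro borel_measurable_diff avg z z')
      \<comment> \<open>The output of phase \<open>i - 1\<close> involves noise up to index
        \<open>i - 1\<close> only.\<close>
      show "\<Delta> (\<xi>(i := v)) = \<Delta> \<xi>" for \<xi> v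
      proof -
        have "phase_output X A n g z (\<xi>(i := v)) (i - 1) = phase_output X A n g z \<xi> (i - 1)"
          using i1 by (intro phase_output_cong) auto
        then show ?thesis by (simp add: \<Delta>_def)
      qed
      show "(norm (\<Delta> \<xi>))\<^sup>2 \<le> 2 * \<rho> * (noise_dev A i)\<^sup>2" for \<xi>
      proof -
        have "norm (\<Delta> \<xi>) \<le> 2 * step_size A i * clip_level A i"
          unfolding \<Delta>_def using A i z
          by (intro phase_average_sensitivity[OF X(1,2) phase_output_in[OF X(2) init] _ _ nonexp[OF i(1)] i1 _ j])
            (auto simp: valid_params_def)
        then have "(norm (\<Delta> \<xi>))\<^sup>2 \<le> (2 * step_size A i * clip_level A i)\<^sup>2"
          by (intro power_mono) auto
        also note dev[OF i(1)]
        finally show ?thesis .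
      qed
    qed simp
    then show ?thesis unfolding law by (simp add: phased_law_def)
  qed
qed

section \<open>Heavy-tailed losses and fresh samples\<close>

text \<open>Beyond the threshold \<open>l / C\<close> exceeds 1, so multiplying by its powers only
  increases the value. With \<open>m = k - 1\<close> this turns the moment of order \<open>k\<close>
  into a bound on the clipping bias.\<close>

lemma excess_le_power_div:
  fixes l C :: real
  assumes "l \<ge> 0" "C > 0"
  shows "max 0 (l - C) \<le> l ^ Suc m / C ^ m"
proof (cases "l \<le> C")
  case False
  then have "1 \<le> (l / C) ^ m" using assms by (intro one_le_power) simp
  then have "l * 1 \<le> l * (l / C) ^ m" using assms(1) by (rule mult_left_mono)
  then show ?thesis using False assms by (simp add: power_divide)
qed (use assms in auto)

locale heavy_tailed =
  fixes k :: nat and G :: "nat \<Rightarrow> real" and X :: "'a::euclidean_space set" and P :: "'s measure"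
    and f :: "'a \<Rightarrow> 's \<Rightarrow> real"
  assumes X: "compact X" "convex X" "X \<noteq> {}" and k: "k \<ge> 2" and sco: "heavy_tailed_sco k G X P f"
begin

abbreviation "g \<equiv> sample_grad X f"
abbreviation "L \<equiv> sample_lip X f"
abbreviation "F \<equiv> pop_loss P f"
abbreviation "D \<equiv> diameter X"

sublocale P: prob_space P
  using sco by (simp add: heavy_tailed_sco_def)

lemma closedX: "closed X" by (rule compact_imp_closed[OF X(1)])

lemma norm_le_diameter: "x \<in> X \<Longrightarrow> y \<in> X \<Longrightarrow> norm (x - y) \<le> D"
  using diameter_bounded_bound[OF compact_imp_bounded[OF X(1)]] by (simp add: dist_norm)

lemma diameter_nonneg: "0 \<le> D"
  by (rule diameter_ge_0[OF compact_imp_bounded[OF X(1)]])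

lemma f_convex: "s \<in> space P \<Longrightarrow> convex_on X (\<lambda>x. f x s)"
  and f_C1: "s \<in> space P \<Longrightarrow> C1_on X (\<lambda>x. f x s)"
  and f_integrable: "x \<in> X \<Longrightarrow> integrable P (f x)"
  and L_moment: "j \<in> {1..k} \<Longrightarrow> integrable P (\<lambda>s. L s ^ j)"
    "j \<in> {1..k} \<Longrightarrow> (\<integral>s. L s ^ j \<partial>P) \<le> G j ^ j"
  using sco by (auto simp: heavy_tailed_sco_def)

lemma f_differentiable: "s \<in> space P \<Longrightarrow> (\<lambda>x. f x s) differentiable_on X"
  and g_continuous: "s \<in> space P \<Longrightarrow> continuous_on X (\<lambda>x. g x s)"
  using f_C1 by (auto simp: C1_on_def sample_grad_def)

lemma norm_g_le: "x \<in> X \<Longrightarrow> s \<in> space P \<Longrightarrow> norm (g x s) \<le> L s"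
  unfolding sample_lip_def
  by (intro cSUP_upper bounded_imp_bdd_above compact_imp_bounded compact_continuous_image
      continuous_on_norm g_continuous X(1))

lemma L_nonneg: "s \<in> space P \<Longrightarrow> 0 \<le> L s"
  using X(3) order_trans[OF norm_ge_zero norm_g_le] by blast

lemma f_diff_le: "x \<in> X \<Longrightarrow> y \<in> X \<Longrightarrow> s \<in> space P \<Longrightarrow> f x s - f y s \<le> g x s \<bullet> (x - y)"
  using convex_grad_on_ineq[OF f_convex _ _ f_differentiable, of s x y]
  by (simp add: sample_grad_def inner_diff_right)

lemma f_lipschitz:
  assumes "x \<in> X" "y \<in> X" "s \<in> space P"
  shows "\<bar>f x s - f y s\<bar> \<le> L s * norm (x - y)"
proof -
  have *: "f x s - f y s \<le> L s * norm (x - y)" if "x \<in> X" "y \<in> X" for x y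
  proof -
    have "f x s - f y s \<le> g x s \<bullet> (x - y)" by (rule f_diff_le[OF that assms(3)])
    also have "\<dots> \<le> norm (g x s) * norm (x - y)" by (rule norm_cauchy_schwarz)
    also have "\<dots> \<le> L s * norm (x - y)"
      by (intro mult_right_mono norm_g_le that assms) simp
    finally show ?thesis .
  qed
  show ?thesis using *[OF assms(1,2)] *[OF assms(2,1)] by (simp add: norm_minus_commute)
qed

lemma f_measurable: "(\<lambda>(x, s). f x s) \<in> borel_measurable (restrict_space borel X \<Otimes>\<^sub>M P)"
  using f_differentiable f_integrable
  by (intro borel_measurable_Caratheodory) (auto intro: differentiable_imp_continuous_on)

lemma g_measurable: "(\<lambda>(x, s). g x s) \<in> borel_measurable (restrict_space borel X \<Otimes>\<^sub>M P)"
  using f_integrable f_differentiable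
  by (intro borel_measurable_Caratheodory g_continuous sample_grad_measurable X(2)) auto

lemma L_integrable: "integrable P L" and L_expectation_le: "(\<integral>s. L s \<partial>P) \<le> G 1"
  using L_moment[of 1] k by auto

lemma L_measurable [measurable]: "L \<in> borel_measurable P"
  using L_integrable by simp

lemma G1_nonneg: "0 \<le> G 1"
proof -
  have "0 \<le> (\<integral>s. L s \<partial>P)" by (rule Bochner_Integration.integral_nonneg) (rule L_nonneg)
  then show ?thesis using L_expectation_le by linarith
qed

lemma F_lipschitz:
  assumes "x \<in> X" "y \<in> X"
  shows "\<bar>F x - F y\<bar> \<le> G 1 * norm (x - y)"
proof -
  have "F x - F y = (\<integral>s. f x s - f y s \<partial>P)"
    using assms f_integrable by (simp add: pop_loss_def)
  also have "\<bar>\<dots>\<bar> \<le> (\<integral>s. \<bar>f x s - f y s\<bar> \<partial>P)"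
    by (rule integral_abs_bound)
  also have "\<dots> \<le> (\<integral>s. L s * norm (x - y) \<partial>P)"
    using assms f_integrable L_integrable by (intro integral_mono f_lipschitz) auto
  also have "\<dots> \<le> G 1 * norm (x - y)"
    using L_expectation_le by (simp add: mult_right_mono)
  finally show ?thesis .
qed

lemma F_diff_bound: "x \<in> X \<Longrightarrow> y \<in> X \<Longrightarrow> \<bar>F x - F y\<bar> \<le> G 1 * D"
  using F_lipschitz[of x y] mult_left_mono[OF norm_le_diameter[of x y] G1_nonneg] by linarith

lemma F_continuous: "continuous_on X F"
proof -
  have "(G 1)-lipschitz_on X F"
    using F_lipschitz G1_nonneg by (intro lipschitz_onI) (auto simp: dist_norm)
  then show ?thesis by (rule lipschitz_on_continuous_on)
qed

lemma F_measurable: "F \<in> borel_measurable (restrict_space borel X)"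
  by (rule borel_measurable_continuous_on_restrict[OF F_continuous])

lemma F_convex: "convex_on X F"
proof (rule convex_onI[OF _ X(2)])
  fix t x y assume t: "0 < t" "t < (1::real)" and xy: "x \<in> X" "y \<in> X"
  have m: "(1 - t) *\<^sub>R x + t *\<^sub>R y \<in> X"
    using convexD_alt[OF X(2) xy, of t] t by simp
  have "F ((1 - t) *\<^sub>R x + t *\<^sub>R y) \<le> (\<integral>s. (1 - t) * f x s + t * f y s \<partial>P)"
    unfolding pop_loss_def using t xy f_integrable f_integrable[OF m] f_convex
    by (intro integral_mono) (auto intro!: convex_onD)
  also have "\<dots> = (1 - t) * F x + t * F y"
    using xy f_integrable by (simp add: pop_loss_def)
  finally show "F ((1 - t) *\<^sub>R x + t *\<^sub>R y) \<le> (1 - t) * F x + t * F y" .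
qed

lemma clip_bias_integrable: "integrable P (\<lambda>s. max 0 (L s - C))"
  using L_integrable by (intro integrable_max) auto

lemma clip_bias_le:
  assumes "C > 0"
  shows "(\<integral>s. max 0 (L s - C) \<partial>P) \<le> G k ^ k / C ^ (k - 1)"
proof -
  have k1: "k \<in> {1..k}" "Suc (k - 1) = k" using k by auto
  have "(\<integral>s. max 0 (L s - C) \<partial>P) \<le> (\<integral>s. L s ^ k / C ^ (k - 1) \<partial>P)"
    using excess_le_power_div[OF L_nonneg assms, of _ "k - 1"] L_moment(1)[OF k1(1)] k1(2)
    by (intro integral_mono clip_bias_integrable) auto
  also have "\<dots> \<le> G k ^ k / C ^ (k - 1)"
    using L_moment(2)[OF k1(1)] assms by (simp add: divide_right_mono)
  finally show ?thesis .
qed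

end

section \<open>Replacing a fresh sample by its expectation\<close>

lemma nn_integral_fresh_sample:
  fixes j n :: nat and P :: "'s measure" and N :: "'c measure"
  assumes "prob_space P" "prob_space N" and j: "j < n"
    and Z [measurable]: "Z \<in> PiM {..<n} (\<lambda>_. P) \<Otimes>\<^sub>M N \<rightarrow>\<^sub>M M'"
    and Zj: "\<And>z s \<xi>. Z (z(j := s), \<xi>) = Z (z, \<xi>)"
    and H [measurable]: "H \<in> borel_measurable (M' \<Otimes>\<^sub>M P)"
  shows "(\<integral>\<^sup>+w. H (Z w, fst w j) \<partial>(PiM {..<n} (\<lambda>_. P) \<Otimes>\<^sub>M N))
       = (\<integral>\<^sup>+w. (\<integral>\<^sup>+s. H (Z w, s) \<partial>P) \<partial>(PiM {..<n} (\<lambda>_. P) \<Otimes>\<^sub>M N))"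
proof -
  let ?Q = "PiM {..<n} (\<lambda>_. P)"
  interpret P: prob_space P by fact
  interpret N: prob_space N by fact
  interpret Q: prob_space ?Q by (intro prob_space_PiM assms)
  interpret QN: pair_sigma_finite ?Q N ..
  interpret prod: product_sigma_finite "\<lambda>_::nat. P" ..
  \<comment> \<open>Independence of \<open>Z\<close> from sample \<open>j\<close> is encoded in
    \<open>Zj\<close> as invariance under overwriting that coordinate. Integrating coordinate
    \<open>j\<close> innermost therefore separates it from \<open>Z\<close>.\<close>
  define I where "I = {..<n} - {j}"
  have I: "finite I" "j \<notin> I" "insert j I = {..<n}"
    unfolding I_def using j by (simp_all add: insert_absorb)
  have comp [measurable]: "(\<lambda>w. fst w j) \<in> ?Q \<Otimes>\<^sub>M N \<rightarrow>\<^sub>M P"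
    using j by (intro measurable_compose[OF measurable_fst] measurable_component_singleton) simp
  have compz [measurable]: "(\<lambda>z. z j) \<in> ?Q \<rightarrow>\<^sub>M P"
    using j by (intro measurable_component_singleton) simp
  have fix_xi: "(\<integral>\<^sup>+z. H (Z (z, \<xi>), z j) \<partial>?Q) = (\<integral>\<^sup>+z. (\<integral>\<^sup>+s. H (Z (z, \<xi>), s) \<partial>P) \<partial>?Q)"
    if [measurable]: "\<xi> \<in> space N" for \<xi>
  proof -
    have [measurable]: "(\<lambda>z. Z (z, \<xi>)) \<in> ?Q \<rightarrow>\<^sub>M M'"
      by (rule measurable_compose[OF _ Z]) (use that in measurable)
    have m1: "(\<lambda>z. H (Z (z, \<xi>), z j)) \<in> borel_measurable ?Q" by measurable
    have m2: "(\<lambda>z. \<integral>\<^sup>+s. H (Z (z, \<xi>), s) \<partial>P) \<in> borel_measurable ?Q" by measurable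
    have "(\<integral>\<^sup>+z. H (Z (z, \<xi>), z j) \<partial>?Q) = (\<integral>\<^sup>+w. (\<integral>\<^sup>+s. H (Z (w, \<xi>), s) \<partial>P) \<partial>PiM I (\<lambda>_. P))"
      using prod.product_nn_integral_insert[OF I(1,2), of "\<lambda>z. H (Z (z, \<xi>), z j)"] m1
      unfolding I(3) by (simp add: Zj)
    also have "\<dots> = (\<integral>\<^sup>+z. (\<integral>\<^sup>+s. H (Z (z, \<xi>), s) \<partial>P) \<partial>?Q)"
      \<comment> \<open>The integrand no longer depends on coordinate \<open>j\<close>; restoring
        that coordinate only multiplies by the total mass 1 of \<open>P\<close>.\<close>
      using prod.product_nn_integral_insert[OF I(1,2), of "\<lambda>z. \<integral>\<^sup>+s. H (Z (z, \<xi>), s) \<partial>P"] m2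
      unfolding I(3) by (simp add: Zj P.emeasure_space_1)
    finally show ?thesis .
  qed
  have "(\<integral>\<^sup>+w. H (Z w, fst w j) \<partial>(?Q \<Otimes>\<^sub>M N)) = (\<integral>\<^sup>+\<xi>. (\<integral>\<^sup>+z. H (Z (z, \<xi>), z j) \<partial>?Q) \<partial>N)"
    by (subst QN.nn_integral_snd[symmetric]) auto
  also have "\<dots> = (\<integral>\<^sup>+\<xi>. (\<integral>\<^sup>+z. (\<integral>\<^sup>+s. H (Z (z, \<xi>), s) \<partial>P) \<partial>?Q) \<partial>N)"
    by (intro nn_integral_cong fix_xi)
  also have "\<dots> = (\<integral>\<^sup>+w. (\<integral>\<^sup>+s. H (Z w, s) \<partial>P) \<partial>(?Q \<Otimes>\<^sub>M N))"
    by (rule QN.nn_integral_snd) measurable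
  finally show ?thesis .
qed

text \<open>Loss differences have no sign. Identifying the joint law as a product carries the
  statement on nonnegative integrals over to Bochner integrals.\<close>

lemma distr_fresh_sample:
  fixes j n :: nat and P :: "'s measure" and N :: "'c measure"
  assumes P: "prob_space P" and N: "prob_space N" and j: "j < n"
    and Z [measurable]: "Z \<in> PiM {..<n} (\<lambda>_. P) \<Otimes>\<^sub>M N \<rightarrow>\<^sub>M M'"
    and Zj: "\<And>z s \<xi>. Z (z(j := s), \<xi>) = Z (z, \<xi>)"
  defines "W \<equiv> PiM {..<n} (\<lambda>_. P) \<Otimes>\<^sub>M N"
  shows "distr W (M' \<Otimes>\<^sub>M P) (\<lambda>w. (Z w, fst w j)) = distr W M' Z \<Otimes>\<^sub>M P"
proof (rule measure_eqI)
  interpret P: prob_space P by fact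
  have [measurable]: "Z \<in> W \<rightarrow>\<^sub>M M'" by (simp add: W_def)
  have comp [measurable]: "(\<lambda>w. fst w j) \<in> W \<rightarrow>\<^sub>M P"
    unfolding W_def using j by (intro measurable_compose[OF measurable_fst] measurable_component_singleton) simp
  show sets: "sets (distr W (M' \<Otimes>\<^sub>M P) (\<lambda>w. (Z w, fst w j))) = sets (distr W M' Z \<Otimes>\<^sub>M P)"
    by (simp cong: sets_pair_measure_cong)
  fix B assume "B \<in> sets (distr W (M' \<Otimes>\<^sub>M P) (\<lambda>w. (Z w, fst w j)))"
  then have B [measurable]: "B \<in> sets (M' \<Otimes>\<^sub>M P)" by simp
  have B': "B \<in> sets (distr W M' Z \<Otimes>\<^sub>M P)" using B by (simp cong: sets_pair_measure_cong)
  have "emeasure (distr W (M' \<Otimes>\<^sub>M P) (\<lambda>w. (Z w, fst w j))) B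
      = (\<integral>\<^sup>+x. indicator B x \<partial>distr W (M' \<Otimes>\<^sub>M P) (\<lambda>w. (Z w, fst w j)))"
    by simp
  also have "\<dots> = (\<integral>\<^sup>+w. indicator B (Z w, fst w j) \<partial>W)"
    by (subst nn_integral_distr) auto
  also have "\<dots> = (\<integral>\<^sup>+w. (\<integral>\<^sup>+s. indicator B (Z w, s) \<partial>P) \<partial>W)"
    unfolding W_def by (rule nn_integral_fresh_sample[OF P N j Z Zj]) simp
  also have "\<dots> = (\<integral>\<^sup>+m. (\<integral>\<^sup>+s. indicator B (m, s) \<partial>P) \<partial>distr W M' Z)"
    by (subst nn_integral_distr) auto
  also have "\<dots> = emeasure (distr W M' Z \<Otimes>\<^sub>M P) B"
    by (rule P.emeasure_pair_measure[OF B', symmetric])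
  finally show "emeasure (distr W (M' \<Otimes>\<^sub>M P) (\<lambda>w. (Z w, fst w j))) B = emeasure (distr W M' Z \<Otimes>\<^sub>M P) B" .
qed

lemma integral_fresh_sample:
  fixes j n :: nat and P :: "'s measure" and N :: "'c measure" and H :: "'m \<times> 's \<Rightarrow> real"
  assumes P: "prob_space P" and N: "prob_space N" and j: "j < n"
    and Z [measurable]: "Z \<in> PiM {..<n} (\<lambda>_. P) \<Otimes>\<^sub>M N \<rightarrow>\<^sub>M M'"
    and Zj: "\<And>z s \<xi>. Z (z(j := s), \<xi>) = Z (z, \<xi>)"
    and H [measurable]: "H \<in> borel_measurable (M' \<Otimes>\<^sub>M P)"
  defines "W \<equiv> PiM {..<n} (\<lambda>_. P) \<Otimes>\<^sub>M N"
  assumes int: "integrable W (\<lambda>w. H (Z w, fst w j))"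
  shows "(\<integral>w. H (Z w, fst w j) \<partial>W) = (\<integral>w. (\<integral>s. H (Z w, s) \<partial>P) \<partial>W)"
proof -
  interpret P: prob_space P by fact
  interpret N: prob_space N by fact
  interpret Q: prob_space "PiM {..<n} (\<lambda>_. P)" by (intro prob_space_PiM P)
  interpret QN: pair_prob_space "PiM {..<n} (\<lambda>_. P)" N ..
  have [measurable]: "Z \<in> W \<rightarrow>\<^sub>M M'" by (simp add: W_def)
  have "prob_space (distr W M' Z)"
    unfolding W_def by (rule QN.prob_space_distr) simp
  then interpret Z: prob_space "distr W M' Z" .
  interpret ZP: pair_sigma_finite "distr W M' Z" P ..
  have comp [measurable]: "(\<lambda>w. fst w j) \<in> W \<rightarrow>\<^sub>M P"
    unfolding W_def using j by (intro measurable_compose[OF measurable_fst] measurable_component_singleton) simp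
  note eq = distr_fresh_sample[OF P N j Z Zj, folded W_def]
  have intH: "integrable (distr W M' Z \<Otimes>\<^sub>M P) H"
    using int unfolding eq[symmetric] by (subst integrable_distr_eq) auto
  have "(\<integral>w. H (Z w, fst w j) \<partial>W) = (\<integral>x. H x \<partial>distr W (M' \<Otimes>\<^sub>M P) (\<lambda>w. (Z w, fst w j)))"
    by (rule integral_distr[symmetric]) measurable
  also have "\<dots> = (\<integral>m. (\<integral>s. H (m, s) \<partial>P) \<partial>distr W M' Z)"
    unfolding eq by (rule ZP.integral_fst'[OF intH, symmetric])
  also have "\<dots> = (\<integral>w. (\<integral>s. H (Z w, s) \<partial>P) \<partial>W)"
    by (rule integral_distr) measurable
  finally show ?thesis .
qed

lemma distr_sample_component:
  fixes j n :: nat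
  assumes P: "prob_space P" and N: "prob_space N" and j: "j < n"
  shows "distr (PiM {..<n} (\<lambda>_. P) \<Otimes>\<^sub>M N) P (\<lambda>w. fst w j) = P"
proof -
  interpret N: prob_space N by fact
  have "distr (PiM {..<n} (\<lambda>_. P) \<Otimes>\<^sub>M N) P (\<lambda>w. fst w j)
     = distr (distr (PiM {..<n} (\<lambda>_. P) \<Otimes>\<^sub>M N) (PiM {..<n} (\<lambda>_. P)) fst) P (\<lambda>z. z j)"
    using j by (subst distr_distr) (auto simp: o_def)
  also have "\<dots> = P"
    unfolding N.distr_pair_fst by (rule distr_PiM_component[where M="\<lambda>_. P"]) (use j P in auto)
  finally show ?thesis .
qed

section \<open>Excess risk of the phased method\<close>

locale phased_run = heavy_tailed k G X P f
  for k G and X :: "'a::euclidean_space set" and P :: "'s measure" and f +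
  fixes n :: nat and A :: "'a phased_params"
  assumes valid: "valid_params X n A" and one_phase: "num_phases A \<ge> 1"
begin

abbreviation "m \<equiv> num_phases A"
abbreviation "W \<equiv> PiM {..<n} (\<lambda>_. P) \<Otimes>\<^sub>M phased_noise A"

definition out :: "nat \<Rightarrow> (nat \<Rightarrow> 's) \<times> (nat \<Rightarrow> 'a) \<Rightarrow> 'a" where
  "out i w = phase_output X A n g (fst w) (snd w) i"

definition iter :: "nat \<Rightarrow> nat \<Rightarrow> (nat \<Rightarrow> 's) \<times> (nat \<Rightarrow> 'a) \<Rightarrow> 'a" where
  "iter i t w = phase_iterate X A n g (fst w) i (out (i - 1) w) t"

definition avg :: "nat \<Rightarrow> (nat \<Rightarrow> 's) \<times> (nat \<Rightarrow> 'a) \<Rightarrow> 'a" where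
  "avg i w = phase_average X A n g (fst w) i (out (i - 1) w)"

lemma init_in: "init_point A \<in> X"
  and pos: "i \<in> {1..m} \<Longrightarrow> step_size A i > 0" "i \<in> {1..m} \<Longrightarrow> clip_level A i > 0" "i \<in> {1..m} \<Longrightarrow> noise_dev A i > 0"
  using valid by (auto simp: valid_params_def)

lemma phase_length_pos: "i \<le> m \<Longrightarrow> n div 2 ^ i > 0"
proof -
  assume "i \<le> m"
  then have "(2::nat) ^ i \<le> 2 ^ m" by (intro power_increasing) auto
  also have "\<dots> \<le> n" using valid by (simp add: valid_params_def)
  finally show ?thesis by (simp add: div_greater_zero_iff)
qed

sublocale Q: prob_space "PiM {..<n} (\<lambda>_. P)"
  by (intro prob_space_PiM P.prob_space_axioms)

sublocale N: prob_space "phased_noise A"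
  by (intro prob_space_phased_noise pos)

sublocale W: pair_prob_space "PiM {..<n} (\<lambda>_. P)" "phased_noise A" ..

lemma sample_meas: "l < n \<Longrightarrow> (\<lambda>w. fst w l) \<in> W \<rightarrow>\<^sub>M P"
  by (intro measurable_compose[OF measurable_fst] measurable_component_singleton) simp

lemma noise_meas: "i \<in> {1..m} \<Longrightarrow> (\<lambda>w. snd w i) \<in> borel_measurable W"
  by (intro measurable_compose[OF measurable_snd])
    (simp add: measurable_component_singleton cong: measurable_cong_sets)

lemma sample_in: "w \<in> space W \<Longrightarrow> l < n \<Longrightarrow> fst w l \<in> space P"
  by (rule measurable_space[OF sample_meas])

lemma out_in: "out i w \<in> X"
  unfolding out_def by (rule phase_output_in[OF closedX init_in])

lemma iter_in: "iter i t w \<in> X"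
  unfolding iter_def by (rule phase_iterate_in[OF closedX out_in])

lemma avg_in: "i \<le> m \<Longrightarrow> avg i w \<in> X"
  unfolding avg_def using phase_length_pos[of i]
  by (intro phase_average_in[OF closedX X(2) out_in]) auto

lemma out_meas: "i \<le> m \<Longrightarrow> out i \<in> borel_measurable W"
  unfolding out_def[abs_def]
  by (intro phase_output_measurable[OF X(2) closedX init_in g_measurable] sample_meas noise_meas) auto

lemma iter_meas: "i \<in> {1..m} \<Longrightarrow> t < n div 2 ^ i \<Longrightarrow> iter i t \<in> borel_measurable W"
  unfolding iter_def[abs_def]
  by (rule phase_average_measurable(1)[OF X(2) closedX g_measurable out_meas out_in sample_meas]) auto

lemma avg_meas: "i \<in> {1..m} \<Longrightarrow> avg i \<in> borel_measurable W"
  unfolding avg_def[abs_def]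
  by (rule phase_average_measurable(2)[OF X(2) closedX g_measurable out_meas out_in sample_meas]) auto

lemma out_fresh:
  assumes "phase_start n (Suc i) \<le> j"
  shows "out i (z(j := s), \<xi>) = out i (z, \<xi>)"
  unfolding out_def fst_conv snd_conv using assms by (intro phase_output_cong) auto

text \<open>Iterate \<open>t\<close> is computed from earlier phases and from the entries of its
  phase at positions below \<open>t\<close>; the entry at which its gradient is taken next is still
  unseen.\<close>

lemma iter_fresh:
  assumes "i \<ge> 1"
  shows "iter i t (z(phase_start n i + t := s), \<xi>) = iter i t (z, \<xi>)"
proof -
  have "out (i - 1) (z(phase_start n i + t := s), \<xi>) = out (i - 1) (z, \<xi>)"
    using assms by (intro out_fresh) auto
  then show ?thesis
    unfolding iter_def phase_iterate_def by (auto intro!: clipped_sgd_cong)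
qed

lemma avg_fresh:
  assumes "i \<ge> 1" "phase_start n (Suc i) \<le> j"
  shows "avg i (z(j := s), \<xi>) = avg i (z, \<xi>)"
proof -
  have "out (i - 1) (z(j := s), \<xi>) = out (i - 1) (z, \<xi>)"
    using assms phase_start_mono[of i "Suc i" n] by (intro out_fresh) auto
  then show ?thesis
    using assms unfolding avg_def by (auto intro!: phase_average_cong)
qed

lemma restrict_meas:
  "u \<in> borel_measurable W \<Longrightarrow> (\<And>w. u w \<in> X) \<Longrightarrow> u \<in> W \<rightarrow>\<^sub>M restrict_space borel X"
  by (intro measurable_restrict_space2) auto

lemma F_diff_integrable:
  assumes "u \<in> borel_measurable W" "\<And>w. u w \<in> X" "v \<in> borel_measurable W" "\<And>w. v w \<in> X"
  shows "integrable W (\<lambda>w. F (u w) - F (v w))"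
proof (rule W.P.integrable_const_bound[where B="G 1 * D"])
  show "AE w in W. norm (F (u w) - F (v w)) \<le> G 1 * D"
    using F_diff_bound assms by auto
  show "(\<lambda>w. F (u w) - F (v w)) \<in> borel_measurable W"
    using measurable_compose[OF restrict_meas[OF assms(1,2)] F_measurable]
      measurable_compose[OF restrict_meas[OF assms(3,4)] F_measurable] by measurable
qed

lemma norm_diff_integrable:
  assumes [measurable]: "u \<in> borel_measurable W" "v \<in> borel_measurable W"
    and "\<And>w. u w \<in> X" "\<And>w. v w \<in> X"
  shows "integrable W (\<lambda>w. norm (u w - v w))" "integrable W (\<lambda>w. (norm (u w - v w))\<^sup>2)"
proof -
  show "integrable W (\<lambda>w. norm (u w - v w))"
    by (rule W.P.integrable_const_bound[where B=D]) (use norm_le_diameter assms(3,4) in auto)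
  show "integrable W (\<lambda>w. (norm (u w - v w))\<^sup>2)"
    by (rule W.P.integrable_const_bound[where B="D\<^sup>2"])
      (use norm_le_diameter assms(3,4) in \<open>auto intro!: power_mono\<close>)
qed

lemma sample_expectation:
  fixes h :: "'s \<Rightarrow> real"
  assumes "l < n" "h \<in> borel_measurable P"
  shows "(\<integral>w. h (fst w l) \<partial>W) = (\<integral>s. h s \<partial>P)"
    and "integrable P h \<Longrightarrow> integrable W (\<lambda>w. h (fst w l))"
proof -
  note d = distr_sample_component[OF P.prob_space_axioms N.prob_space_axioms assms(1)]
  show "(\<integral>w. h (fst w l) \<partial>W) = (\<integral>s. h s \<partial>P)"
    using integral_distr[OF sample_meas[OF assms(1)] assms(2)] unfolding d by simp
  show "integrable W (\<lambda>w. h (fst w l))" if "integrable P h"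
    using integrable_distr_eq[OF sample_meas[OF assms(1)] assms(2)] that unfolding d by simp
qed

text \<open>Iterate and comparator are both determined before entry \<open>l\<close> is read, so in
  expectation the sampled loss may replace the population loss. The difference is dominated by
  \<open>L\<close> times the diameter, which settles integrability although \<open>L\<close> is
  unbounded in general.\<close>

lemma fresh_gap:
  assumes i: "i \<in> {1..m}" and t: "t < n div 2 ^ i"
    and u: "u \<in> borel_measurable W" "\<And>w. u w \<in> X"
    and fresh: "\<And>z s \<xi> j. phase_start n i \<le> j \<Longrightarrow> u (z(j := s), \<xi>) = u (z, \<xi>)"
  defines "l \<equiv> phase_start n i + t"
  shows "integrable W (\<lambda>w. f (iter i t w) (fst w l) - f (u w) (fst w l))"
    and "(\<integral>w. F (iter i t w) - F (u w) \<partial>W) = (\<integral>w. f (iter i t w) (fst w l) - f (u w) (fst w l) \<partial>W)"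
proof -
  have l: "l < n" unfolding l_def using i t by (intro phase_index_less_n) auto
  have s: "(\<lambda>w. fst w l) \<in> W \<rightarrow>\<^sub>M P" by (rule sample_meas[OF l])
  have it: "iter i t \<in> borel_measurable W" by (rule iter_meas[OF i t])
  have meas: "(\<lambda>w. f (iter i t w) (fst w l) - f (u w) (fst w l)) \<in> borel_measurable W"
    by (intro borel_measurable_diff measurable_oracle[OF f_measurable] it u s iter_in)
  show int: "integrable W (\<lambda>w. f (iter i t w) (fst w l) - f (u w) (fst w l))"
  proof (rule Bochner_Integration.integrable_bound[where f="\<lambda>w. L (fst w l) * D"])
    show "integrable W (\<lambda>w. L (fst w l) * D)"
      by (intro integrable_mult_left sample_expectation(2) l L_measurable L_integrable)
    show "AE w in W. norm (f (iter i t w) (fst w l) - f (u w) (fst w l)) \<le> norm (L (fst w l) * D)"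
    proof (rule AE_I2)
      fix w assume "w \<in> space W"
      then have sw: "fst w l \<in> space P" using l by (rule sample_in)
      have "\<bar>f (iter i t w) (fst w l) - f (u w) (fst w l)\<bar> \<le> L (fst w l) * norm (iter i t w - u w)"
        by (rule f_lipschitz[OF iter_in u(2) sw])
      also have "\<dots> \<le> L (fst w l) * D"
        by (intro mult_left_mono norm_le_diameter iter_in u L_nonneg sw)
      finally show "norm (f (iter i t w) (fst w l) - f (u w) (fst w l)) \<le> norm (L (fst w l) * D)"
        by simp
    qed
  qed (rule meas)
  define Z where "Z w = (iter i t w, u w)" for w
  define H where "H = (\<lambda>(p, s). f (fst p) s - f (snd p) s)"
  let ?M = "restrict_space borel X \<Otimes>\<^sub>M restrict_space borel X"
  have Z: "Z \<in> W \<rightarrow>\<^sub>M ?M"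
    unfolding Z_def[abs_def] by (intro measurable_Pair restrict_meas it u iter_in)
  have Zl: "Z (z(l := s), \<xi>) = Z (z, \<xi>)" for z s \<xi>
    using iter_fresh[of i t z s \<xi>] fresh[of l z s \<xi>] i by (simp add: Z_def l_def)
  have H: "H \<in> borel_measurable (?M \<Otimes>\<^sub>M P)"
  proof -
    have sub: "(\<lambda>w. f (q w) (snd w)) \<in> borel_measurable (?M \<Otimes>\<^sub>M P)"
      if "q \<in> ?M \<Otimes>\<^sub>M P \<rightarrow>\<^sub>M restrict_space borel X" for q
      using measurable_compose[OF measurable_Pair[OF that measurable_snd] f_measurable] by simp
    show ?thesis unfolding H_def case_prod_beta
      by (intro borel_measurable_diff sub) measurable
  qed
  have "(\<integral>w. f (iter i t w) (fst w l) - f (u w) (fst w l) \<partial>W) = (\<integral>w. H (Z w, fst w l) \<partial>W)"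
    by (simp add: H_def Z_def)
  also have "\<dots> = (\<integral>w. (\<integral>s. H (Z w, s) \<partial>P) \<partial>W)"
    by (rule integral_fresh_sample[OF P.prob_space_axioms N.prob_space_axioms l Z Zl H])
      (use int in \<open>simp add: H_def Z_def\<close>)
  also have "\<dots> = (\<integral>w. F (iter i t w) - F (u w) \<partial>W)"
    using f_integrable[OF iter_in] f_integrable[OF u(2)] by (simp add: H_def Z_def pop_loss_def)
  finally show "(\<integral>w. F (iter i t w) - F (u w) \<partial>W) = (\<integral>w. f (iter i t w) (fst w l) - f (u w) (fst w l) \<partial>W)"
    by simp
qed

text \<open>Online-to-batch conversion: Jensen bounds the loss of the average by the average loss of
  the iterates, freshness turns it into sampled losses, and the pointwise regret inequality is
  integrated. The comparator may be random as long as it is determined before the phase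
  starts.\<close>

lemma phase_gap:
  assumes i: "i \<in> {1..m}"
    and u: "u \<in> borel_measurable W" "\<And>w. u w \<in> X"
    and fresh: "\<And>z s \<xi> j. phase_start n i \<le> j \<Longrightarrow> u (z(j := s), \<xi>) = u (z, \<xi>)"
  shows "(\<integral>w. F (avg i w) - F (u w) \<partial>W)
    \<le> (\<integral>w. (norm (out (i - 1) w - u w))\<^sup>2 \<partial>W) / (2 * step_size A i * real (n div 2 ^ i))
      + step_size A i / 2 * (\<integral>s. (L s)\<^sup>2 \<partial>P) + D * (\<integral>s. max 0 (L s - clip_level A i) \<partial>P)"
proof -
  let ?N = "n div 2 ^ i"
  define \<eta> where "\<eta> = step_size A i"
  define C where "C = clip_level A i"
  define l where "l t = phase_start n i + t" for t
  define R where "R w = (norm (out (i - 1) w - u w))\<^sup>2" for w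
  define K where "K s = \<eta> * (L s)\<^sup>2 / 2 + D * max 0 (L s - C)" for s
  have N: "real ?N > 0" using phase_length_pos[of i] i by simp
  have \<eta>: "\<eta> > 0" and C: "C > 0" using pos i by (auto simp: \<eta>_def C_def)
  have l: "l t < n" if "t < ?N" for t unfolding l_def using i that by (intro phase_index_less_n) auto
  have L2: "integrable P (\<lambda>s. (L s)\<^sup>2)" using L_moment(1)[of 2] k by simp
  have K: "integrable P K" unfolding K_def[abs_def]
    by (intro Bochner_Integration.integrable_add integrable_mult_right integrable_divide_zero L2 clip_bias_integrable)
  have intK: "(\<integral>s. K s \<partial>P) = \<eta> / 2 * (\<integral>s. (L s)\<^sup>2 \<partial>P) + D * (\<integral>s. max 0 (L s - C) \<partial>P)"
    unfolding K_def[abs_def] using L2 clip_bias_integrable by simp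
  have R: "integrable W R"
    unfolding R_def[abs_def] using i by (intro norm_diff_integrable out_meas u out_in) auto
  note itF = F_diff_integrable[OF iter_meas[OF i] iter_in u]
  have jensen: "real ?N * (F (avg i w) - F (u w)) \<le> (\<Sum>t<?N. F (iter i t w) - F (u w))" for w
  proof -
    have "avg i w = (\<Sum>t<?N. (1 / real ?N) *\<^sub>R iter i t w)"
      by (simp add: avg_def phase_average_def iter_def scaleR_right.sum)
    then have "F (avg i w) \<le> (\<Sum>t<?N. 1 / real ?N * F (iter i t w))"
      using N by (simp only:) (intro convex_on_sum[OF _ _ F_convex], auto intro: iter_in)
    then have "real ?N * F (avg i w) \<le> real ?N * (\<Sum>t<?N. 1 / real ?N * F (iter i t w))"
      using N by (intro mult_left_mono) auto
    also have "\<dots> = (\<Sum>t<?N. F (iter i t w))"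
      using N by (simp flip: sum_divide_distrib)
    finally show ?thesis by (simp add: sum_subtractf right_diff_distrib)
  qed
  have regret: "(\<Sum>t<?N. f (iter i t w) (fst w (l t)) - f (u w) (fst w (l t))) \<le> R w / (2 * \<eta>) + (\<Sum>t<?N. K (fst w (l t)))"
    if w: "w \<in> space W" for w
    unfolding iter_def phase_iterate_def R_def K_def \<eta>_def[symmetric] C_def[symmetric] l_def
    by (rule clipped_sgd_regret[OF X(2) closedX out_in u(2) \<eta> C norm_le_diameter f_diff_le norm_g_le])
      (use l sample_in[OF w] in \<open>auto simp: l_def\<close>)
  have "real ?N * (\<integral>w. F (avg i w) - F (u w) \<partial>W) = (\<integral>w. real ?N * (F (avg i w) - F (u w)) \<partial>W)"
    by simp
  also have "\<dots> \<le> (\<integral>w. (\<Sum>t<?N. F (iter i t w) - F (u w)) \<partial>W)"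
  proof (rule integral_mono[OF _ _ jensen])
    show "integrable W (\<lambda>w. real ?N * (F (avg i w) - F (u w)))"
      using i by (intro integrable_mult_right F_diff_integrable avg_meas avg_in u) auto
    show "integrable W (\<lambda>w. \<Sum>t<?N. F (iter i t w) - F (u w))"
      by (intro Bochner_Integration.integrable_sum itF) auto
  qed
  also have "\<dots> = (\<Sum>t<?N. \<integral>w. F (iter i t w) - F (u w) \<partial>W)"
    by (intro Bochner_Integration.integral_sum itF) auto
  also have "\<dots> = (\<Sum>t<?N. \<integral>w. f (iter i t w) (fst w (l t)) - f (u w) (fst w (l t)) \<partial>W)"
    unfolding l_def by (intro sum.cong refl fresh_gap(2)[OF i _ u fresh]) auto
  also have "\<dots> = (\<integral>w. (\<Sum>t<?N. f (iter i t w) (fst w (l t)) - f (u w) (fst w (l t))) \<partial>W)"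
    unfolding l_def by (intro Bochner_Integration.integral_sum[symmetric] fresh_gap(1)[OF i _ u fresh]) auto
  also have "\<dots> \<le> (\<integral>w. R w / (2 * \<eta>) + (\<Sum>t<?N. K (fst w (l t))) \<partial>W)"
  proof (rule integral_mono[OF _ _ regret])
    show "integrable W (\<lambda>w. \<Sum>t<?N. f (iter i t w) (fst w (l t)) - f (u w) (fst w (l t)))"
      unfolding l_def by (intro Bochner_Integration.integrable_sum fresh_gap(1)[OF i _ u fresh]) auto
    show "integrable W (\<lambda>w. R w / (2 * \<eta>) + (\<Sum>t<?N. K (fst w (l t))))"
      using K by (intro Bochner_Integration.integrable_add integrable_divide_zero R
        Bochner_Integration.integrable_sum sample_expectation(2) l) auto
  qed
  also have "\<dots> = (\<integral>w. R w \<partial>W) / (2 * \<eta>) + (\<Sum>t<?N. \<integral>w. K (fst w (l t)) \<partial>W)"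
    using K R l by (subst Bochner_Integration.integral_add)
      (auto intro!: Bochner_Integration.integrable_sum sample_expectation(2) Bochner_Integration.integral_sum)
  also have "(\<Sum>t<?N. \<integral>w. K (fst w (l t)) \<partial>W) = real ?N * (\<integral>s. K s \<partial>P)"
    using K l by (simp add: sample_expectation(1))
  finally have "(\<integral>w. F (avg i w) - F (u w) \<partial>W) \<le> ((\<integral>w. R w \<partial>W) / (2 * \<eta>) + real ?N * (\<integral>s. K s \<partial>P)) / real ?N"
    using N by (simp only: pos_le_divide_eq mult.commute)
  also have "\<dots> = (\<integral>w. R w \<partial>W) / (2 * \<eta> * real ?N) + (\<integral>s. K s \<partial>P)"
    using N by (simp add: add_divide_distrib)
  finally show ?thesis unfolding intK R_def \<eta>_def C_def by simp
qed

section \<open>Cost of the noise and the telescoped risk\<close>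

lemma noise_second_moment:
  assumes i: "i \<in> {1..m}"
  shows "(\<integral>w. (norm (out i w - avg i w))\<^sup>2 \<partial>W) \<le> DIM('a) * (noise_dev A i)\<^sup>2"
proof -
  \<comment> \<open>The projection is nonexpansive and fixes the average, which already lies in
    \<open>X\<close>, so it cannot enlarge the noise.\<close>
  have le: "norm (out i w - avg i w) \<le> norm (snd w i)" for w
  proof -
    have "out i w = closest_point X (avg i w + snd w i)"
      using i by (cases i) (auto simp: out_def avg_def)
    moreover have "closest_point X (avg i w) = avg i w"
      using i by (intro closest_point_self avg_in) auto
    ultimately show ?thesis
      using closest_point_nonexpansive[OF X(2) closedX X(3), of "avg i w + snd w i" "avg i w"] by simp
  qed
  have meas_i: "(\<lambda>\<xi>. \<xi> i) \<in> borel_measurable (phased_noise A)"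
    using i by (simp add: measurable_component_singleton cong: measurable_cong_sets)
  have "integrable W (\<lambda>w. (norm (out i w - avg i w))\<^sup>2)"
    using i by (intro norm_diff_integrable out_meas avg_meas out_in avg_in) auto
  then have "ennreal (\<integral>w. (norm (out i w - avg i w))\<^sup>2 \<partial>W) = (\<integral>\<^sup>+w. ennreal ((norm (out i w - avg i w))\<^sup>2) \<partial>W)"
    by (intro nn_integral_eq_integral[symmetric]) auto
  also have "\<dots> \<le> (\<integral>\<^sup>+w. ennreal ((norm (snd w i))\<^sup>2) \<partial>W)"
    by (intro nn_integral_mono ennreal_leI power_mono le) auto
  also have "\<dots> = (\<integral>\<^sup>+\<xi>. (\<integral>\<^sup>+z. ennreal ((norm (\<xi> i))\<^sup>2) \<partial>PiM {..<n} (\<lambda>_. P)) \<partial>phased_noise A)"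
    using noise_meas[OF i] by (subst W.nn_integral_snd[symmetric]) auto
  also have "\<dots> = (\<integral>\<^sup>+\<xi>. ennreal ((norm (\<xi> i))\<^sup>2) \<partial>phased_noise A)"
    by (simp add: Q.emeasure_space_1)
  also have "\<dots> = (\<integral>\<^sup>+v. ennreal ((norm v)\<^sup>2) \<partial>distr (phased_noise A) (gaussian (noise_dev A i)) (\<lambda>\<xi>. \<xi> i))"
    using meas_i by (subst nn_integral_distr) (auto cong: measurable_cong_sets)
  also have "distr (phased_noise A) (gaussian (noise_dev A i)) (\<lambda>\<xi>. \<xi> i) = gaussian (noise_dev A i)"
    unfolding phased_noise_def
    by (rule distr_PiM_component[where M="\<lambda>i. gaussian (noise_dev A i)"]) (use i pos prob_space_gaussian in auto)
  also have "(\<integral>\<^sup>+v. ennreal ((norm v)\<^sup>2) \<partial>(gaussian (noise_dev A i) :: 'a measure)) = ennreal (DIM('a) * (noise_dev A i)\<^sup>2)"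
    by (rule nn_integral_gaussian_norm_power2[OF pos(3)[OF i]])
  finally show ?thesis by (simp add: ennreal_le_iff)
qed

lemma last_gap: "(\<integral>w. F (out m w) - F (avg m w) \<partial>W) \<le> G 1 * (sqrt (DIM('a)) * noise_dev A m)"
proof -
  have i: "m \<in> {1..m}" using one_phase by simp
  let ?Y = "\<lambda>w. norm (out m w - avg m w)"
  note Y = norm_diff_integrable[OF out_meas avg_meas out_in avg_in, OF order_refl i order_refl]
  \<comment> \<open>Nonnegativity of the variance passes from the second moment to the
    first.\<close>
  have "(\<integral>w. ?Y w \<partial>W)\<^sup>2 \<le> (\<integral>w. (?Y w)\<^sup>2 \<partial>W)"
    using W.P.variance_positive[of ?Y] W.P.variance_eq[OF Y] by simp
  also have "\<dots> \<le> (sqrt (DIM('a)) * noise_dev A m)\<^sup>2"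
    using noise_second_moment[OF i] by (simp add: power_mult_distrib)
  finally have "(\<integral>w. ?Y w \<partial>W) \<le> sqrt (DIM('a)) * noise_dev A m"
    by (rule power2_le_imp_le) (use pos(3)[OF i] in simp)
  then have "G 1 * (\<integral>w. ?Y w \<partial>W) \<le> G 1 * (sqrt (DIM('a)) * noise_dev A m)"
    by (intro mult_left_mono G1_nonneg)
  moreover have "(\<integral>w. F (out m w) - F (avg m w) \<partial>W) \<le> (\<integral>w. G 1 * ?Y w \<partial>W)"
  proof (rule integral_mono)
    show "integrable W (\<lambda>w. F (out m w) - F (avg m w))"
      by (intro F_diff_integrable out_meas avg_meas out_in avg_in i order_refl)
    show "integrable W (\<lambda>w. G 1 * ?Y w)" using Y by simp
    show "F (out m w) - F (avg m w) \<le> G 1 * ?Y w" for w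
      using F_lipschitz[OF out_in avg_in, of m m w w] by simp
  qed
  ultimately show ?thesis by simp
qed

lemma total_gap:
  assumes xs: "xs \<in> X"
  shows "(\<integral>w. F (out m w) - F xs \<partial>W) \<le> G 1 * (sqrt (DIM('a)) * noise_dev A m)
    + (\<Sum>i=1..m. (if i = 1 then D\<^sup>2 else DIM('a) * (noise_dev A (i - 1))\<^sup>2) / (2 * step_size A i * real (n div 2 ^ i))
      + step_size A i / 2 * (\<integral>s. (L s)\<^sup>2 \<partial>P) + D * (\<integral>s. max 0 (L s - clip_level A i) \<partial>P))"
proof -
  \<comment> \<open>\<open>U (i - 1)\<close> is the comparator of phase \<open>i\<close>. For
    \<open>i = 1\<close> there is no previous average, and the initial distance to \<open>xs\<close>
    is bounded by the diameter.\<close>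
  define U where "U i w = (if i = 0 then xs else avg i w)" for i w
  have U: "U i \<in> borel_measurable W" "U i w \<in> X" if "i \<le> m" for i w
    using that xs avg_meas[of i] avg_in[of i] by (cases "i = 0"; simp add: U_def[abs_def])+
  have tele: "F (out m w) - F xs = (F (out m w) - F (avg m w)) + (\<Sum>i=1..m. F (U i w) - F (U (i - 1) w))" for w
  proof -
    have "(\<Sum>i=1..M. F (U i w) - F (U (i - 1) w)) = F (U M w) - F xs" for M
      by (induction M) (auto simp: U_def)
    then show ?thesis using one_phase by (simp add: U_def)
  qed
  have int: "integrable W (\<lambda>w. F (U i w) - F (U (i - 1) w))" if "i \<in> {1..m}" for i
    using that by (intro F_diff_integrable U) auto
  have split: "(\<integral>w. F (out m w) - F xs \<partial>W)
      = (\<integral>w. F (out m w) - F (avg m w) \<partial>W) + (\<integral>w. (\<Sum>i=1..m. F (U i w) - F (U (i - 1) w)) \<partial>W)"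
    unfolding tele
  proof (rule Bochner_Integration.integral_add)
    show "integrable W (\<lambda>w. F (out m w) - F (avg m w))"
      using one_phase by (intro F_diff_integrable out_meas avg_meas out_in avg_in) auto
    show "integrable W (\<lambda>w. \<Sum>i=1..m. F (U i w) - F (U (i - 1) w))"
      by (intro Bochner_Integration.integrable_sum int)
  qed
  have "(\<integral>w. (\<Sum>i=1..m. F (U i w) - F (U (i - 1) w)) \<partial>W) = (\<Sum>i=1..m. \<integral>w. F (U i w) - F (U (i - 1) w) \<partial>W)"
    by (intro Bochner_Integration.integral_sum int)
  also have "\<dots> \<le> (\<Sum>i=1..m. (if i = 1 then D\<^sup>2 else DIM('a) * (noise_dev A (i - 1))\<^sup>2) / (2 * step_size A i * real (n div 2 ^ i))
      + step_size A i / 2 * (\<integral>s. (L s)\<^sup>2 \<partial>P) + D * (\<integral>s. max 0 (L s - clip_level A i) \<partial>P))"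
  proof (rule sum_mono)
    fix i assume i: "i \<in> {1..m}"
    have im: "i - 1 \<le> m" using i by auto
    note U' = U[OF im]
    have fresh: "U (i - 1) (z(j := s), \<xi>) = U (i - 1) (z, \<xi>)" if "phase_start n i \<le> j" for z s \<xi> j
      using avg_fresh[of "i - 1" j z s \<xi>] that by (cases "i - 1") (auto simp: U_def)
    have eq: "(\<integral>w. F (U i w) - F (U (i - 1) w) \<partial>W) = (\<integral>w. F (avg i w) - F (U (i - 1) w) \<partial>W)"
      using i by (simp add: U_def)
    have gap: "(\<integral>w. F (avg i w) - F (U (i - 1) w) \<partial>W) \<le> (\<integral>w. (norm (out (i - 1) w - U (i - 1) w))\<^sup>2 \<partial>W) / (2 * step_size A i * real (n div 2 ^ i))
      + step_size A i / 2 * (\<integral>s. (L s)\<^sup>2 \<partial>P) + D * (\<integral>s. max 0 (L s - clip_level A i) \<partial>P)"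
      by (rule phase_gap[OF i U' fresh])
    have "(\<integral>w. (norm (out (i - 1) w - U (i - 1) w))\<^sup>2 \<partial>W)
        \<le> (if i = 1 then D\<^sup>2 else DIM('a) * (noise_dev A (i - 1))\<^sup>2)"
    proof (cases "i = 1")
      case True
      have "(\<integral>w. (norm (out (i - 1) w - U (i - 1) w))\<^sup>2 \<partial>W) \<le> (\<integral>w. D\<^sup>2 \<partial>W)"
      proof (rule integral_mono)
        show "integrable W (\<lambda>w. (norm (out (i - 1) w - U (i - 1) w))\<^sup>2)"
          using i by (intro norm_diff_integrable out_meas U' out_in) auto
        show "(norm (out (i - 1) w - U (i - 1) w))\<^sup>2 \<le> D\<^sup>2" for w
          by (intro power_mono norm_le_diameter out_in U') auto
      qed simp
      then show ?thesis using True by (simp add: W.P.prob_space)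
    next
      case False
      then have "i - 1 \<in> {1..m}" using i by auto
      from noise_second_moment[OF this] show ?thesis using False i by (auto simp: U_def)
    qed
    then have "(\<integral>w. (norm (out (i - 1) w - U (i - 1) w))\<^sup>2 \<partial>W) / (2 * step_size A i * real (n div 2 ^ i))
        \<le> (if i = 1 then D\<^sup>2 else DIM('a) * (noise_dev A (i - 1))\<^sup>2) / (2 * step_size A i * real (n div 2 ^ i))"
      using pos(1)[OF i] by (intro divide_right_mono) auto
    then show "(\<integral>w. F (U i w) - F (U (i - 1) w) \<partial>W)
      \<le> (if i = 1 then D\<^sup>2 else DIM('a) * (noise_dev A (i - 1))\<^sup>2) / (2 * step_size A i * real (n div 2 ^ i))
      + step_size A i / 2 * (\<integral>s. (L s)\<^sup>2 \<partial>P) + D * (\<integral>s. max 0 (L s - clip_level A i) \<partial>P)"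
      unfolding eq using gap by linarith
  qed
  finally show ?thesis unfolding split using last_gap by (intro add_mono)
qed

lemma excess_risk_eq:
  assumes xs: "xs \<in> X"
  shows "(\<integral>z. (\<integral>x. F x - F xs \<partial>phased_law X A n g z) \<partial>PiM {..<n} (\<lambda>_. P)) = (\<integral>w. F (out m w) - F xs \<partial>W)"
proof -
  have int: "integrable W (\<lambda>w. F (out m w) - F xs)"
    by (rule F_diff_integrable[where u="out m" and v="\<lambda>_. xs", OF out_meas out_in])
      (simp_all add: xs)
  have "(\<integral>x. F x - F xs \<partial>phased_law X A n g z) = (\<integral>\<xi>. F (out m (z, \<xi>)) - F xs \<partial>phased_noise A)"
    if z: "z \<in> space (PiM {..<n} (\<lambda>_. P))" for z
  proof -
    have "out m \<in> W \<rightarrow>\<^sub>M restrict_space borel X" by (intro restrict_meas out_meas out_in) simp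
    from measurable_compose[OF measurable_Pair1'[OF z] this]
    have "(\<lambda>\<xi>. out m (z, \<xi>)) \<in> phased_noise A \<rightarrow>\<^sub>M restrict_space borel X" .
    then show ?thesis
      using F_measurable unfolding phased_law_def by (subst integral_distr) (auto simp: out_def)
  qed
  then have "(\<integral>z. (\<integral>x. F x - F xs \<partial>phased_law X A n g z) \<partial>PiM {..<n} (\<lambda>_. P))
      = (\<integral>z. (\<integral>\<xi>. F (out m (z, \<xi>)) - F xs \<partial>phased_noise A) \<partial>PiM {..<n} (\<lambda>_. P))"
    by (rule Bochner_Integration.integral_cong[OF refl])
  also have "\<dots> = (\<integral>w. F (out m w) - F xs \<partial>W)"
    by (rule W.integral_fst'[OF int])
  finally show ?thesis .
qed

end

section \<open>Choice of parameters\<close>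

lemma sum_power_le:
  fixes q :: real
  assumes "0 \<le> q" "q < 1"
  shows "(\<Sum>i=1..M. q ^ (i - 1)) \<le> 1 / (1 - q)"
proof -
  have "(\<Sum>i=1..M. q ^ (i - 1)) = (\<Sum>i<M. q ^ i)"
    by (rule sum.reindex_bij_witness[of _ Suc "\<lambda>i. i - 1"]) auto
  also have "\<dots> = (1 - q ^ M) / (1 - q)"
    using assms by (simp add: sum_gp_strict)
  also have "\<dots> \<le> 1 / (1 - q)"
    using assms by (intro divide_right_mono) auto
  finally show ?thesis .
qed

text \<open>Rounding down loses less than 1, which is at most a quarter of a quotient that is at
  least 4. This dictates stopping the phases while \<open>2 ^ (M + 2) \<le> n\<close>.\<close>

lemma phase_length_ge:
  assumes "2 ^ (i + 2) \<le> n"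
  shows "3 / 4 * (real n / 2 ^ i) \<le> real (n div 2 ^ i)"
proof -
  have "real (2 ^ (i + 2)) \<le> real n" using assms by (rule of_nat_mono)
  then have "4 \<le> real n / 2 ^ i" by (simp add: pos_le_divide_eq)
  moreover have "real n / 2 ^ i < real (n div 2 ^ i) + 1"
  proof -
    have "n < n div 2 ^ i * 2 ^ i + 2 ^ i"
    proof -
      have "n mod 2 ^ i < 2 ^ i" by simp
      then show ?thesis using div_mult_mod_eq[of n "2 ^ i"] by linarith
    qed
    then have "real n < real (n div 2 ^ i * 2 ^ i + 2 ^ i)" by (rule of_nat_less_iff[THEN iffD2])
    then show ?thesis by (simp add: pos_divide_less_eq distrib_right)
  qed
  ultimately show ?thesis by linarith
qed

text \<open>
  Step sizes shrink by \<open>9\<close> and clipping levels grow by \<open>3 / 2\<close>, so that the noise of one phase, at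
  squared scale \<open>1 / 36\<close>, costs the next phase a term of ratio \<open>9 * 2 / 36 = 1 / 2\<close>, and the clipping bias
  has ratio at most \<open>2 / 3\<close>.  The number \<open>M\<close> of phases makes \<open>(1 / 6) ^ (M - 1)\<close> of order \<open>1 / sqrt n\<close>.
\<close>

lemma phased_bound:
  fixes D G1 G2 Gk c r R \<rho> d n V \<eta>1 :: real and N B :: "nat \<Rightarrow> real" and M :: nat
  assumes pos: "D > 0" "G2 > 0" "Gk > 0" "c > 0" "r > 0" "R > 0" "\<rho> > 0" "n > 0" "\<eta>1 > 0"
    and G1: "0 \<le> G1" "G1 \<le> G2" and M: "M \<ge> 1" "n \<le> 16 * 36 ^ (M - 1)"
    and rc: "r * c = Gk * R" and d: "d = r\<^sup>2 * n\<^sup>2 * \<rho>"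
    and \<eta>1: "\<eta>1 = min (D / (G2 * sqrt n)) (D / (8 * n * R * Gk))"
    and N: "\<And>i. i \<in> {1..M} \<Longrightarrow> 3 / 4 * (n / 2 ^ i) \<le> N i"
    and V: "V \<le> G2\<^sup>2" and B: "\<And>i. i \<in> {1..M} \<Longrightarrow> B i \<le> Gk * R * (2 / 3) ^ (i - 1)"
  defines "\<eta> \<equiv> \<lambda>i. \<eta>1 * (1 / 9) ^ (i - 1)" and "C \<equiv> \<lambda>i. c * (3 / 2) ^ (i - 1)"
  defines "\<tau> \<equiv> \<lambda>i. \<eta> i * C i * sqrt (2 / \<rho>)"
  shows "G1 * (sqrt d * \<tau> M)
     + (\<Sum>i=1..M. (if i = 1 then D\<^sup>2 else d * (\<tau> (i - 1))\<^sup>2) / (2 * \<eta> i * N i) + \<eta> i / 2 * V + D * B i)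
     \<le> 4 * G2 * D * sqrt (1 / n) + 26 * Gk * D * R"
proof -
  define S where "S = G2 * D * sqrt (1 / n)"
  define T where "T = Gk * D * R"
  have sn: "sqrt n > 0" "sqrt n * sqrt n = n" using pos by auto
  have S0: "S > 0" and T0: "T > 0" using pos by (auto simp: S_def T_def)
  \<comment> \<open>The two branches of the minimum. The first balances initial distance against
    gradient variance; the second keeps the noise of the first phase at the scale of
    \<open>D\<close>.\<close>
  have \<eta>S: "\<eta>1 \<le> D / (G2 * sqrt n)" and \<eta>T: "n * \<eta>1 * (Gk * R) \<le> D / 8"
  proof -
    show "\<eta>1 \<le> D / (G2 * sqrt n)" using \<eta>1 by simp
    have "\<eta>1 \<le> D / (8 * n * R * Gk)" using \<eta>1 by simp
    then show "n * \<eta>1 * (Gk * R) \<le> D / 8" using pos by (simp add: field_simps)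
  qed
  have \<eta>pos: "\<eta> i > 0" for i using pos by (simp add: \<eta>_def)
  have Npos: "N i > 0" if "i \<in> {1..M}" for i
    using N[OF that] pos by (smt (verit) divide_pos_pos mult_pos_pos zero_less_power)
  have first: "D\<^sup>2 / (2 * \<eta> 1 * N 1) \<le> 4 / 3 * S + 32 / 3 * T"
  proof -
    have "D\<^sup>2 / (2 * \<eta> 1 * N 1) \<le> D\<^sup>2 / (2 * \<eta>1 * (3 / 4 * (n / 2)))"
      using N[of 1] M pos Npos[of 1] by (intro divide_left_mono mult_left_mono mult_pos_pos) (auto simp: \<eta>_def)
    also have "\<dots> = 4 / 3 * (D\<^sup>2 / n) * (1 / \<eta>1)" by (simp add: mult_ac)
    \<comment> \<open>The reciprocal of a minimum is at most the sum of the reciprocals. The factor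
      4/3 reflects at least 3n/8 steps in the first phase, and 32/3 is 8 times 4/3.\<close>
    also have "1 / \<eta>1 \<le> G2 * sqrt n / D + 8 * n * R * Gk / D"
      using \<eta>1 pos by (auto simp: min_def)
    then have "4 / 3 * (D\<^sup>2 / n) * (1 / \<eta>1) \<le> 4 / 3 * (D\<^sup>2 / n) * (G2 * sqrt n / D + 8 * n * R * Gk / D)"
      using pos by (intro mult_left_mono) auto
    also have "\<dots> = 4 / 3 * S + 32 / 3 * T"
    proof -
      have "sqrt n / n = sqrt (1 / n)"
        using pos by (simp add: real_sqrt_divide real_div_sqrt field_simps)
      moreover have "4 / 3 * (D\<^sup>2 / n) * (G2 * sqrt n / D) = 4 / 3 * (G2 * D * (sqrt n / n))"
        using pos by (simp add: power2_eq_square)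
      ultimately have "4 / 3 * (D\<^sup>2 / n) * (G2 * sqrt n / D) = 4 / 3 * S"
        by (simp only: S_def)
      moreover have "4 / 3 * (D\<^sup>2 / n) * (8 * n * R * Gk / D) = 32 / 3 * T"
        using pos by (simp add: T_def power2_eq_square)
      ultimately show ?thesis by (simp only: distrib_left)
    qed
    finally show ?thesis .
  qed
  \<comment> \<open>The squared noise is quadratic in the step size: one factor is bounded by D / 8
    through the second branch of the minimum, the other cancels against the step size in the
    denominator. The exponent is i - 2 because phase i inherits the noise of phase i - 1, whose own
    exponents are i - 2.\<close>
  have later: "d * (\<tau> (i - 1))\<^sup>2 / (2 * \<eta> i * N i) \<le> 6 * T * (1 / 2) ^ (i - 2)" if i: "i \<in> {1..M}" "i \<noteq> 1" for i
  proof -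
    obtain j where j: "i = Suc (Suc j)" using i by (cases i; cases "i - 1") auto
    have "d * (\<tau> (i - 1))\<^sup>2 = 2 * (n * \<eta>1 * (r * c))\<^sup>2 * (((1 / 9) ^ j)\<^sup>2 * ((3 / 2) ^ j)\<^sup>2)"
      using pos by (simp add: j d \<tau>_def \<eta>_def C_def power_mult_distrib)
    also have "((1 / 9) ^ j)\<^sup>2 * ((3 / 2) ^ j)\<^sup>2 = (1 / 36 :: real) ^ j"
      by (simp add: power_mult_distrib[symmetric] power_even_eq[symmetric] power2_eq_square flip: power_mult_distrib)
    finally have "d * (\<tau> (i - 1))\<^sup>2 = 2 * (n * \<eta>1 * (Gk * R)) * (n * \<eta>1 * (Gk * R)) * (1 / 36) ^ j"
      by (simp only: rc) (simp add: power2_eq_square)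
    also have "\<dots> \<le> 2 * (n * \<eta>1 * (Gk * R)) * (D / 8) * (1 / 36) ^ j"
      using pos by (intro mult_right_mono mult_left_mono \<eta>T) auto
    also have "\<dots> = (6 * T * (1 / 2) ^ j) * (2 * (\<eta>1 * (1 / 9) ^ Suc j) * (3 / 4 * (n / 2 ^ i)))"
    proof -
      have "(1 / 36 :: real) ^ j = (1 / 2) ^ j * ((1 / 9) ^ j * (1 / 2) ^ j)"
        by (simp flip: power_mult_distrib)
      then show ?thesis by (simp add: j T_def power_one_over)
    qed
    also have "\<dots> \<le> (6 * T * (1 / 2) ^ j) * (2 * \<eta> i * N i)"
    proof (rule mult_left_mono)
      have "2 * \<eta> i * (3 / 4 * (n / 2 ^ i)) \<le> 2 * \<eta> i * N i"
        using N[OF i(1)] \<eta>pos[of i] by (intro mult_left_mono) auto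
      then show "2 * (\<eta>1 * (1 / 9) ^ Suc j) * (3 / 4 * (n / 2 ^ i)) \<le> 2 * \<eta> i * N i"
        by (simp add: \<eta>_def j)
    qed (use T0 in simp)
    finally show ?thesis
      using \<eta>pos[of i] Npos[OF i(1)] by (simp add: j divide_le_eq)
  qed
  have sum1: "(\<Sum>i=1..M. (if i = 1 then D\<^sup>2 else d * (\<tau> (i - 1))\<^sup>2) / (2 * \<eta> i * N i)) \<le> 4 / 3 * S + 32 / 3 * T + 12 * T"
  proof -
    have "(\<Sum>i=1..M. (if i = 1 then D\<^sup>2 else d * (\<tau> (i - 1))\<^sup>2) / (2 * \<eta> i * N i))
        \<le> (\<Sum>i=1..M. if i = 1 then 4 / 3 * S + 32 / 3 * T else 6 * T * (1 / 2) ^ (i - 2))"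
      using first later by (intro sum_mono) auto
    \<comment> \<open>Keeping the subtracted tail gives an equality, which goes through by induction
      on \<open>M\<close>.\<close>
    also have "\<dots> = 4 / 3 * S + 32 / 3 * T + 12 * T - 12 * T * (1 / 2) ^ (M - 1)"
      using M(1)
    proof (induction M rule: dec_induct)
      case (step m)
      obtain m' where m': "m = Suc m'" using step by (cases m) auto
      show ?case using step.IH by (simp add: m')
    qed simp
    finally show ?thesis using T0 by (smt (verit) mult_pos_pos zero_less_power half_gt_zero_iff)
  qed
  have sum2: "(\<Sum>i=1..M. \<eta> i / 2 * V) \<le> 9 / 16 * S"
  proof -
    have "(\<Sum>i=1..M. \<eta> i / 2 * V) \<le> (\<Sum>i=1..M. \<eta> i / 2 * G2\<^sup>2)"
      using \<eta>pos V by (intro sum_mono mult_left_mono) (auto simp: less_imp_le)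
    also have "\<dots> = \<eta>1 * G2\<^sup>2 / 2 * (\<Sum>i=1..M. (1 / 9) ^ (i - 1))"
      by (simp add: \<eta>_def sum_distrib_left mult_ac)
    also have "\<dots> \<le> \<eta>1 * G2\<^sup>2 / 2 * (1 / (1 - 1 / 9))"
      using pos by (intro mult_left_mono sum_power_le) auto
    also have "\<dots> \<le> D / (G2 * sqrt n) * G2\<^sup>2 / 2 * (1 / (1 - 1 / 9))"
      using pos by (intro mult_right_mono divide_right_mono \<eta>S) auto
    also have "\<dots> = 9 / 16 * S"
      using pos by (simp add: S_def power2_eq_square real_sqrt_divide)
    finally show ?thesis .
  qed
  have sum3: "(\<Sum>i=1..M. D * B i) \<le> 3 * T"
  proof -
    have "(\<Sum>i=1..M. D * B i) \<le> (\<Sum>i=1..M. D * (Gk * R * (2 / 3) ^ (i - 1)))"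
      using B pos by (intro sum_mono mult_left_mono) auto
    also have "\<dots> = T * (\<Sum>i=1..M. (2 / 3) ^ (i - 1))"
      by (simp add: T_def sum_distrib_left mult_ac)
    also have "\<dots> \<le> T * (1 / (1 - 2 / 3))"
      using T0 by (intro mult_left_mono sum_power_le) auto
    finally show ?thesis by simp
  qed
  have last: "G1 * (sqrt d * \<tau> M) \<le> 2 * S"
  proof -
    have sd: "sqrt d = r * n * sqrt \<rho>" using pos by (simp add: d real_sqrt_mult)
    have "sqrt \<rho> * sqrt (2 / \<rho>) = sqrt 2" using pos by (simp flip: real_sqrt_mult)
    moreover have "sqrt d * \<tau> M = (sqrt \<rho> * sqrt (2 / \<rho>)) * (n * \<eta>1 * (r * c)) * ((1 / 9) ^ (M - 1) * (3 / 2) ^ (M - 1))"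
      unfolding sd \<tau>_def \<eta>_def C_def by (simp only: mult_ac)
    ultimately have "sqrt d * \<tau> M = sqrt 2 * (n * \<eta>1 * (r * c)) * ((1 / 9) ^ (M - 1) * (3 / 2) ^ (M - 1))"
      by (simp only:)
    \<comment> \<open>The noise shrinks by 6 per phase: the step size by 9, against growth of the
      clipping level by 3/2.\<close>
    also have "(1 / 9) ^ (M - 1) * (3 / 2) ^ (M - 1) = (1 / 6 :: real) ^ (M - 1)"
      by (simp flip: power_mult_distrib)
    also have "sqrt 2 * (n * \<eta>1 * (r * c)) * (1 / 6) ^ (M - 1) \<le> 2 * (D / 8) * (1 / 6) ^ (M - 1)"
      unfolding rc using pos sqrt2_less_2 by (intro mult_right_mono mult_mono \<eta>T) auto
    also have "\<dots> \<le> D * sqrt (1 / n)"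
    proof -
      \<comment> \<open>Here the number of phases matters: the shrinkage of the noise by the last
        phase is at most 4 / sqrt n.\<close>
      have "sqrt n \<le> sqrt (16 * 36 ^ (M - 1))" using M(2) by simp
      also have "\<dots> = 4 * 6 ^ (M - 1)"
      proof (rule real_sqrt_unique)
        have "(36::real) ^ (M - 1) = 6 ^ (M - 1) * 6 ^ (M - 1)" by (simp flip: power_mult_distrib)
        then show "(4 * 6 ^ (M - 1))\<^sup>2 = 16 * (36::real) ^ (M - 1)" by (simp add: power2_eq_square)
      qed simp
      finally have "sqrt n * (1 / 6) ^ (M - 1) \<le> 4" by (simp add: power_one_over field_simps)
      then have "(1 / 6) ^ (M - 1) \<le> 4 / sqrt n" using sn by (simp add: field_simps)
      then have "2 * (D / 8) * (1 / 6) ^ (M - 1) \<le> 2 * (D / 8) * (4 / sqrt n)"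
        using pos by (intro mult_left_mono) auto
      then show ?thesis by (simp add: real_sqrt_divide)
    qed
    finally have "sqrt d * \<tau> M \<le> D * sqrt (1 / n)" .
    then have "G1 * (sqrt d * \<tau> M) \<le> G2 * (D * sqrt (1 / n))"
      by (rule mult_mono[OF G1(2)]) (use G1 pos in \<open>auto simp: d \<tau>_def \<eta>_def C_def\<close>)
    then show ?thesis using S0 by (simp add: S_def)
  qed
  \<comment> \<open>The coefficients add up to 4/3 + 9/16 + 2 = 187/48 < 4 for \<open>S\<close> and
    to 32/3 + 12 + 3 = 77/3 < 26 for \<open>T\<close>.\<close>
  have "4 * S = 4 * G2 * D * sqrt (1 / n)" "26 * T = 26 * Gk * D * R"
    by (simp_all add: S_def T_def)
  then show ?thesis
    unfolding sum.distrib using sum1 sum2 sum3 last S0 T0 by linarith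
qed

text \<open>Without phases the output is the initial point, whatever the data: perfectly private,
  with excess risk bounded by the Lipschitz constant times the diameter. This handles the degenerate
  parameter ranges.\<close>

lemma (in heavy_tailed) no_phases:
  fixes A :: "'a phased_params"
  assumes valid: "valid_params X n A" and A: "num_phases A = 0" "\<And>i. noise_dev A i > 0"
    and \<rho>: "\<rho> \<ge> 0" and xs: "xs \<in> X"
  shows "CDP \<rho> n (space P) (phased_law X A n g)"
    and "(\<integral>z. (\<integral>x. F x - F xs \<partial>phased_law X A n g z) \<partial>PiM {..<n} (\<lambda>_. P)) \<le> G 1 * D"
proof -
  show "CDP \<rho> n (space P) (phased_law X A n g)"
    by (rule phased_law_CDP[OF X(2) closedX valid A(2) g_measurable \<rho>]) (simp_all add: A)
  interpret N: prob_space "phased_noise A" by (intro prob_space_phased_noise A)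
  interpret Q: prob_space "PiM {..<n} (\<lambda>_. P)" by (intro prob_space_PiM P.prob_space_axioms)
  have x0: "init_point A \<in> X" using valid by (simp add: valid_params_def)
  have "(\<integral>x. F x - F xs \<partial>phased_law X A n g z) = F (init_point A) - F xs" for z
    unfolding phased_law_def A phase_output.simps using x0 F_measurable
    by (subst integral_distr) (auto simp: N.prob_space intro!: measurable_const simp: space_restrict_space)
  then show "(\<integral>z. (\<integral>x. F x - F xs \<partial>phased_law X A n g z) \<partial>PiM {..<n} (\<lambda>_. P)) \<le> G 1 * D"
    using F_diff_bound[OF x0 xs] by (simp add: Q.prob_space)
qed

lemma glm_step_nonexpansive:
  fixes f :: "'a::euclidean_space \<Rightarrow> 'a \<Rightarrow> real"
  assumes "heavy_tailed k G X P f" "\<forall>s\<in>space P. \<forall>x\<in>X. f x s = \<sigma> (s \<bullet> x)"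
    and "\<forall>s\<in>space P. smooth_on X \<beta> (\<lambda>x. f x s)"
    and "x \<in> X" "y \<in> X" "s \<in> space P" "C > 0" "\<eta> > 0" "\<eta> * \<beta> \<le> 2"
  shows "norm ((x - \<eta> *\<^sub>R clip C (sample_grad X f x s)) - (y - \<eta> *\<^sub>R clip C (sample_grad X f y s))) \<le> norm (x - y)"
proof -
  interpret heavy_tailed k G X P f by fact
  show ?thesis
    unfolding sample_grad_def
    by (rule glm_clipped_step_nonexpansive[OF f_convex f_C1, where \<sigma>=\<sigma> and \<beta>=\<beta> and s=s]) (use assms in auto)
qed

text \<open>The quantifier over \<open>A\<close> precedes those over \<open>P\<close>,
  \<open>f\<close> and \<beta>, so one choice of parameters serves all admissible distributions and
  losses. The risk bound is guarded by \<rho> > 0: for \<rho> = 0 division by zero would turn its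
  second term, informally infinite, into 0.\<close>

theorem theorem4:
  fixes X :: "'a::euclidean_space set" and D \<rho> :: real and k n :: nat and G :: "nat \<Rightarrow> real"
  assumes "compact X" and "convex X" and "X \<noteq> {}" and "diameter X = D"
    and "k \<ge> 2" and "mono_on {1..k} G" and "n \<ge> 1" and "\<rho> \<ge> 0"
  shows "\<exists>A :: 'a phased_params. valid_params X n A \<and>
    (\<forall>(P :: 'a measure) (f :: 'a \<Rightarrow> 'a \<Rightarrow> real) (\<sigma> :: real \<Rightarrow> real) (\<beta> :: real) (xstar :: 'a).
       heavy_tailed_sco k G X P f \<and>
       convex_on UNIV \<sigma> \<and>
       (\<forall>s\<in>space P. \<forall>x\<in>X. f x s = \<sigma> (s \<bullet> x)) \<and>
       (\<forall>s\<in>space P. smooth_on X \<beta> (\<lambda>x. f x s)) \<and>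
       (\<rho> > 0 \<longrightarrow> \<beta> \<le> max (sqrt (real n / 2) * (G 2 / D))
                        (real n * (real DIM('a) / (real n ^ 2 * \<rho>)) powr ((real k - 1) / (2 * real k))
                          * (G k / D))) \<and>
       is_arg_min (pop_loss P f) (\<lambda>x. x \<in> X) xstar
       \<longrightarrow>
       CDP \<rho> n (space P) (phased_law X A n (sample_grad X f)) \<and>
       phased_law X A n (sample_grad X f)
         \<in> PiM {..<n} (\<lambda>_. P) \<rightarrow>\<^sub>M prob_algebra (restrict_space borel X) \<and>
       (\<forall>z \<in> {..<n} \<rightarrow>\<^sub>E space P. \<forall>\<xi> \<in> space (phased_noise A).
          phased_queries X A n (sample_grad X f) z \<xi> \<subseteq> X \<times> z ` {..<n} \<and>
          card (phased_queries X A n (sample_grad X f) z \<xi>) \<le> n) \<and>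
       (\<rho> > 0 \<longrightarrow>
          (\<integral>z. (\<integral>x. pop_loss P f x - pop_loss P f xstar \<partial>phased_law X A n (sample_grad X f) z)
             \<partial>PiM {..<n} (\<lambda>_. P))
          \<le> 4 * G 2 * D * sqrt (1 / real n)
             + 26 * G k * D * (sqrt (real DIM('a)) / (real n * sqrt \<rho>)) powr (1 - 1 / real k)))"
\<comment> \<open>Outside this range no phases are run. If \<rho> > 0, the trivial bound
  \<open>G 1 * D\<close> is 0 when \<open>D = 0\<close> or \<open>G 2 \<le> 0\<close>, and for n
  \<le> 16 it is covered by the first term, since \<open>4 * sqrt (1 / real n)\<close> is at least
  1.\<close>
proof (cases "\<rho> > 0 \<and> D > 0 \<and> G 2 > 0 \<and> n > 16")
  case False
  obtain x0 where x0: "x0 \<in> X" using assms(3) by auto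
  define A where "A = \<lparr>num_phases = 0, init_point = x0, step_size = (\<lambda>_. 1), clip_level = (\<lambda>_. 1), noise_dev = (\<lambda>_. 1)\<rparr>"
  have valid: "valid_params X n A" using x0 assms(7) by (simp add: valid_params_def A_def)
  show ?thesis
  proof (intro exI[of _ A] conjI valid allI impI; elim conjE)
    fix P :: "'a measure" and f :: "'a \<Rightarrow> 'a \<Rightarrow> real" and xs
    assume sco: "heavy_tailed_sco k G X P f" and "is_arg_min (pop_loss P f) (\<lambda>x. x \<in> X) xs"
    then have xs: "xs \<in> X" by (simp add: is_arg_min_def)
    interpret heavy_tailed k G X P f using assms sco by unfold_locales
    note res = no_phases[OF valid _ _ assms(8) xs]
    show "CDP \<rho> n (space P) (phased_law X A n g)"
      by (rule res(1)) (simp_all add: A_def)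
    show "phased_law X A n g \<in> PiM {..<n} (\<lambda>_. P) \<rightarrow>\<^sub>M prob_algebra (restrict_space borel X)"
      by (rule phased_law_measurable[OF X(2) closedX valid g_measurable])
    show "\<forall>z \<in> {..<n} \<rightarrow>\<^sub>E space P. \<forall>\<xi> \<in> space (phased_noise A).
        phased_queries X A n g z \<xi> \<subseteq> X \<times> z ` {..<n} \<and> card (phased_queries X A n g z \<xi>) \<le> n"
      using x0 by (intro ballI conjI phased_queries_bound[OF closedX]) (simp_all add: A_def)
    assume \<rho>: "\<rho> > 0"
    have D: "D \<ge> 0" using diameter_nonneg assms(4) by simp
    have G: "0 \<le> G 1" "G 1 \<le> G 2" "G 1 \<le> G k"
      using G1_nonneg k by (auto intro!: mono_onD[OF assms(6)])
    have "G 1 * D \<le> 4 * G 2 * D * sqrt (1 / real n)"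
    proof (cases "D = 0 \<or> G 2 \<le> 0")
      case True
      then have "D = 0 \<or> G 1 = 0 \<and> G 2 = 0" using G by linarith
      then show ?thesis by auto
    next
      case D0: False
      then have "n \<le> 16" using False \<rho> D by auto
      then have "sqrt (real n) \<le> 4" by (intro real_le_lsqrt) auto
      then have "1 \<le> 4 * sqrt (1 / real n)"
        using assms(7) by (simp add: real_sqrt_divide le_divide_eq)
      then have "G 2 * D * 1 \<le> G 2 * D * (4 * sqrt (1 / real n))"
        using G D by (intro mult_left_mono) auto
      moreover have "G 1 * D \<le> G 2 * D" using G D by (intro mult_right_mono)
      ultimately show ?thesis by simp
    qed
    moreover have "0 \<le> 26 * G k * D * (sqrt (real DIM('a)) / (real n * sqrt \<rho>)) powr (1 - 1 / real k)"
      using G D by (intro mult_nonneg_nonneg) auto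
    moreover have "(\<integral>z. (\<integral>x. F x - F xs \<partial>phased_law X A n g z) \<partial>PiM {..<n} (\<lambda>_. P)) \<le> G 1 * D"
      unfolding assms(4)[symmetric] by (rule res(2)) (simp_all add: A_def)
    ultimately show "(\<integral>z. (\<integral>x. F x - F xs \<partial>phased_law X A n g z) \<partial>PiM {..<n} (\<lambda>_. P))
        \<le> 4 * G 2 * D * sqrt (1 / real n)
           + 26 * G k * D * (sqrt (real DIM('a)) / (real n * sqrt \<rho>)) powr (1 - 1 / real k)"
      by linarith
  qed
next
  case True
  then have \<rho>: "\<rho> > 0" and D: "D > 0" and G2: "G 2 > 0" and n: "n > 16" by auto
  obtain x0 where x0: "x0 \<in> X" using assms(3) by auto
  have Gk: "G 2 \<le> G k" "G 1 \<le> G 2" using assms(5) by (auto intro!: mono_onD[OF assms(6)])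
  then have Gk0: "G k > 0" using G2 by simp
  obtain e where e: "2 ^ e \<le> n" "n < 2 ^ (e + 1)"
    using ex_power_ivl1[of 2 n] assms(7) by auto
  have "e \<ge> 4"
  proof (rule ccontr)
    assume "\<not> e \<ge> 4"
    then have "(2::nat) ^ (e + 1) \<le> 2 ^ 4" by (intro power_increasing) auto
    with e n show False by simp
  qed
  \<comment> \<open>Two binary digits of \<open>n\<close> are held back: every phase then has at
    least four entries, and n < 2^(M + 3) = 16 * 2^(M - 1) yields the upper bound on
    \<open>n\<close> required for the last noise.\<close>
  define M where "M = e - 2"
  have M: "M \<ge> 1" "2 ^ (M + 2) \<le> n" "n < 2 ^ (M + 3)"
  proof -
    have "e = M + 2" using \<open>e \<ge> 4\<close> by (simp add: M_def)
    then show "M \<ge> 1" "2 ^ (M + 2) \<le> n" "n < 2 ^ (M + 3)"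
      using e \<open>e \<ge> 4\<close> by (simp_all add: eval_nat_numeral)
  qed
  define d where "d = real DIM('a)"
  define r where "r = sqrt d / (real n * sqrt \<rho>)"
  define R where "R = r powr (1 - 1 / real k)"
  \<comment> \<open>The clipping level that equalizes the two costs of clipping: the noise scale
    \<open>r * c\<close>, growing in \<open>c\<close>, and the bias
    \<open>G k ^ k / c ^ (k - 1)\<close>, falling in \<open>c\<close>, both equal
    \<open>G k * R\<close>.\<close>
  define c where "c = G k * r powr (- 1 / real k)"
  define \<eta>1 where "\<eta>1 = min (D / (G 2 * sqrt (real n))) (D / (8 * real n * R * G k))"
  have n0: "real n > 0" and k0: "real k > 0" using n assms(5) by auto
  have d0: "d > 0" by (simp add: d_def)
  have r0: "r > 0" using d0 n0 \<rho> by (simp add: r_def)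
  have R0: "R > 0" and c0: "c > 0" using r0 Gk0 by (auto simp: R_def c_def)
  have \<eta>0: "\<eta>1 > 0" using D G2 n0 R0 Gk0 by (simp add: \<eta>1_def)
  have rc: "r * c = G k * R"
    using r0 by (simp add: c_def R_def powr_diff powr_minus_divide)
  have d: "d = r\<^sup>2 * (real n)\<^sup>2 * \<rho>"
    using d0 n0 \<rho> by (simp add: r_def power_divide power_mult_distrib)
  have bias: "G k ^ k / c ^ (k - 1) = G k * R"
  proof -
    have "(r powr (- 1 / real k)) ^ (k - 1) = r powr (- (1 - 1 / real k))"
      using r0 k0 assms(5) by (subst powr_power) (auto simp: field_simps of_nat_diff)
    then have "c ^ (k - 1) = G k ^ (k - 1) * (1 / R)"
      by (simp only: c_def power_mult_distrib R_def powr_minus_divide)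
    moreover have "G k ^ k = G k * G k ^ (k - 1)" using assms(5) by (cases k) auto
    ultimately show ?thesis using Gk0 R0 by simp
  qed
  \<comment> \<open>Identifies the power in the bound on \<beta> with \<open>R\<close>, so that the
    bound can be matched with the second branch of \<eta>1.\<close>
  have R_eq: "(d / ((real n)\<^sup>2 * \<rho>)) powr ((real k - 1) / (2 * real k)) = R"
  proof -
    have "d / ((real n)\<^sup>2 * \<rho>) = r powr 2"
      using d n0 \<rho> r0 by simp
    moreover have "2 * ((real k - 1) / (2 * real k)) = 1 - 1 / real k"
      using k0 by (simp add: field_simps)
    ultimately show ?thesis by (simp add: powr_powr R_def)
  qed
  \<comment> \<open>The factor sqrt (2 / \<rho>) solves the calibration (2 \<eta> C)^2 = 2 \<rho>
    \<tau>^2 for the noise deviation \<tau>.\<close>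
  define A where "A = \<lparr>num_phases = M, init_point = x0, step_size = (\<lambda>i. \<eta>1 * (1 / 9) ^ (i - 1)),
    clip_level = (\<lambda>i. c * (3 / 2) ^ (i - 1)),
    noise_dev = (\<lambda>i. \<eta>1 * (1 / 9) ^ (i - 1) * (c * (3 / 2) ^ (i - 1)) * sqrt (2 / \<rho>))\<rparr>"
  have A_sel: "num_phases A = M" "init_point A = x0" "step_size A = (\<lambda>i. \<eta>1 * (1 / 9) ^ (i - 1))"
    "clip_level A = (\<lambda>i. c * (3 / 2) ^ (i - 1))"
    "noise_dev A = (\<lambda>i. \<eta>1 * (1 / 9) ^ (i - 1) * (c * (3 / 2) ^ (i - 1)) * sqrt (2 / \<rho>))"
    by (simp_all add: A_def)
  have A_pos: "step_size A i > 0" "clip_level A i > 0" "noise_dev A i > 0" for i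
    using \<eta>0 c0 \<rho> by (auto simp: A_sel)
  have "(2::nat) ^ M \<le> 2 ^ (M + 2)" by (intro power_increasing) auto
  then have valid: "valid_params X n A"
    using x0 M(2) A_pos by (simp add: valid_params_def A_sel(1,2))
  show ?thesis
  proof (intro exI[of _ A] conjI valid allI impI; elim conjE)
    fix P :: "'a measure" and f :: "'a \<Rightarrow> 'a \<Rightarrow> real" and \<sigma> :: "real \<Rightarrow> real" and \<beta> :: real and xs
    assume sco: "heavy_tailed_sco k G X P f" and "is_arg_min (pop_loss P f) (\<lambda>x. x \<in> X) xs"
      and glm: "\<forall>s\<in>space P. \<forall>x\<in>X. f x s = \<sigma> (s \<bullet> x)"
      and smooth: "\<forall>s\<in>space P. smooth_on X \<beta> (\<lambda>x. f x s)"
      and \<beta>: "\<rho> > 0 \<longrightarrow> \<beta> \<le> max (sqrt (real n / 2) * (G 2 / D))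
          (real n * (real DIM('a) / (real n ^ 2 * \<rho>)) powr ((real k - 1) / (2 * real k)) * (G k / D))"
    then have xs: "xs \<in> X" by (simp add: is_arg_min_def)
    have ht: "heavy_tailed k G X P f" using assms sco by unfold_locales
    interpret heavy_tailed k G X P f by (rule ht)
    interpret run: phased_run k G X P f n A
      using valid M(1) by unfold_locales (simp_all add: A_sel)
    have step_le: "step_size A i \<le> \<eta>1" for i
      using \<eta>0 by (simp add: A_sel mult_le_cancel_left1 power_le_one)
    \<comment> \<open>Each alternative in the maximum bounding \<beta> meets one branch of the
      minimum defining \<eta>1: the products are at most 1 / sqrt 2 and 1/8. A nonpositive \<beta>
      is separated because multiplying by the larger \<eta>1 would go the wrong way.\<close>
    have step_\<beta>: "step_size A i * \<beta> \<le> 2" for i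
    proof (cases "\<beta> \<le> 0")
      case True
      then have "step_size A i * \<beta> \<le> 0" using A_pos(1)[of i] by (simp add: mult_le_0_iff)
      then show ?thesis by simp
    next
      case False
      have b: "\<beta> \<le> max (sqrt (real n / 2) * (G 2 / D)) (real n * R * (G k / D))"
        using \<beta> \<rho> R_eq by (simp add: d_def)
      have "\<eta>1 * (sqrt (real n / 2) * (G 2 / D)) \<le> D / (G 2 * sqrt (real n)) * (sqrt (real n / 2) * (G 2 / D))"
        using G2 D by (intro mult_right_mono) (auto simp: \<eta>1_def)
      also have "\<dots> = 1 / sqrt 2" using G2 D n0 by (simp add: real_sqrt_divide)
      also have "\<dots> \<le> 1 / 1" by (intro divide_left_mono) auto
      finally have 1: "\<eta>1 * (sqrt (real n / 2) * (G 2 / D)) \<le> 2" by simp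
      have "\<eta>1 * (real n * R * (G k / D)) \<le> D / (8 * real n * R * G k) * (real n * R * (G k / D))"
        using Gk0 R0 D by (intro mult_right_mono) (auto simp: \<eta>1_def)
      also have "\<dots> = 1 / 8" using Gk0 D n0 R0 by simp
      also have "\<dots> \<le> 2" by simp
      finally have 2: "\<eta>1 * (real n * R * (G k / D)) \<le> 2" .
      have "step_size A i * \<beta> \<le> \<eta>1 * \<beta>"
        using False step_le by (intro mult_right_mono) auto
      also have "\<dots> \<le> \<eta>1 * max (sqrt (real n / 2) * (G 2 / D)) (real n * R * (G k / D))"
        using \<eta>0 b by (intro mult_left_mono) auto
      also have "\<dots> \<le> 2" using 1 2 by (simp add: max_def)
      finally show ?thesis .
    qed
    show "CDP \<rho> n (space P) (phased_law X A n g)"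
    proof (rule phased_law_CDP[OF X(2) closedX valid A_pos(3) g_measurable assms(8)])
      show "norm (x - step_size A i *\<^sub>R clip (clip_level A i) (g x s) - (y - step_size A i *\<^sub>R clip (clip_level A i) (g y s)))
          \<le> norm (x - y)" if "x \<in> X" "y \<in> X" "s \<in> space P" for i x y s
        by (rule glm_step_nonexpansive[OF ht glm smooth that A_pos(2,1) step_\<beta>])
      show "(2 * step_size A i * clip_level A i)\<^sup>2 \<le> 2 * \<rho> * (noise_dev A i)\<^sup>2" for i
        using \<rho> by (simp add: A_sel power_mult_distrib)
    qed
    show "phased_law X A n g \<in> PiM {..<n} (\<lambda>_. P) \<rightarrow>\<^sub>M prob_algebra (restrict_space borel X)"
      by (rule phased_law_measurable[OF X(2) closedX valid g_measurable])
    show "\<forall>z \<in> {..<n} \<rightarrow>\<^sub>E space P. \<forall>\<xi> \<in> space (phased_noise A).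
        phased_queries X A n g z \<xi> \<subseteq> X \<times> z ` {..<n} \<and> card (phased_queries X A n g z \<xi>) \<le> n"
      using x0 by (intro ballI conjI phased_queries_bound[OF closedX]) (simp_all add: A_sel)
    have N: "3 / 4 * (real n / 2 ^ i) \<le> real (n div 2 ^ i)" if "i \<in> {1..M}" for i
    proof (rule phase_length_ge)
      have "(2::nat) ^ (i + 2) \<le> 2 ^ (M + 2)" using that by (intro power_increasing) auto
      then show "2 ^ (i + 2) \<le> n" using M(2) by (rule order_trans)
    qed
    have B: "(\<integral>s. max 0 (L s - clip_level A i) \<partial>P) \<le> G k * R * (2 / 3) ^ (i - 1)" for i
    proof -
      define q where "q = (3 / 2 :: real) ^ (i - 1)"
      have q: "q \<ge> 1" by (simp add: q_def one_le_power)
      have "(\<integral>s. max 0 (L s - clip_level A i) \<partial>P) \<le> G k ^ k / (c * q) ^ (k - 1)"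
        using clip_bias_le[OF A_pos(2)[of i]] by (simp add: A_sel q_def)
      also have "\<dots> = G k * R / q ^ (k - 1)"
        by (simp only: power_mult_distrib bias divide_divide_eq_left[symmetric])
      \<comment> \<open>Since k \<ge> 2, the exponent \<open>k - 1\<close> is at least 1; the bias
        therefore decays at least as fast as the clipping level grows.\<close>
      also have "\<dots> \<le> G k * R / q"
      proof (rule divide_left_mono)
        show "q \<le> q ^ (k - 1)" using q assms(5) power_increasing[of 1 "k - 1" q] by simp
      qed (use Gk0 R0 q in auto)
      also have "\<dots> = G k * R * (2 / 3) ^ (i - 1)" by (simp add: q_def power_divide)
      finally show ?thesis .
    qed
    have V: "(\<integral>s. (L s)\<^sup>2 \<partial>P) \<le> (G 2)\<^sup>2" using L_moment(2)[of 2] k by simp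
    have "real n \<le> 16 * 36 ^ (M - 1)"
    proof -
      have "real n \<le> real (2 ^ (M + 3))" using M(3) by (intro of_nat_mono) simp
      also have "\<dots> = 16 * 2 ^ (M - 1)" using M(1) by (cases M) (auto simp: power_add)
      also have "\<dots> \<le> 16 * 36 ^ (M - 1)" by (simp add: power_mono)
      finally show ?thesis .
    qed
    note phased_bound[OF D G2 Gk0 c0 r0 R0 \<rho> n0 \<eta>0 G1_nonneg Gk(2) M(1) this rc d \<eta>1_def N V B]
    then have "(\<integral>w. F (run.out M w) - F xs \<partial>(PiM {..<n} (\<lambda>_. P) \<Otimes>\<^sub>M phased_noise A))
        \<le> 4 * G 2 * D * sqrt (1 / real n) + 26 * G k * D * R"
      using run.total_gap[OF xs] unfolding A_sel assms(4) d_def by linarith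
    then show "(\<integral>z. (\<integral>x. F x - F xs \<partial>phased_law X A n g z) \<partial>PiM {..<n} (\<lambda>_. P))
        \<le> 4 * G 2 * D * sqrt (1 / real n)
           + 26 * G k * D * (sqrt (real DIM('a)) / (real n * sqrt \<rho>)) powr (1 - 1 / real k)"
      unfolding run.excess_risk_eq[OF xs] by (simp add: A_sel R_def r_def d_def)
  qed
qed

end
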